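(* Let $X$ be a Lorentzian pre-length space with timelike curvature globally bounded above by $0$. Let $\gamma$ be a complete timelike line in $X$ and define $$S=\{\alpha:\alpha\text{ is a complete timelike line weakly parallel to }\gamma\}/\sim,$$ where $\alpha\sim\beta$ if there exists $c\in\mathbb{R}$ such that $\alpha(t)=\beta(t+c)$ for all $t\in\mathbb{R}$. Then: (1) Each element of $S$ has a representative which is synchronised parallel to $\gamma$, and these representatives are synchronised parallel to each other. (2) The quantity $$d_S([\alpha],[\beta]):=\inf\{(t-s)/2:\ \beta(s)\leq\alpha(0)\leq\beta(t)\}$$ does not depend on the chosen representatives, and it is the spacelike distance between the synchronised parallel representatives of $[\alpha]$ and $[\beta]$. (3) $d_S$ is a metric on $S$ such that $(S,d_S)$ is a $\mathrm{CAT}(0)$ space, and the map $f\colon {}^{-}\mathbb{R}\times S\to X$, $(t,[\alpha])\mapsto\alpha(t)$, where $\alpha$ is the unique representative of $[\alpha]$ that is synchronised parallel to $\gamma$, is an isometric embedding (i.e. an isometry onto its image, which is $\bigcup_{[\alpha]\in S}\alpha(\mathbb{R})$). (4) In particular, if $X=\bigcup_{[\alpha]\in S}\alpha(\mathbb{R})$, then $X$ is isometric to the Lorentzian product ${}^{-}\mathbb{R}\times S$, where $S$ is a $\mathrm{CAT}(0)$ space.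
   Context: A Lorentzian pre-length space is a tuple $(X,d,\ll,\leq,\tau)$, where $d$ is a metric on the set $X$, $\leq$ is a reflexive and transitive relation, $\ll$ is a transitive relation contained in $\leq$, and $\tau\colon X\times X\to[0,\infty]$ (time separation) is lower semicontinuous with respect to $d$, satisfies $\tau(x,z)\geq\tau(x,y)+\tau(y,z)$ for $x\leq y\leq z$, $\tau(x,y)=0$ if $x\not\leq y$, and $\tau(x,y)>0\iff x\ll y$. Two points are timelike related if $x\ll y$ or $y\ll x$. Curves: a future-directed causal (timelike) curve is a curve that is monotone with respect to $\leq$ (resp. $\ll$). $L_\tau(\gamma)=\inf\sum_i\tau(\gamma(t_i),\gamma(t_{i+1}))$ over all partitions. A future-directed geodesic is a causal curve $\gamma\colon I\to X$ with $\tau(\gamma(s),\gamma(t))=L_\tau(\gamma|_{[s,t]})$ for all $s\leq t$ in $I$. Timelike triangle: three pairwise timelike related points together with geodesics (sides) joining them. Comparison triangle: a timelike triangle in the Minkowski plane $\mathbb{R}^{1,1}$ with the same side lengths; comparison points are the points on corresponding sides with the same time separations to the endpoints. $X$ has timelike curvature globally bounded above by $0$ if: (i) $\tau$ is continuous on $\tau^{-1}([0,\infty))$ and this set is open; (ii) any $x\ll y$ with $\tau(x,y)<\infty$ are joined by a geodesic; (iii) for every timelike triangle having a comparison triangle in $\mathbb{R}^{1,1}$, and all points $p,q$ on its sides with comparison points $\bar p,\bar q$, one has $\tau(p,q)\geq\tau(\bar p,\bar q)$. (It is a known fact, recalled here, that geodesics between timelike related points are unique up to reparametrisation under such an upper curvature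 bound.) A complete timelike line is a (future-directed) curve $\alpha\colon\mathbb{R}\to X$ parametrised by $\tau$-arclength which is a geodesic between any of its points, i.e. $\tau(\alpha(s),\alpha(t))=t-s$ for all $s\leq t$. Two future-directed complete timelike lines $\alpha,\beta$ are weakly parallel if there are $s,s'\geq0$ such that $\alpha(t)\leq\beta(t+s)$ and $\beta(t)\leq\alpha(t+s')$ for all $t\in\mathbb{R}$. Two complete timelike lines $\alpha,\beta$ are synchronised parallel if there is $c\geq0$ such that for all $s<t$: $\alpha(s)\leq\beta(t)\iff t-s\geq c$, and in this case $\tau(\alpha(s),\beta(t))=\sqrt{(t-s)^2-c^2}$, and the same with $\alpha,\beta$ interchanged. The constant $c$ is the spacelike distance between $\alpha$ and $\beta$. Lorentzian product ${}^{-}\mathbb{R}\times S$ of $\mathbb{R}$ with a metric space $(S,d_S)$: the set $\mathbb{R}\times S$ with metric $\sqrt{|t-s|^2+d_S(x,y)^2}$, relations $(s,x)\ll(t,y)\iff t-s>d_S(x,y)$ and $(s,x)\leq(t,y)\iff t-s\geq d_S(x,y)$, and $\tau((s,x),(t,y))=\sqrt{(t-s)^2-d_S(x,y)^2}$ if $(s,x)\leq(t,y)$ and $0$ otherwise. A map $f$ between Lorentzian pre-length spaces is causality-preserving if $f(x)\leq f(y)\iff x\leq y$, and $\tau$-preserving if $\tau(f(x),f(y))=\tau(x,y)$ for all $x,y$. An isometry is a bijection that is $\tau$- and causality-preserving. A $\mathrm{CAT}(0)$ space is a geodesic metric space satisfying globally the triangle comparison condition for curvature $\leq0$ (completeness is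 not required).
   Formalization: The formal theorem also assumes that ≤ is closed in X×X and, as a hypothesis rather than a derived fact, that geodesics between timelike related points at finite τ are unique up to reparametrisation by τ-arclength (so contain no null pieces); without these the claim fails. *)

theory Defs
  imports "HOL-Analysis.Analysis"
begin

section \<open>Lorentzian pre-length spaces\<close>

text \<open>Underlying set, metric, timelike relation, causal relation and time separation. Only the
  values on the underlying set matter.\<close>

record 'a lspace =
  pts :: "'a set"
  ldist :: "'a \<Rightarrow> 'a \<Rightarrow> real"
  chron :: "'a \<Rightarrow> 'a \<Rightarrow> bool"
  caus :: "'a \<Rightarrow> 'a \<Rightarrow> bool"
  tsep :: "'a \<Rightarrow> 'a \<Rightarrow> ennreal"

abbreviation ltop :: "'a lspace \<Rightarrow> 'a topology" where
  "ltop X \<equiv> Metric_space.mtopology (pts X) (ldist X)"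

abbreviation ltop2 :: "'a lspace \<Rightarrow> ('a \<times> 'a) topology" where
  "ltop2 X \<equiv> prod_topology (ltop X) (ltop X)"

definition lorentzian_pre_length_space :: "'a lspace \<Rightarrow> bool" where
  "lorentzian_pre_length_space X \<longleftrightarrow>
     Metric_space (pts X) (ldist X) \<and>
     (\<forall>x\<in>pts X. caus X x x) \<and>
     (\<forall>x\<in>pts X. \<forall>y\<in>pts X. \<forall>z\<in>pts X. caus X x y \<longrightarrow> caus X y z \<longrightarrow> caus X x z) \<and>
     (\<forall>x\<in>pts X. \<forall>y\<in>pts X. \<forall>z\<in>pts X. chron X x y \<longrightarrow> chron X y z \<longrightarrow> chron X x z) \<and>
     (\<forall>x\<in>pts X. \<forall>y\<in>pts X. chron X x y \<longrightarrow> caus X x y) \<and>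
     (\<forall>c. openin (ltop2 X) {(x, y). x \<in> pts X \<and> y \<in> pts X \<and> c < tsep X x y}) \<and>
     (\<forall>x\<in>pts X. \<forall>y\<in>pts X. \<forall>z\<in>pts X. caus X x y \<longrightarrow> caus X y z \<longrightarrow>
        tsep X x y + tsep X y z \<le> tsep X x z) \<and>
     (\<forall>x\<in>pts X. \<forall>y\<in>pts X. \<not> caus X x y \<longrightarrow> tsep X x y = 0) \<and>
     (\<forall>x\<in>pts X. \<forall>y\<in>pts X. 0 < tsep X x y \<longleftrightarrow> chron X x y)"

section \<open>Curves and geodesics\<close>

definition causal_curve :: "'a lspace \<Rightarrow> real set \<Rightarrow> (real \<Rightarrow> 'a) \<Rightarrow> bool" where
  "causal_curve X I \<gamma> \<longleftrightarrow>
     is_interval I \<and> continuous_map (top_of_set I) (ltop X) \<gamma> \<and>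
     (\<forall>s\<in>I. \<forall>t\<in>I. s \<le> t \<longrightarrow> caus X (\<gamma> s) (\<gamma> t))"

definition tau_length :: "'a lspace \<Rightarrow> (real \<Rightarrow> 'a) \<Rightarrow> real \<Rightarrow> real \<Rightarrow> ennreal" where
  "tau_length X \<gamma> a b =
     Inf {(\<Sum>i<n. tsep X (\<gamma> (p i)) (\<gamma> (p (Suc i)))) | n p.
            p 0 = a \<and> p n = b \<and> (\<forall>i<n. p i < p (Suc i))}"

definition geodesic :: "'a lspace \<Rightarrow> real set \<Rightarrow> (real \<Rightarrow> 'a) \<Rightarrow> bool" where
  "geodesic X I \<gamma> \<longleftrightarrow> causal_curve X I \<gamma> \<and>
     (\<forall>s\<in>I. \<forall>t\<in>I. s \<le> t \<longrightarrow> tsep X (\<gamma> s) (\<gamma> t) = tau_length X \<gamma> s t)"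

text \<open>The set \<open>G\<close> is the image of a future-directed geodesic from \<open>x\<close> to \<open>y\<close>.\<close>

definition geodesic_segment :: "'a lspace \<Rightarrow> 'a \<Rightarrow> 'a \<Rightarrow> 'a set \<Rightarrow> bool" where
  "geodesic_segment X x y G \<longleftrightarrow>
     (\<exists>\<gamma> a b. a \<le> b \<and> geodesic X {a..b} \<gamma> \<and> \<gamma> a = x \<and> \<gamma> b = y \<and> G = \<gamma> ` {a..b})"

section \<open>Lorentzian products and the Minkowski plane\<close>

definition lorentz_product :: "'b set \<Rightarrow> ('b \<Rightarrow> 'b \<Rightarrow> real) \<Rightarrow> (real \<times> 'b) lspace" where
  "lorentz_product S d =
     \<lparr> pts = UNIV \<times> S,
       ldist = prod_dist dist d,
       chron = (\<lambda>(s, x) (t, y). t - s > d x y),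
       caus = (\<lambda>(s, x) (t, y). t - s \<ge> d x y),
       tsep = (\<lambda>(s, x) (t, y).
         if t - s \<ge> d x y then ennreal (sqrt ((t - s)\<^sup>2 - (d x y)\<^sup>2)) else 0) \<rparr>"

text \<open>\<open>(t, x)\<close> has time coordinate \<open>t\<close>; the plane is the Lorentzian product with the real line.\<close>

definition minkowski_plane :: "(real \<times> real) lspace" where
  "minkowski_plane = lorentz_product UNIV dist"

section \<open>Timelike curvature bounded above by zero\<close>

text \<open>The vertices of a timelike triangle are listed in chronological order. Three pairwise timelike
  related points that cannot be listed in this way form a cycle; their time separations
  are then infinite, so there is no comparison triangle.\<close>

definition timelike_triangle ::
  "'a lspace \<Rightarrow> 'a \<Rightarrow> 'a \<Rightarrow> 'a \<Rightarrow> 'a set \<Rightarrow> 'a set \<Rightarrow> 'a set \<Rightarrow> bool" where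
  "timelike_triangle X x y z A B C \<longleftrightarrow>
     x \<in> pts X \<and> y \<in> pts X \<and> z \<in> pts X \<and>
     chron X x y \<and> chron X y z \<and> chron X x z \<and>
     geodesic_segment X x y A \<and> geodesic_segment X y z B \<and> geodesic_segment X x z C"

definition comparison_triangle ::
  "'a lspace \<Rightarrow> 'a \<Rightarrow> 'a \<Rightarrow> 'a \<Rightarrow> real \<times> real \<Rightarrow> real \<times> real \<Rightarrow> real \<times> real \<Rightarrow> bool" where
  "comparison_triangle X x y z x' y' z' \<longleftrightarrow>
     chron minkowski_plane x' y' \<and> chron minkowski_plane y' z' \<and> chron minkowski_plane x' z' \<and>
     tsep minkowski_plane x' y' = tsep X x y \<and>
     tsep minkowski_plane y' z' = tsep X y z \<and>
     tsep minkowski_plane x' z' = tsep X x z"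

text \<open>Pairs of a point on the side \<open>G\<close> from \<open>x\<close> to \<open>y\<close> and its comparison point. The side joining
  timelike related points of the Minkowski plane is the straight segment.\<close>

definition comparison_points ::
  "'a lspace \<Rightarrow> 'a \<Rightarrow> 'a \<Rightarrow> 'a set \<Rightarrow> real \<times> real \<Rightarrow> real \<times> real \<Rightarrow> ('a \<times> (real \<times> real)) set" where
  "comparison_points X x y G x' y' =
     {(p, p'). p \<in> G \<and> p' \<in> closed_segment x' y' \<and>
        tsep minkowski_plane x' p' = tsep X x p \<and> tsep minkowski_plane p' y' = tsep X p y}"

definition timelike_curvature_bounded_above_0 :: "'a lspace \<Rightarrow> bool" where
  "timelike_curvature_bounded_above_0 X \<longleftrightarrow>
     (let U = {(x, y). x \<in> pts X \<and> y \<in> pts X \<and> tsep X x y < \<infinity>} in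
        openin (ltop2 X) U \<and>
        continuous_map (subtopology (ltop2 X) U) euclidean (\<lambda>(x, y). tsep X x y)) \<and>
     (\<forall>x\<in>pts X. \<forall>y\<in>pts X. chron X x y \<longrightarrow> tsep X x y < \<infinity> \<longrightarrow>
        (\<exists>G. geodesic_segment X x y G)) \<and>
     (\<forall>x y z A B C x' y' z'.
        timelike_triangle X x y z A B C \<longrightarrow> comparison_triangle X x y z x' y' z' \<longrightarrow>
        (let T = comparison_points X x y A x' y' \<union> comparison_points X y z B y' z' \<union>
                 comparison_points X x z C x' z'
         in \<forall>(p, p')\<in>T. \<forall>(q, q')\<in>T. tsep minkowski_plane p' q' \<le> tsep X p q))"

text \<open>Any two geodesics from \<open>x\<close> to \<open>y\<close> are reparametrisations of one and the same curve
  parametrised by the time separation from \<open>x\<close>. The case \<open>G = H\<close> says that a geodesic between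
  timelike related points contains no null piece, so that it has such a parametrisation. Neither
  this condition nor the next one follows from the axioms above.\<close>

definition unique_timelike_geodesics :: "'a lspace \<Rightarrow> bool" where
  "unique_timelike_geodesics X \<longleftrightarrow>
     (\<forall>x\<in>pts X. \<forall>y\<in>pts X. chron X x y \<longrightarrow> tsep X x y < \<infinity> \<longrightarrow>
        (\<forall>G H. geodesic_segment X x y G \<longrightarrow> geodesic_segment X x y H \<longrightarrow>
           (\<forall>p\<in>G. \<forall>q\<in>H. tsep X x p = tsep X x q \<longrightarrow> p = q)))"

definition causally_closed :: "'a lspace \<Rightarrow> bool" where
  "causally_closed X \<longleftrightarrow> closedin (ltop2 X) {(x, y). x \<in> pts X \<and> y \<in> pts X \<and> caus X x y}"

section \<open>Complete timelike lines and parallelity\<close>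

definition complete_timelike_line :: "'a lspace \<Rightarrow> (real \<Rightarrow> 'a) \<Rightarrow> bool" where
  "complete_timelike_line X \<alpha> \<longleftrightarrow> geodesic X UNIV \<alpha> \<and>
     (\<forall>s t. s \<le> t \<longrightarrow> tsep X (\<alpha> s) (\<alpha> t) = ennreal (t - s))"

definition weakly_parallel :: "'a lspace \<Rightarrow> (real \<Rightarrow> 'a) \<Rightarrow> (real \<Rightarrow> 'a) \<Rightarrow> bool" where
  "weakly_parallel X \<alpha> \<beta> \<longleftrightarrow>
     (\<exists>s\<ge>0. \<exists>s'\<ge>0. \<forall>t. caus X (\<alpha> t) (\<beta> (t + s)) \<and> caus X (\<beta> t) (\<alpha> (t + s')))"

definition synchronised_parallel_at ::
  "'a lspace \<Rightarrow> real \<Rightarrow> (real \<Rightarrow> 'a) \<Rightarrow> (real \<Rightarrow> 'a) \<Rightarrow> bool" where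
  "synchronised_parallel_at X c \<alpha> \<beta> \<longleftrightarrow> 0 \<le> c \<and>
     (\<forall>s t. s < t \<longrightarrow>
        (caus X (\<alpha> s) (\<beta> t) \<longleftrightarrow> c \<le> t - s) \<and>
        (c \<le> t - s \<longrightarrow> tsep X (\<alpha> s) (\<beta> t) = ennreal (sqrt ((t - s)\<^sup>2 - c\<^sup>2))) \<and>
        (caus X (\<beta> s) (\<alpha> t) \<longleftrightarrow> c \<le> t - s) \<and>
        (c \<le> t - s \<longrightarrow> tsep X (\<beta> s) (\<alpha> t) = ennreal (sqrt ((t - s)\<^sup>2 - c\<^sup>2))))"

definition synchronised_parallel :: "'a lspace \<Rightarrow> (real \<Rightarrow> 'a) \<Rightarrow> (real \<Rightarrow> 'a) \<Rightarrow> bool" where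
  "synchronised_parallel X \<alpha> \<beta> \<longleftrightarrow> (\<exists>c. synchronised_parallel_at X c \<alpha> \<beta>)"

definition lines_parallel_to :: "'a lspace \<Rightarrow> (real \<Rightarrow> 'a) \<Rightarrow> (real \<Rightarrow> 'a) set" where
  "lines_parallel_to X \<gamma> = {\<alpha>. complete_timelike_line X \<alpha> \<and> weakly_parallel X \<alpha> \<gamma>}"

definition shift_rel :: "'a lspace \<Rightarrow> (real \<Rightarrow> 'a) \<Rightarrow> ((real \<Rightarrow> 'a) \<times> (real \<Rightarrow> 'a)) set" where
  "shift_rel X \<gamma> =
     {(\<alpha>, \<beta>). \<alpha> \<in> lines_parallel_to X \<gamma> \<and> \<beta> \<in> lines_parallel_to X \<gamma> \<and>
        (\<exists>c. \<forall>t. \<alpha> t = \<beta> (t + c))}"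

definition line_classes :: "'a lspace \<Rightarrow> (real \<Rightarrow> 'a) \<Rightarrow> (real \<Rightarrow> 'a) set set" where
  "line_classes X \<gamma> = lines_parallel_to X \<gamma> // shift_rel X \<gamma>"

definition line_dist :: "'a lspace \<Rightarrow> (real \<Rightarrow> 'a) \<Rightarrow> (real \<Rightarrow> 'a) \<Rightarrow> real" where
  "line_dist X \<alpha> \<beta> = Inf {(t - s) / 2 | s t. caus X (\<beta> s) (\<alpha> 0) \<and> caus X (\<alpha> 0) (\<beta> t)}"

text \<open>The value 0 outside \<open>line_classes X \<gamma>\<close> is immaterial; it is there because
  \<^const>\<open>Metric_space\<close> asks for symmetry and nonnegativity off the carrier too.\<close>

definition class_dist ::
  "'a lspace \<Rightarrow> (real \<Rightarrow> 'a) \<Rightarrow> (real \<Rightarrow> 'a) set \<Rightarrow> (real \<Rightarrow> 'a) set \<Rightarrow> real" where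
  "class_dist X \<gamma> A B =
     (if A \<in> line_classes X \<gamma> \<and> B \<in> line_classes X \<gamma>
      then line_dist X (SOME \<alpha>. \<alpha> \<in> A) (SOME \<beta>. \<beta> \<in> B) else 0)"

definition splitting_map :: "'a lspace \<Rightarrow> (real \<Rightarrow> 'a) \<Rightarrow> real \<times> (real \<Rightarrow> 'a) set \<Rightarrow> 'a" where
  "splitting_map X \<gamma> = (\<lambda>(t, A). (THE \<alpha>. \<alpha> \<in> A \<and> synchronised_parallel X \<alpha> \<gamma>) t)"

section \<open>Isometries\<close>

definition isometry :: "'a lspace \<Rightarrow> 'b lspace \<Rightarrow> ('a \<Rightarrow> 'b) \<Rightarrow> bool" where
  "isometry X Y f \<longleftrightarrow> bij_betw f (pts X) (pts Y) \<and>
     (\<forall>x\<in>pts X. \<forall>y\<in>pts X.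
        tsep Y (f x) (f y) = tsep X x y \<and> (caus Y (f x) (f y) \<longleftrightarrow> caus X x y))"

definition isometric_lspaces :: "'a lspace \<Rightarrow> 'b lspace \<Rightarrow> bool" where
  "isometric_lspaces X Y \<longleftrightarrow> (\<exists>f. isometry X Y f)"

definition isometric_embedding :: "'a lspace \<Rightarrow> 'b lspace \<Rightarrow> ('a \<Rightarrow> 'b) \<Rightarrow> bool" where
  "isometric_embedding X Y f \<longleftrightarrow>
     f ` pts X \<subseteq> pts Y \<and> isometry X (Y\<lparr>pts := f ` pts X\<rparr>) f"

section \<open>CAT(0) spaces\<close>

definition metric_segment :: "'b set \<Rightarrow> ('b \<Rightarrow> 'b \<Rightarrow> real) \<Rightarrow> 'b \<Rightarrow> 'b \<Rightarrow> 'b set \<Rightarrow> bool" where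
  "metric_segment S d x y G \<longleftrightarrow>
     (\<exists>\<sigma>. \<sigma> ` {0..d x y} = G \<and> G \<subseteq> S \<and> \<sigma> 0 = x \<and> \<sigma> (d x y) = y \<and>
          (\<forall>s\<in>{0..d x y}. \<forall>t\<in>{0..d x y}. d (\<sigma> s) (\<sigma> t) = \<bar>s - t\<bar>))"

definition euclidean_comparison_points ::
  "('b \<Rightarrow> 'b \<Rightarrow> real) \<Rightarrow> 'b \<Rightarrow> 'b \<Rightarrow> 'b set \<Rightarrow> real ^ 2 \<Rightarrow> real ^ 2 \<Rightarrow> ('b \<times> (real ^ 2)) set" where
  "euclidean_comparison_points d x y G x' y' =
     {(p, p'). p \<in> G \<and> p' \<in> closed_segment x' y' \<and> dist x' p' = d x p \<and> dist p' y' = d p y}"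

definition CAT0_space :: "'b set \<Rightarrow> ('b \<Rightarrow> 'b \<Rightarrow> real) \<Rightarrow> bool" where
  "CAT0_space S d \<longleftrightarrow> Metric_space S d \<and>
     (\<forall>x\<in>S. \<forall>y\<in>S. \<exists>G. metric_segment S d x y G) \<and>
     (\<forall>x\<in>S. \<forall>y\<in>S. \<forall>z\<in>S. \<forall>A B C x' y' z'.
        metric_segment S d x y A \<longrightarrow> metric_segment S d y z B \<longrightarrow> metric_segment S d x z C \<longrightarrow>
        dist x' y' = d x y \<longrightarrow> dist y' z' = d y z \<longrightarrow> dist x' z' = d x z \<longrightarrow>
        (let T = euclidean_comparison_points d x y A x' y' \<union>
                 euclidean_comparison_points d y z B y' z' \<union>
                 euclidean_comparison_points d x z C x' z'
         in \<forall>(p, p')\<in>T. \<forall>(q, q')\<in>T. d p q \<le> dist p' q'))"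

end

theory Submission
  imports Defs
begin

text \<open>
  The proof rests on a rigidity of pairs of weakly parallel lines \<open>\<alpha>\<close>, \<open>\<beta>\<close>. Comparison in the two
  halves of a quadrilateral shows that, where it is positive, \<open>\<tau>(\<alpha>(a), \<beta>(b))\<close> is concave in
  \<open>(a, b)\<close> along directions in which both parameters increase. In the direction \<open>(1, 1)\<close> it is
  nonnegative on a whole line, hence constant: \<open>\<tau>(\<alpha>(a), \<beta>(b)) = g(b - a)\<close>, and likewise
  \<open>\<tau>(\<beta>(a), \<alpha>(b)) = h(b - a)\<close>. Comparison with the midpoint of a diagonal gives a Lorentzian
  parallelogram inequality for chronological quadruples (\<open>four_point_inequality\<close>). Applied to
  \<open>\<alpha>(0)\<close>, \<open>\<alpha>(t)\<close>, \<open>\<beta>(r)\<close>, \<open>\<beta>(r + t)\<close> it says that \<open>g(w)\<^sup>2 - w\<^sup>2\<close> for large \<open>w\<close> and \<open>h(-w)\<^sup>2 - w\<^sup>2\<close>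
  for very negative \<open>w\<close> are the two ends of one midpoint convex function. The reverse triangle
  inequality along \<open>\<alpha>\<close>, \<open>\<beta>\<close>, \<open>\<alpha>\<close> says that its slope at \<open>\<infinity>\<close> does not exceed its slope at \<open>-\<infinity>\<close>, so
  the function is affine (\<open>hyperbola_rigidity\<close>). After a shift of \<open>\<beta>\<close> which makes it constant, say
  \<open>-c\<^sup>2\<close>, both \<open>g\<close> and \<open>h\<close> are \<open>sqrt (w\<^sup>2 - c\<^sup>2)\<close>: the two lines span a flat strip
  (\<open>parallel_flat_pair\<close>).

  The right shift is the one for which \<open>g(w) - w\<close> and \<open>h(w) - w\<close> tend to \<open>0\<close>. By the reverse
  triangle inequality this property is inherited by the pair \<open>\<alpha>\<close>, \<open>\<delta>\<close> from \<open>\<alpha>\<close>, \<open>\<beta>\<close> and \<open>\<beta>\<close>, \<open>\<delta>\<close>,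
  so that synchronisation is transitive (\<open>flat_pair_trans\<close>). The causal relations of flat pairs
  then yield the formula for the distance of classes, its independence of representatives, and the
  axioms of a metric. Only definiteness uses more: lines at distance \<open>0\<close> agree by uniqueness of
  geodesics.

  Geodesics of the space of lines are found in the strip between \<open>\<alpha>\<close> and \<open>\<beta>\<close>. The points dividing
  the geodesics from \<open>\<alpha>(a)\<close> to \<open>\<beta>(a + r)\<close> in a fixed ratio form a line: concavity bounds their
  separations from below, and remote points of \<open>\<alpha>\<close> bound them from above (\<open>strip_line\<close>,
  \<open>strip_foliation\<close>). For the CAT(0) condition, put a long timelike triangle on three lines. In
  Stewart's theorem in the Minkowski plane the time coordinates cancel, and what remains is the CN
  inequality of Bruhat and Tits for the spatial distances (\<open>flat_pair_CN\<close>), which is equivalent to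
  triangle comparison.
\<close>

section \<open>The real-valued time separation\<close>

locale upper_curvature_zero =
  fixes X :: "'a lspace"
  assumes pre_length: "lorentzian_pre_length_space X"
    and curvature: "timelike_curvature_bounded_above_0 X"
    and unique_geodesics: "unique_timelike_geodesics X"
    and closed_causality: "causally_closed X"
begin

text \<open>Meaningful only for pairs at finite separation: infinite separations become \<open>0\<close>.\<close>

definition T :: "'a \<Rightarrow> 'a \<Rightarrow> real" where
  "T x y = enn2real (tsep X x y)"

definition fin :: "'a \<Rightarrow> 'a \<Rightarrow> bool" where
  "fin x y \<longleftrightarrow> tsep X x y < top"

lemma tsep_eq_T: "fin x y \<Longrightarrow> tsep X x y = ennreal (T x y)"
  by (simp add: fin_def T_def)

lemma T_nonneg [simp]: "0 \<le> T x y"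
  by (simp add: T_def)

lemma fin_T_eqI: "tsep X x y = ennreal r \<Longrightarrow> 0 \<le> r \<Longrightarrow> fin x y \<and> T x y = r"
  by (simp add: fin_def T_def)

lemma axioms_unfolded:
  shows metric_pts: "Metric_space (pts X) (ldist X)"
    and caus_refl: "\<And>x. x \<in> pts X \<Longrightarrow> caus X x x"
    and caus_trans: "\<And>x y z. caus X x y \<Longrightarrow> caus X y z \<Longrightarrow>
      x \<in> pts X \<Longrightarrow> y \<in> pts X \<Longrightarrow> z \<in> pts X \<Longrightarrow> caus X x z"
    and chron_imp_caus: "\<And>x y. chron X x y \<Longrightarrow> x \<in> pts X \<Longrightarrow> y \<in> pts X \<Longrightarrow> caus X x y"
    and tsep_triangle: "\<And>x y z. caus X x y \<Longrightarrow> caus X y z \<Longrightarrow>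
      x \<in> pts X \<Longrightarrow> y \<in> pts X \<Longrightarrow> z \<in> pts X \<Longrightarrow> tsep X x y + tsep X y z \<le> tsep X x z"
    and tsep_not_caus: "\<And>x y. \<not> caus X x y \<Longrightarrow> x \<in> pts X \<Longrightarrow> y \<in> pts X \<Longrightarrow> tsep X x y = 0"
    and tsep_pos_iff: "\<And>x y. x \<in> pts X \<Longrightarrow> y \<in> pts X \<Longrightarrow> 0 < tsep X x y \<longleftrightarrow> chron X x y"
proof -
  note * = pre_length[unfolded lorentzian_pre_length_space_def]
  note ** = *[THEN conjunct2] note *** = **[THEN conjunct2, THEN conjunct2]
  note t = ***[THEN conjunct2, THEN conjunct2]
  show "Metric_space (pts X) (ldist X)" by (rule *[THEN conjunct1])
  show "\<And>x. x \<in> pts X \<Longrightarrow> caus X x x" using **[THEN conjunct1] by blast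
  show "\<And>x y z. caus X x y \<Longrightarrow> caus X y z \<Longrightarrow>
      x \<in> pts X \<Longrightarrow> y \<in> pts X \<Longrightarrow> z \<in> pts X \<Longrightarrow> caus X x z"
    using **[THEN conjunct2, THEN conjunct1] by blast
  show "\<And>x y. chron X x y \<Longrightarrow> x \<in> pts X \<Longrightarrow> y \<in> pts X \<Longrightarrow> caus X x y"
    using ***[THEN conjunct2, THEN conjunct1] by blast
  show "\<And>x y z. caus X x y \<Longrightarrow> caus X y z \<Longrightarrow>
      x \<in> pts X \<Longrightarrow> y \<in> pts X \<Longrightarrow> z \<in> pts X \<Longrightarrow> tsep X x y + tsep X y z \<le> tsep X x z"
    using t[THEN conjunct2, THEN conjunct1] by blast
  show "\<And>x y. \<not> caus X x y \<Longrightarrow> x \<in> pts X \<Longrightarrow> y \<in> pts X \<Longrightarrow> tsep X x y = 0"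
    using t[THEN conjunct2, THEN conjunct2, THEN conjunct1] by blast
  show "\<And>x y. x \<in> pts X \<Longrightarrow> y \<in> pts X \<Longrightarrow> 0 < tsep X x y \<longleftrightarrow> chron X x y"
    using t[THEN conjunct2, THEN conjunct2, THEN conjunct2] by blast
qed

lemma not_caus_fin:
  assumes "\<not> caus X x y" "x \<in> pts X" "y \<in> pts X"
  shows "fin x y" "T x y = 0"
  using tsep_not_caus[OF assms] unfolding T_def fin_def by auto

lemma chron_iff:
  assumes "fin x y" "x \<in> pts X" "y \<in> pts X"
  shows "chron X x y \<longleftrightarrow> 0 < T x y"
proof -
  have "chron X x y \<longleftrightarrow> 0 < tsep X x y"
    using tsep_pos_iff[OF assms(2,3)] by simp
  then show ?thesis using tsep_eq_T[OF assms(1)] by simp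
qed

lemma T_pos_imp_caus: "0 < T x y \<Longrightarrow> x \<in> pts X \<Longrightarrow> y \<in> pts X \<Longrightarrow> caus X x y"
  using not_caus_fin by fastforce

text \<open>Finiteness is inherited by subintervals of a causal chain, so the reverse triangle
  inequality may be used over the reals as soon as its largest term is finite.\<close>

lemma T_triangle:
  assumes "caus X x y" "caus X y z" "fin x z" "x \<in> pts X" "y \<in> pts X" "z \<in> pts X"
  shows "fin x y" "fin y z" "T x y + T y z \<le> T x z"
proof -
  have le: "tsep X x y + tsep X y z \<le> tsep X x z" using tsep_triangle assms by blast
  then show f: "fin x y" "fin y z"
    using assms(3) unfolding fin_def by (auto simp: top.not_eq_extremum[symmetric] top_unique)
  show "T x y + T y z \<le> T x z"
    using le unfolding tsep_eq_T[OF f(1)] tsep_eq_T[OF f(2)] tsep_eq_T[OF assms(3)]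
    by (simp flip: ennreal_plus)
qed

lemma fin_between:
  assumes "fin x z" "caus X x p" "caus X q z" "x \<in> pts X" "p \<in> pts X" "q \<in> pts X" "z \<in> pts X"
  shows "fin p q"
proof (cases "caus X p q")
  case True
  then have "caus X x q" using caus_trans assms by blast
  then have "fin x q" using T_triangle assms by blast
  then show ?thesis using T_triangle assms True by blast
next
  case False
  then show ?thesis using not_caus_fin assms by blast
qed

lemma fin_diag: "fin x y \<Longrightarrow> caus X x y \<Longrightarrow> x \<in> pts X \<Longrightarrow> y \<in> pts X \<Longrightarrow>
    T x x = 0 \<and> T y y = 0 \<and> fin x x \<and> fin y y"
  using T_triangle[of x x y] T_triangle[of x y y] caus_refl T_nonneg[of x x] T_nonneg[of y y]
      by auto

section \<open>Geodesic segments\<close>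

text \<open>A partition into two pieces already bounds the length, so the reverse triangle inequality is
  an equality along a geodesic. Conversely, additivity makes all partition sums equal.\<close>

lemma geodesic_additive:
  assumes "geodesic X I \<sigma>" "r \<in> I" "s \<in> I" "t \<in> I" "r \<le> s" "s \<le> t" "fin (\<sigma> r) (\<sigma> t)"
  shows "T (\<sigma> r) (\<sigma> s) + T (\<sigma> s) (\<sigma> t) = T (\<sigma> r) (\<sigma> t)"
proof -
  have cc: "causal_curve X I \<sigma>" using assms geodesic_def by blast
  note M = metric_pts
  have p: "\<sigma> r \<in> pts X" "\<sigma> s \<in> pts X" "\<sigma> t \<in> pts X"
    using cc assms unfolding causal_curve_def continuous_map_def
    by (auto simp: Metric_space.topspace_mtopology[OF M])
  have c: "caus X (\<sigma> r) (\<sigma> s)" "caus X (\<sigma> s) (\<sigma> t)"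
    using cc assms unfolding causal_curve_def by auto
  note tri = T_triangle[OF c assms(7) p]
  show ?thesis
  proof (cases "r < s \<and> s < t")
    case True
    let ?p = "\<lambda>i::nat. if i = 0 then r else if i = 1 then s else t"
    have "tsep X (\<sigma> r) (\<sigma> t) = tau_length X \<sigma> r t" using assms unfolding geodesic_def by auto
    also have "\<dots> \<le> (\<Sum>i<2. tsep X (\<sigma> (?p i)) (\<sigma> (?p (Suc i))))"
      unfolding tau_length_def
      apply (rule Inf_lower) using True
      by (intro CollectI exI[of _ 2] exI[of _ ?p]) (auto simp: less_2_cases_iff)
    also have "\<dots> = tsep X (\<sigma> r) (\<sigma> s) + tsep X (\<sigma> s) (\<sigma> t)" by (simp add: numeral_2_eq_2)
    finally have "T (\<sigma> r) (\<sigma> t) \<le> T (\<sigma> r) (\<sigma> s) + T (\<sigma> s) (\<sigma> t)"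
      unfolding tsep_eq_T[OF tri(1)] tsep_eq_T[OF tri(2)] tsep_eq_T[OF assms(7)]
      by (simp flip: ennreal_plus)
    then show ?thesis using tri by simp
  next
    case False
    then have "r = s \<or> s = t" using assms by auto
    moreover have "T (\<sigma> r) (\<sigma> r) = 0" "T (\<sigma> t) (\<sigma> t) = 0"
      using fin_diag[OF assms(7) _ p(1,3)] caus_trans[OF c p] by auto
    ultimately show ?thesis by auto
  qed
qed

lemma geodesicI:
  assumes cc: "causal_curve X I \<sigma>"
    and f: "\<And>s t. s \<in> I \<Longrightarrow> t \<in> I \<Longrightarrow> s \<le> t \<Longrightarrow> fin (\<sigma> s) (\<sigma> t)"
    and add: "\<And>r s t. r \<in> I \<Longrightarrow> s \<in> I \<Longrightarrow> t \<in> I \<Longrightarrow> r \<le> s \<Longrightarrow> s \<le> t \<Longrightarrow>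
      T (\<sigma> r) (\<sigma> s) + T (\<sigma> s) (\<sigma> t) = T (\<sigma> r) (\<sigma> t)"
  shows "geodesic X I \<sigma>"
  unfolding geodesic_def
proof (intro conjI cc ballI impI)
  fix s t assume st: "s \<in> I" "t \<in> I" "s \<le> t"
  have int: "is_interval I" using cc causal_curve_def by blast
  have *: "(\<Sum>i<n. tsep X (\<sigma> (p i)) (\<sigma> (p (Suc i)))) = tsep X (\<sigma> s) (\<sigma> (p n)) \<and> s \<le> p n"
    if "p 0 = s" "\<And>i. i < n \<Longrightarrow> p i < p (Suc i)" "p n \<le> t" for n and p :: "nat \<Rightarrow> real"
    using that
  proof (induction n)
    case 0
    have "T (\<sigma> s) (\<sigma> s) = 0" using add[of s s s] st by simp
    then show ?case using 0 f[of s s] st by (simp add: tsep_eq_T)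
  next
    case (Suc n)
    have lt: "p n < p (Suc n)" using Suc by auto
    have IH: "(\<Sum>i<n. tsep X (\<sigma> (p i)) (\<sigma> (p (Suc i)))) = tsep X (\<sigma> s) (\<sigma> (p n)) \<and> s \<le> p n"
      using Suc lt by auto
    have inI: "p n \<in> I" "p (Suc n) \<in> I"
      using int st IH lt Suc.prems unfolding is_interval_1 by (meson less_imp_le order_trans)+
    have le: "s \<le> p n" "p n \<le> p (Suc n)" using IH lt by auto
    have "tsep X (\<sigma> s) (\<sigma> (p n)) + tsep X (\<sigma> (p n)) (\<sigma> (p (Suc n)))
        = ennreal (T (\<sigma> s) (\<sigma> (p n)) + T (\<sigma> (p n)) (\<sigma> (p (Suc n))))"
      using f[OF st(1) inI(1) le(1)] f[OF inI le(2)] by (simp add: tsep_eq_T)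
    also have "\<dots> = tsep X (\<sigma> s) (\<sigma> (p (Suc n)))"
      using add[OF st(1) inI le] f[OF st(1) inI(2)] le by (simp add: tsep_eq_T)
    finally show ?case using IH le by auto
  qed
  let ?S = "{(\<Sum>i<n. tsep X (\<sigma> (p i)) (\<sigma> (p (Suc i)))) | n p.
            p 0 = s \<and> p n = t \<and> (\<forall>i<n. p i < p (Suc i))}"
  have "\<exists>(n::nat) p. p 0 = s \<and> p n = t \<and> (\<forall>i<n. p i < p (Suc i))"
  proof (cases "s = t")
    case True then show ?thesis by (intro exI[of _ 0] exI[of _ "\<lambda>_. s"]) auto
  next
    case False then show ?thesis using st
      by (intro exI[of _ 1] exI[of _ "\<lambda>i. if i = 0 then s else t"]) auto
  qed
  then have ne: "?S \<noteq> {}" by blast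
  have sub: "?S \<subseteq> {tsep X (\<sigma> s) (\<sigma> t)}"
  proof
    fix w assume "w \<in> ?S"
    then obtain n :: nat and p where w: "w = (\<Sum>i<n. tsep X (\<sigma> (p i)) (\<sigma> (p (Suc i))))"
      and p: "p 0 = s" "p n = t" "\<And>i. i < n \<Longrightarrow> p i < p (Suc i)"
      by blast
    show "w \<in> {tsep X (\<sigma> s) (\<sigma> t)}" using *[OF p(1,3)] p(2) w by simp
  qed
  have "?S = {tsep X (\<sigma> s) (\<sigma> t)}" using subset_singletonD[OF sub] ne by argo
  then show "tsep X (\<sigma> s) (\<sigma> t) = tau_length X \<sigma> s t" unfolding tau_length_def by simp
qed

lemma topspace_ltop [simp]: "topspace (ltop X) = pts X"
  by (simp add: Metric_space.topspace_mtopology[OF metric_pts])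

lemma continuous_on_T:
  assumes f: "continuous_map (top_of_set I) (ltop X) f"
      and g: "continuous_map (top_of_set I) (ltop X) g"
    and fin: "\<And>t. t \<in> I \<Longrightarrow> fin (f t) (g t)"
  shows "continuous_on (I::real set) (\<lambda>t. T (f t) (g t))"
proof -
  define U where "U = {(x, y). x \<in> pts X \<and> y \<in> pts X \<and> tsep X x y < \<infinity>}"
  have U: "continuous_map (subtopology (ltop2 X) U) euclidean (\<lambda>(x, y). tsep X x y)"
    using curvature unfolding timelike_curvature_bounded_above_0_def Let_def U_def by blast
  have "f t \<in> pts X" "g t \<in> pts X" if "t \<in> I" for t
    using f g that unfolding continuous_map_def by auto
  then have "continuous_map (top_of_set I) (subtopology (ltop2 X) U) (\<lambda>t. (f t, g t))"
    using f g fin unfolding continuous_map_in_subtopology fin_def U_def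
    by (auto simp: continuous_map_pairwise o_def)
  from continuous_map_compose[OF this U]
  have "continuous_on I (\<lambda>t. tsep X (f t) (g t))" by (simp add: o_def)
  then show ?thesis unfolding T_def continuous_on_def
    using fin by (auto intro!: tendsto_intros simp: fin_def)
qed

lemma geodesic_segmentE:
  assumes "geodesic_segment X x y G" "fin x y" "x \<in> pts X" "y \<in> pts X"
  obtains \<sigma> a b where "a \<le> b" "geodesic X {a..b} \<sigma>" "\<sigma> a = x" "\<sigma> b = y" "G = \<sigma> ` {a..b}"
    "\<And>s. s \<in> {a..b} \<Longrightarrow> \<sigma> s \<in> pts X"
    "\<And>s t. a \<le> s \<Longrightarrow> s \<le> t \<Longrightarrow> t \<le> b \<Longrightarrow> caus X (\<sigma> s) (\<sigma> t)"
    "\<And>s t. a \<le> s \<Longrightarrow> s \<le> t \<Longrightarrow> t \<le> b \<Longrightarrow> fin (\<sigma> s) (\<sigma> t)"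
    "\<And>r s t. a \<le> r \<Longrightarrow> r \<le> s \<Longrightarrow> s \<le> t \<Longrightarrow> t \<le> b \<Longrightarrow> T (\<sigma> r) (\<sigma> s) + T (\<sigma> s) (\<sigma> t) = T (\<sigma> r) (\<sigma> t)"
    "continuous_on {a..b} (\<lambda>s. T x (\<sigma> s))"
    "continuous_map (top_of_set {a..b}) (ltop X) \<sigma>"
proof -
  obtain \<sigma> a b where g: "a \<le> b" "geodesic X {a..b} \<sigma>" "\<sigma> a = x" "\<sigma> b = y" "G = \<sigma> ` {a..b}"
    using assms unfolding geodesic_segment_def by blast
  then have cc: "causal_curve X {a..b} \<sigma>" unfolding geodesic_def by auto
  then have cont: "continuous_map (top_of_set {a..b}) (ltop X) \<sigma>"
    unfolding causal_curve_def by auto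
  then have p: "\<sigma> s \<in> pts X" if "s \<in> {a..b}" for s using that
    unfolding continuous_map_def by auto
  have c: "caus X (\<sigma> s) (\<sigma> t)" if "a \<le> s" "s \<le> t" "t \<le> b" for s t
    using cc that unfolding causal_curve_def by auto
  have f: "fin (\<sigma> s) (\<sigma> t)" if "a \<le> s" "s \<le> t" "t \<le> b" for s t
    by (rule fin_between[of x y]) (use assms c[of a s] c[of t b] p that g in auto)
  have "continuous_on {a..b} (\<lambda>s. T x (\<sigma> s))"
    by (rule continuous_on_T) (use cont f g assms in auto)
  then show thesis using that g p c f geodesic_additive[OF g(2)] cont by auto
qed

text \<open>The form in which points on sides of triangles are handled: the comparison point of \<open>p\<close> is
  the affine combination of the vertices with weights \<open>1 - l\<close> and \<open>l\<close>.\<close>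

definition divides :: "'a \<Rightarrow> 'a \<Rightarrow> real \<Rightarrow> 'a \<Rightarrow> bool" where
  "divides x y l p \<longleftrightarrow> l \<in> {0..1} \<and> (\<exists>G. geodesic_segment X x y G \<and> p \<in> G) \<and>
     T x p = l * T x y \<and> T p y = (1 - l) * T x y"

lemma dividesD:
  assumes "divides x y l p" "fin x y" "x \<in> pts X" "y \<in> pts X"
  shows "p \<in> pts X" "caus X x p" "caus X p y" "fin x p" "fin p y" "0 \<le> l" "l \<le> 1"
    "T x p = l * T x y" "T p y = (1 - l) * T x y"
proof -
  obtain G where G: "geodesic_segment X x y G" "p \<in> G" using assms divides_def by blast
  obtain \<sigma> a b where g: "a \<le> b" "geodesic X {a..b} \<sigma>" "\<sigma> a = x" "\<sigma> b = y" "G = \<sigma> ` {a..b}"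
    "\<And>s. s \<in> {a..b} \<Longrightarrow> \<sigma> s \<in> pts X"
    "\<And>s t. a \<le> s \<Longrightarrow> s \<le> t \<Longrightarrow> t \<le> b \<Longrightarrow> caus X (\<sigma> s) (\<sigma> t)"
    and f: "\<And>s t. a \<le> s \<Longrightarrow> s \<le> t \<Longrightarrow> t \<le> b \<Longrightarrow> fin (\<sigma> s) (\<sigma> t)"
    and add: "\<And>r s t. a \<le> r \<Longrightarrow> r \<le> s \<Longrightarrow> s \<le> t \<Longrightarrow> t \<le> b \<Longrightarrow> T (\<sigma> r) (\<sigma> s) + T (\<sigma> s) (\<sigma> t) = T (\<sigma> r) (\<sigma> t)"
    and cont: "continuous_on {a..b} (\<lambda>s. T x (\<sigma> s))"
    and "continuous_map (top_of_set {a..b}) (ltop X) \<sigma>"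
    by (rule geodesic_segmentE[OF G(1) assms(2-4)]) (rule that)
  obtain s where "s \<in> {a..b}" "p = \<sigma> s" using G g by auto
  then show "p \<in> pts X" "caus X x p" "caus X p y" "fin x p" "fin p y" using g f by fastforce+
  show "0 \<le> l" "l \<le> 1" "T x p = l * T x y" "T p y = (1 - l) * T x y"
    using assms by (auto simp: divides_def)
qed

text \<open>Along a geodesic the separation from \<open>x\<close> is continuous, hence takes all values up to
  \<open>T x y\<close>. The points \<open>P l\<close> are chosen on one and the same geodesic, so that their mutual
  separations are known too.\<close>

lemma affine_parametrisation:
  assumes "chron X x y" "fin x y" "x \<in> pts X" "y \<in> pts X"
  obtains P where "\<And>l. l \<in> {0..1} \<Longrightarrow> divides x y l (P l)" "P 0 = x" "P 1 = y"
    "\<And>k l. 0 \<le> k \<Longrightarrow> k \<le> l \<Longrightarrow> l \<le> 1 \<Longrightarrow> T (P k) (P l) = (l - k) * T x y"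
proof -
  have Tpos: "0 < T x y" using assms chron_iff by blast
  have "\<exists>G. geodesic_segment X x y G"
    using assms curvature unfolding timelike_curvature_bounded_above_0_def fin_def
        by (simp add: Let_def)
  then obtain G where G: "geodesic_segment X x y G" by blast
  obtain \<sigma> a b where g: "a \<le> b" "geodesic X {a..b} \<sigma>" "\<sigma> a = x" "\<sigma> b = y" "G = \<sigma> ` {a..b}"
    "\<And>s. s \<in> {a..b} \<Longrightarrow> \<sigma> s \<in> pts X"
    "\<And>s t. a \<le> s \<Longrightarrow> s \<le> t \<Longrightarrow> t \<le> b \<Longrightarrow> caus X (\<sigma> s) (\<sigma> t)"
    and f: "\<And>s t. a \<le> s \<Longrightarrow> s \<le> t \<Longrightarrow> t \<le> b \<Longrightarrow> fin (\<sigma> s) (\<sigma> t)"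
    and add: "\<And>r s t. a \<le> r \<Longrightarrow> r \<le> s \<Longrightarrow> s \<le> t \<Longrightarrow> t \<le> b \<Longrightarrow> T (\<sigma> r) (\<sigma> s) + T (\<sigma> s) (\<sigma> t) = T (\<sigma> r) (\<sigma> t)"
    and cont: "continuous_on {a..b} (\<lambda>s. T x (\<sigma> s))"
    and "continuous_map (top_of_set {a..b}) (ltop X) \<sigma>"
    by (rule geodesic_segmentE[OF G assms(2-4)]) (rule that)
  have T0: "T x x = 0" using add[of a a a] g by simp
  have "\<exists>u\<in>{a..b}. T x (\<sigma> u) = l * T x y" if "l \<in> {0..1}" for l
    using IVT'[OF _ _ g(1) cont, of "l * T x y"] that g T0 Tpos
    by (auto simp: mult_left_le_one_le)
  then obtain u0 where u0: "\<And>l. l \<in> {0..1} \<Longrightarrow> u0 l \<in> {a..b} \<and> T x (\<sigma> (u0 l)) = l * T x y"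
    by metis
  \<comment> \<open>a null initial or final piece of \<open>\<sigma>\<close> could put other points at the ratios \<open>0\<close> and \<open>1\<close>\<close>
  define u where "u l = (if l = 0 then a else if l = 1 then b else u0 l)" for l :: real
  have u: "u l \<in> {a..b} \<and> T x (\<sigma> (u l)) = l * T x y" if "l \<in> {0..1}" for l
    using u0[OF that] g T0 unfolding u_def by auto
  have Tk: "T (\<sigma> (u k)) (\<sigma> (u l)) = (l - k) * T x y" if kl: "0 \<le> k" "k \<le> l" "l \<le> 1" for k l
  proof (cases "k = l")
    case True
    then show ?thesis using add[of "u k" "u k" "u k"] u[of k] kl by simp
  next
    case False
    have "u k \<le> u l"
    proof (rule ccontr)
      assume "\<not> u k \<le> u l"
      then have "T x (\<sigma> (u l)) + T (\<sigma> (u l)) (\<sigma> (u k)) = T x (\<sigma> (u k))"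
        using add[of a "u l" "u k"] u[of k] u[of l] kl g by auto
      then have "T x (\<sigma> (u l)) \<le> T x (\<sigma> (u k))"
        using T_nonneg[of "\<sigma> (u l)" "\<sigma> (u k)"] by linarith
      then have "l * T x y \<le> k * T x y" using u[of k] u[of l] kl by auto
      then show False using Tpos False kl by auto
    qed
    then show ?thesis using add[of a "u k" "u l"] u[of k] u[of l] kl g by (auto simp: algebra_simps)
  qed
  have div: "divides x y l (\<sigma> (u l))" if "l \<in> {0..1}" for l
    unfolding divides_def using add[of a "u l" b] u[OF that] G g that
        by (auto simp: algebra_simps intro!: exI[of _ G])
  show thesis by (rule that[of "\<lambda>l. \<sigma> (u l)"]) (use div Tk g in \<open>auto simp: u_def\<close>)
qed

lemma divides_exists:
  assumes "chron X x y" "fin x y" "x \<in> pts X" "y \<in> pts X" "0 \<le> l" "l \<le> 1"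
  shows "\<exists>p. divides x y l p"
proof -
  obtain P where "\<And>l. l \<in> {0..1} \<Longrightarrow> divides x y l (P l)"
    by (rule affine_parametrisation[OF assms(1-4)]) (rule that)
  then show ?thesis using assms by auto
qed

lemma divides_ends:
  assumes "chron X x y" "fin x y" "x \<in> pts X" "y \<in> pts X"
  shows "divides x y 0 x" "divides x y 1 y"
proof -
  obtain P where "\<And>l. l \<in> {0..1} \<Longrightarrow> divides x y l (P l)" "P 0 = x" "P 1 = y"
    by (rule affine_parametrisation[OF assms]) (rule that)
  then show "divides x y 0 x" "divides x y 1 y" by (metis atLeastAtMost_iff order_refl zero_le_one)+
qed

lemma divides_unique:
  assumes "divides x y l p" "divides x y l q" "chron X x y" "fin x y" "x \<in> pts X" "y \<in> pts X"
  shows "p = q"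
proof -
  obtain G H where "geodesic_segment X x y G" "p \<in> G" "geodesic_segment X x y H" "q \<in> H"
    using assms unfolding divides_def by blast
  moreover have "tsep X x p = tsep X x q"
    using dividesD[OF assms(1,4-6)] dividesD[OF assms(2,4-6)] by (simp add: tsep_eq_T)
  ultimately show ?thesis
    using assms(3-6) unique_geodesics unfolding unique_timelike_geodesics_def fin_def
    by (metis infinity_ennreal_def)
qed

end

section \<open>Comparison with the Minkowski plane\<close>

lemma minkowski_chron: "chron minkowski_plane (s, x) (t, y) \<longleftrightarrow> \<bar>x - y\<bar> < t - s"
  by (simp add: minkowski_plane_def lorentz_product_def dist_real_def)

lemma minkowski_tsep:
  assumes "\<bar>x - y\<bar> \<le> t - s" "0 \<le> r" "r\<^sup>2 = (t - s)\<^sup>2 - (x - y)\<^sup>2"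
  shows "tsep minkowski_plane (s, x) (t, y) = ennreal r"
proof -
  have "sqrt ((t - s)\<^sup>2 - (x - y)\<^sup>2) = r" using assms by (metis real_sqrt_abs abs_of_nonneg)
  then show ?thesis using assms(1)
    by (simp add: minkowski_plane_def lorentz_product_def dist_real_def)
qed

lemma minkowski_tsep_scaled:
  assumes "t - s = r * u" "x - y = r * v" "0 \<le> r" "\<bar>v\<bar> \<le> u" "u\<^sup>2 - v\<^sup>2 = a\<^sup>2" "0 \<le> a"
  shows "tsep minkowski_plane (s, x) (t, y) = ennreal (r * a)"
proof (rule minkowski_tsep)
  show "\<bar>x - y\<bar> \<le> t - s" using assms by (simp add: abs_mult mult_left_mono)
  show "(r * a)\<^sup>2 = (t - s)\<^sup>2 - (x - y)\<^sup>2"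
    unfolding assms(1,2) power_mult_distrib assms(5)[symmetric] by (simp add: algebra_simps)
qed (use assms in auto)

text \<open>The Minkowski law of cosines for the triangle \<open>(0, 0)\<close>, \<open>(u, k)\<close>, \<open>(c, 0)\<close>, at the vertex
  \<open>(0, 0)\<close>.\<close>

lemma law_of_cosines:
  fixes u k a b c l m :: real
  assumes "u\<^sup>2 - k\<^sup>2 = a\<^sup>2" "(c - u)\<^sup>2 - k\<^sup>2 = b\<^sup>2"
  shows "(m * c - l * u)\<^sup>2 - (l * k)\<^sup>2 = m\<^sup>2 * c\<^sup>2 + l\<^sup>2 * a\<^sup>2 - l * m * (a\<^sup>2 + c\<^sup>2 - b\<^sup>2)"
proof -
  have *: "a\<^sup>2 + c\<^sup>2 - b\<^sup>2 = 2 * c * u" using assms by (simp add: power2_diff)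
  show ?thesis unfolding * unfolding assms(1)[symmetric]
      by (simp add: power2_eq_square algebra_simps)
qed

context upper_curvature_zero
begin

text \<open>Placing the long side of the triangle on the time axis, its comparison triangle has the
  vertices \<open>(0, 0)\<close>, \<open>(u, k)\<close> and \<open>(C, 0)\<close>.\<close>

lemma comparison_inequality:
  assumes pts: "x \<in> pts X" "y \<in> pts X" "z \<in> pts X"
    and ch: "chron X x y" "chron X y z" and fin: "fin x z"
  defines "A \<equiv> T x y" and "B \<equiv> T y z" and "C \<equiv> T x z"
  obtains u k where "0 \<le> k" "k < u" "k < C - u" "u\<^sup>2 - k\<^sup>2 = A\<^sup>2" "(C - u)\<^sup>2 - k\<^sup>2 = B\<^sup>2"
    "\<And>l p m q. divides x y l p \<Longrightarrow> divides x z m q \<Longrightarrow>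
       tsep minkowski_plane (l * u, l * k) (m * C, 0) \<le> tsep X p q"
    "\<And>l p m q. divides x z l p \<Longrightarrow> divides y z m q \<Longrightarrow>
       tsep minkowski_plane (l * C, 0) (u + m * (C - u), (1 - m) * k) \<le> tsep X p q"
proof -
  have caus: "caus X x y" "caus X y z" using ch chron_imp_caus pts by auto
  then have "caus X x z" using caus_trans pts by blast
  note tri = T_triangle[OF caus fin pts]
  have pos: "0 < A" "0 < B" using chron_iff tri pts ch unfolding A_def B_def by blast+
  have ABC: "A + B \<le> C" using tri unfolding A_def B_def C_def by auto
  then have "0 < C" using pos by linarith
  define u where "u = (A\<^sup>2 + C\<^sup>2 - B\<^sup>2) / (2 * C)"
  have u2: "2 * C * u = A\<^sup>2 + C\<^sup>2 - B\<^sup>2" using \<open>0 < C\<close> by (simp add: u_def)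
  have "B\<^sup>2 \<le> (C - A)\<^sup>2" "A\<^sup>2 \<le> (C - B)\<^sup>2" using ABC pos by (auto intro!: power_mono)
  then have "2 * C * A \<le> 2 * C * u" "2 * C * B \<le> 2 * C * (C - u)"
    unfolding u2 right_diff_distrib
        by (auto simp: algebra_simps power2_eq_square u2[unfolded power2_eq_square])
  then have uA: "A \<le> u" "B \<le> C - u" using \<open>0 < C\<close> by auto
  define k where "k = sqrt (u\<^sup>2 - A\<^sup>2)"
  have "A\<^sup>2 \<le> u\<^sup>2" using uA pos by (auto intro!: power_mono)
  then have k: "0 \<le> k" "k\<^sup>2 = u\<^sup>2 - A\<^sup>2" by (auto simp: k_def)
  have 1: "u\<^sup>2 - k\<^sup>2 = A\<^sup>2" using k by simp
  have 2: "(C - u)\<^sup>2 - k\<^sup>2 = B\<^sup>2" using k u2 by (simp add: power2_eq_square algebra_simps)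
  have "0 < A\<^sup>2" "0 < B\<^sup>2" using pos by auto
  then have "k\<^sup>2 < u\<^sup>2" "k\<^sup>2 < (C - u)\<^sup>2" using 1 2 by linarith+
  then have ku: "k < u" "k < C - u" using uA pos k(1) by (auto intro: power2_less_imp_less)
  define x' :: "real \<times> real" where "x' = (0, 0)"
  define y' :: "real \<times> real" where "y' = (u, k)"
  define z' :: "real \<times> real" where "z' = (C, 0)"
  have segl: "(l * u, l * k) \<in> closed_segment x' y'" "(l * C, 0) \<in> closed_segment x' z'"
    "(u + l * (C - u), (1 - l) * k) \<in> closed_segment y' z'" if "0 \<le> l" "l \<le> 1" for l
    using that unfolding closed_segment_def x'_def y'_def z'_def
    by (auto intro!: exI[of _ l] simp: algebra_simps)
  have cp1: "(p, (l * u, l * k)) \<in> comparison_points X x y G x' y'"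
    if "divides x y l p" "p \<in> G" for l p G
  proof -
    note d = dividesD[OF that(1) tri(1) pts(1,2)]
    have "tsep minkowski_plane x' (l * u, l * k) = ennreal (l * A)"
      unfolding x'_def using d ku k 1 pos
      by (intro minkowski_tsep_scaled[where u = u and v = "- k"]) auto
    moreover have "tsep minkowski_plane (l * u, l * k) y' = ennreal ((1 - l) * A)"
      unfolding y'_def using d ku k 1 pos
      by (intro minkowski_tsep_scaled[where u = u and v = "- k"]) (auto simp: algebra_simps)
    ultimately show ?thesis using that segl[OF d(6,7)] d
      by (auto simp: comparison_points_def tsep_eq_T A_def)
  qed
  have cp2: "(p, (l * C, 0)) \<in> comparison_points X x z G x' z'"
    if "divides x z l p" "p \<in> G" for l p G
  proof -
    note d = dividesD[OF that(1) fin pts(1,3)]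
    have "tsep minkowski_plane x' (l * C, 0) = ennreal (l * C)"
      unfolding x'_def using d \<open>0 < C\<close>
      by (intro minkowski_tsep_scaled[where u = C and v = 0]) auto
    moreover have "tsep minkowski_plane (l * C, 0) z' = ennreal ((1 - l) * C)"
      unfolding z'_def using d \<open>0 < C\<close>
      by (intro minkowski_tsep_scaled[where u = C and v = 0]) (auto simp: algebra_simps)
    ultimately show ?thesis using that segl[OF d(6,7)] d
      by (auto simp: comparison_points_def tsep_eq_T C_def)
  qed
  have cp3: "(p, (u + l * (C - u), (1 - l) * k)) \<in> comparison_points X y z G y' z'"
    if "divides y z l p" "p \<in> G" for l p G
  proof -
    note d = dividesD[OF that(1) tri(2) pts(2,3)]
    have "tsep minkowski_plane y' (u + l * (C - u), (1 - l) * k) = ennreal (l * B)"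
      unfolding y'_def using d ku k 2 pos
      by (intro minkowski_tsep_scaled[where u = "C - u" and v = k]) (auto simp: algebra_simps)
    moreover have "tsep minkowski_plane (u + l * (C - u), (1 - l) * k) z' = ennreal ((1 - l) * B)"
      unfolding z'_def using d ku k 2 pos
      by (intro minkowski_tsep_scaled[where u = "C - u" and v = k]) (auto simp: algebra_simps)
    ultimately show ?thesis using that segl[OF d(6,7)] d
      by (auto simp: comparison_points_def tsep_eq_T B_def)
  qed
  have chxz: "chron X x z" using chron_iff[OF fin pts(1,3)] \<open>0 < C\<close> C_def by simp
  have comp: "comparison_triangle X x y z x' y' z'"
  proof -
    have "tsep minkowski_plane x' y' = ennreal A" "tsep minkowski_plane y' z' = ennreal B"
      "tsep minkowski_plane x' z' = ennreal C"
      unfolding x'_def y'_def z'_def using k ku 1 2 pos \<open>0 < C\<close> by (auto intro!: minkowski_tsep)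
    moreover have "chron minkowski_plane x' y'" "chron minkowski_plane y' z'"
        "chron minkowski_plane x' z'"
      unfolding x'_def y'_def z'_def minkowski_chron using k ku \<open>0 < C\<close> by auto
    ultimately show ?thesis unfolding comparison_triangle_def
      using tri(1,2) fin by (simp add: tsep_eq_T A_def B_def C_def)
  qed
  have curv: "tsep minkowski_plane p' q' \<le> tsep X p q"
    if "geodesic_segment X x y G" "geodesic_segment X y z H" "geodesic_segment X x z K"
       "(p, p') \<in> comparison_points X x y G x' y' \<union> comparison_points X y z H y' z' \<union>
           comparison_points X x z K x' z'"
       "(q, q') \<in> comparison_points X x y G x' y' \<union> comparison_points X y z H y' z' \<union>
           comparison_points X x z K x' z'"
     for G H K p p' q q'
  proof -
    have "timelike_triangle X x y z G H K"
      unfolding timelike_triangle_def using that pts ch chxz by blast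
    then show ?thesis
      using curvature comp that(4,5) unfolding timelike_curvature_bounded_above_0_def Let_def
          by blast
  qed
  have seg: "\<exists>G. geodesic_segment X x y G" "\<exists>G. geodesic_segment X y z G"
      "\<exists>G. geodesic_segment X x z G"
    using divides_ends[OF ch(1) tri(1) pts(1,2)] divides_ends[OF ch(2) tri(2) pts(2,3)]
      divides_ends[OF chxz fin pts(1,3)] unfolding divides_def by blast+
  show thesis
  proof (rule that[of k u])
    fix l p m q
    assume d: "divides x y l p" "divides x z m q"
    obtain G K H where "geodesic_segment X x y G" "p \<in> G" "geodesic_segment X x z K" "q \<in> K"
      "geodesic_segment X y z H" using d seg unfolding divides_def by blast
    then show "tsep minkowski_plane (l * u, l * k) (m * C, 0) \<le> tsep X p q"
      using cp1[OF d(1)] cp2[OF d(2)] by (intro curv[of G H K]) auto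
  next
    fix l p m q
    assume d: "divides x z l p" "divides y z m q"
    obtain G K H where "geodesic_segment X x z K" "p \<in> K" "geodesic_segment X y z H" "q \<in> H"
      "geodesic_segment X x y G" using d seg unfolding divides_def by blast
    then show "tsep minkowski_plane (l * C, 0) (u + m * (C - u), (1 - m) * k) \<le> tsep X p q"
      using cp2[OF d(1)] cp3[OF d(2)] by (intro curv[of G H K]) auto
  qed (use k ku 1 2 in auto)
qed

text \<open>The right-hand side is the squared length of the Minkowski vector between the comparison
  points, as given by the law of cosines at the vertex \<open>x\<close>. The hypothesis on \<open>l\<close> and \<open>m\<close> excludes
  that this vector is past-directed; if it is spacelike the inequality is trivial.\<close>

lemma comparison_at_past_vertex:
  assumes pts: "x \<in> pts X" "y \<in> pts X" "z \<in> pts X"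
    and ch: "chron X x y" "chron X y z" and fin: "fin x z"
    and d: "divides x y l p" "divides x z m q" and le: "l * T x y \<le> m * T x z"
  shows "m\<^sup>2 * (T x z)\<^sup>2 + l\<^sup>2 * (T x y)\<^sup>2 - l * m * ((T x y)\<^sup>2 + (T x z)\<^sup>2 - (T y z)\<^sup>2) \<le> (T p
      q)\<^sup>2"
proof -
  obtain u k where uk: "0 \<le> k" "k < u" "k < T x z - u" "u\<^sup>2 - k\<^sup>2 = (T x y)\<^sup>2"
      "(T x z - u)\<^sup>2 - k\<^sup>2 = (T y z)\<^sup>2"
    and cmp: "\<And>l p m q. divides x y l p \<Longrightarrow> divides x z m q \<Longrightarrow>
       tsep minkowski_plane (l * u, l * k) (m * T x z, 0) \<le> tsep X p q"
    by (rule comparison_inequality[OF pts ch fin]) (rule that)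
  have caus: "caus X x y" "caus X y z" using ch chron_imp_caus pts by auto
  note tri = T_triangle[OF caus fin pts]
  note d1 = dividesD[OF d(1) tri(1) pts(1,2)] and d2 = dividesD[OF d(2) fin pts(1,3)]
  have "caus X p z" using caus_trans d1 caus pts by blast
  then have f: "fin p q" using fin_between[OF fin d1(2) d2(3)] d1 d2 pts by blast
  define E where "E = (m * T x z - l * u)\<^sup>2 - (l * k)\<^sup>2"
  have Eeq: "E = m\<^sup>2 * (T x z)\<^sup>2 + l\<^sup>2 * (T x y)\<^sup>2 - l * m * ((T x y)\<^sup>2 + (T x z)\<^sup>2 - (T y z)\<^sup>2)"
    unfolding E_def by (rule law_of_cosines[OF uk(4,5)])
  show ?thesis
  proof (cases "0 < E")
    case True
    have "l * k < m * T x z - l * u"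
    proof (rule ccontr)
      assume "\<not> l * k < m * T x z - l * u"
      then have "m * T x z - l * u < - (l * k)"
      proof -
        have "\<not> \<bar>m * T x z - l * u\<bar> \<le> \<bar>l * k\<bar>"
          using True unfolding E_def abs_le_square_iff by simp
        moreover have "0 \<le> l * k" using d1 uk by simp
        ultimately show ?thesis using \<open>\<not> l * k < m * T x z - l * u\<close> by linarith
      qed
      then have *: "m * T x z < l * (u - k)" by (simp add: algebra_simps)
      have "(u - k)\<^sup>2 \<le> u\<^sup>2 - k\<^sup>2"
        using mult_nonneg_nonneg[OF uk(1), of "u - k"] uk(2)
            by (simp add: power2_eq_square algebra_simps)
      then have "(u - k)\<^sup>2 \<le> (T x y)\<^sup>2" using uk(4) by simp
      then have "u - k \<le> T x y" by (rule power2_le_imp_le) simp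
      then have "l * (u - k) \<le> l * T x y" using d1 by (intro mult_left_mono) auto
      then show False using * le by simp
    qed
    then have "tsep minkowski_plane (l * u, l * k) (m * T x z, 0) = ennreal (sqrt E)"
      using True d1 uk by (intro minkowski_tsep) (auto simp: E_def)
    then have "ennreal (sqrt E) \<le> ennreal (T p q)" using cmp[OF d] tsep_eq_T[OF f] by simp
    then have "sqrt E \<le> T p q" by simp
    then have "(sqrt E)\<^sup>2 \<le> (T p q)\<^sup>2" using True by (intro power_mono) auto
    then show ?thesis using True Eeq by simp
  next
    case False
    then show ?thesis using Eeq zero_le_power2[of "T p q"] by linarith
  qed
qed

text \<open>The mirror image of the previous lemma under time reversal.\<close>

lemma comparison_at_future_vertex:
  assumes pts: "x \<in> pts X" "y \<in> pts X" "z \<in> pts X"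
    and ch: "chron X x y" "chron X y z" and fin: "fin x z"
    and d: "divides x z (1 - l) p" "divides y z (1 - m) q" and le: "m * T y z \<le> l * T x z"
  shows "l\<^sup>2 * (T x z)\<^sup>2 + m\<^sup>2 * (T y z)\<^sup>2 - m * l * ((T y z)\<^sup>2 + (T x z)\<^sup>2 - (T x y)\<^sup>2) \<le> (T p
      q)\<^sup>2"
proof -
  obtain u k where uk: "0 \<le> k" "k < u" "k < T x z - u" "u\<^sup>2 - k\<^sup>2 = (T x y)\<^sup>2"
      "(T x z - u)\<^sup>2 - k\<^sup>2 = (T y z)\<^sup>2"
    and "\<And>l p m q. divides x y l p \<Longrightarrow> divides x z m q \<Longrightarrow>
       tsep minkowski_plane (l * u, l * k) (m * T x z, 0) \<le> tsep X p q"
    and cmp: "\<And>l p m q. divides x z l p \<Longrightarrow> divides y z m q \<Longrightarrow>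
       tsep minkowski_plane (l * T x z, 0) (u + m * (T x z - u), (1 - m) * k) \<le> tsep X p q"
    by (rule comparison_inequality[OF pts ch fin]) (rule that)
  have caus: "caus X x y" "caus X y z" using ch chron_imp_caus pts by auto
  note tri = T_triangle[OF caus fin pts]
  note d1 = dividesD[OF d(1) fin pts(1,3)] and d2 = dividesD[OF d(2) tri(2) pts(2,3)]
  have f: "fin p q" using fin_between[OF fin d1(2) d2(3)] d1 d2 pts by blast
  define w where "w = T x z - u"
  define E where "E = (l * T x z - m * w)\<^sup>2 - (m * k)\<^sup>2"
  have w: "k < w" "w\<^sup>2 - k\<^sup>2 = (T y z)\<^sup>2" "u = T x z - w" using uk by (auto simp: w_def)
  have Eeq: "E = l\<^sup>2 * (T x z)\<^sup>2 + m\<^sup>2 * (T y z)\<^sup>2 - m * l * ((T y z)\<^sup>2 + (T x z)\<^sup>2 - (T x y)\<^sup>2)"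
    unfolding E_def using uk(4) by (intro law_of_cosines[OF w(2)]) (simp add: w(3))
  show ?thesis
  proof (cases "0 < E")
    case True
    have "m * k < l * T x z - m * w"
    proof (rule ccontr)
      assume "\<not> m * k < l * T x z - m * w"
      then have "l * T x z - m * w < - (m * k)"
      proof -
        have "\<not> \<bar>l * T x z - m * w\<bar> \<le> \<bar>m * k\<bar>"
          using True unfolding E_def abs_le_square_iff by simp
        moreover have "0 \<le> m * k" using d2 uk by simp
        ultimately show ?thesis using \<open>\<not> m * k < l * T x z - m * w\<close> by linarith
      qed
      then have *: "l * T x z < m * (w - k)" by (simp add: algebra_simps)
      have "(w - k)\<^sup>2 \<le> w\<^sup>2 - k\<^sup>2"
        using mult_nonneg_nonneg[OF uk(1), of "w - k"] w(1)
            by (simp add: power2_eq_square algebra_simps)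
      then have "(w - k)\<^sup>2 \<le> (T y z)\<^sup>2" using w(2) by simp
      then have "w - k \<le> T y z" by (rule power2_le_imp_le) simp
      then have "m * (w - k) \<le> m * T y z" using d2 by (intro mult_left_mono) auto
      then show False using * le by simp
    qed
    moreover have "u + (1 - m) * (T x z - u) - (1 - l) * T x z = l * T x z - m * w"
      by (simp add: w_def algebra_simps)
    ultimately have "tsep minkowski_plane ((1 - l) * T x z, 0) (u + (1 - m) * (T x z - u), (1 - (1
        - m)) * k) = ennreal (sqrt E)"
      using True d2 uk by (intro minkowski_tsep) (auto simp: E_def)
    then have "ennreal (sqrt E) \<le> ennreal (T p q)" using cmp[OF d] tsep_eq_T[OF f] by simp
    then have "sqrt E \<le> T p q" by simp
    then have "(sqrt E)\<^sup>2 \<le> (T p q)\<^sup>2" using True by (intro power_mono) auto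
    then show ?thesis using True Eeq by simp
  next
    case False
    then show ?thesis using Eeq zero_le_power2[of "T p q"] by linarith
  qed
qed

text \<open>The diagonal from \<open>x\<close> to \<open>y'\<close> cuts the quadrilateral into two triangles, in each of which
  the comparison is a homothety.\<close>

lemma separation_concave:
  assumes pts: "x \<in> pts X" "y \<in> pts X" "x' \<in> pts X" "y' \<in> pts X"
    and ch: "chron X x y" "chron X x' y'" "chron X x x'" "chron X y y'" and fin: "fin x y'"
    and d: "divides x y l p" "divides x' y' l p'" and l: "0 < l" "l < 1"
  shows "chron X p p'" "fin p p'" "(1 - l) * T x x' + l * T y y' \<le> T p p'"
proof -
  have caus: "caus X x y" "caus X x' y'" "caus X x x'" "caus X y y'"
      using ch chron_imp_caus pts by auto
  note t1 = T_triangle[OF caus(1,4) fin pts(1,2,4)] and t2 = T_triangle[OF caus(3,2) fin pts(1,3,4)]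
  note d1 = dividesD[OF d(1) t1(1) pts(1,2)] and d2 = dividesD[OF d(2) t2(2) pts(3,4)]
  have pos: "0 < T x y" "0 < T y y'" "0 < T x x'" "0 < T x' y'"
    using chron_iff t1 t2 ch pts by blast+
  have chd: "chron X x y'" using chron_iff[OF fin pts(1,4)] pos t1 by linarith
  obtain r where r: "divides x y' l r" using divides_exists[OF chd fin pts(1,4)] l by fastforce
  note dr = dividesD[OF r fin pts(1,4)]
  have "l\<^sup>2 * (T x y')\<^sup>2 + l\<^sup>2 * (T x y)\<^sup>2 - l * l * ((T x y)\<^sup>2 + (T x y')\<^sup>2 - (T y y')\<^sup>2) \<le> (T p
      r)\<^sup>2"
    using comparison_at_past_vertex[OF pts(1,2,4) ch(1,4) fin d(1) r] l t1 pos by auto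
  then have "(l * T y y')\<^sup>2 \<le> (T p r)\<^sup>2" by (simp add: power2_eq_square algebra_simps)
  then have 1: "l * T y y' \<le> T p r" by (rule power2_le_imp_le) simp
  have "divides x y' (1 - (1 - l)) r" "divides x' y' (1 - (1 - l)) p'" using r d by auto
  moreover have "(1 - l) * T x' y' \<le> (1 - l) * T x y'"
    using t2 pos l by (intro mult_left_mono) auto
  ultimately have "(1 - l)\<^sup>2 * (T x y')\<^sup>2 + (1 - l)\<^sup>2 * (T x' y')\<^sup>2 -
     (1 - l) * (1 - l) * ((T x' y')\<^sup>2 + (T x y')\<^sup>2 - (T x x')\<^sup>2) \<le> (T r p')\<^sup>2"
    by (rule comparison_at_future_vertex[OF pts(1,3,4) ch(3,2) fin])
  then have "((1 - l) * T x x')\<^sup>2 \<le> (T r p')\<^sup>2" by (simp add: power2_eq_square algebra_simps)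
  then have 2: "(1 - l) * T x x' \<le> T r p'" by (rule power2_le_imp_le) simp
  have "0 < l * T y y'" "0 < (1 - l) * T x x'" using pos l by auto
  then have "0 < T p r" "0 < T r p'" using 1 2 by linarith+
  then have c: "caus X p r" "caus X r p'" using T_pos_imp_caus d1 dr d2 by blast+
  show f: "fin p p'" using fin_between[OF fin d1(2) d2(3)] pts d1 d2 by blast
  have "T p r + T r p' \<le> T p p'" using T_triangle[OF c f] d1 dr d2 by blast
  then show "(1 - l) * T x x' + l * T y y' \<le> T p p'" using 1 2 by simp
  then show "chron X p p'" using chron_iff[OF f] \<open>0 < l * T y y'\<close> \<open>0 < (1 - l) * T x x'\<close> d1 d2
    by auto
qed

text \<open>The Lorentzian form of the parallelogram inequality: compare both \<open>b\<close> and \<open>c\<close> with the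
  midpoint of the diagonal from \<open>a\<close> to \<open>d\<close>, and use the reverse triangle inequality through it.\<close>

lemma four_point_inequality:
  assumes pts: "a \<in> pts X" "b \<in> pts X" "c \<in> pts X" "d \<in> pts X"
    and ch: "chron X a b" "chron X b c" "chron X c d" and fin: "fin a d"
    and eq: "T c d = T a b" "T b d = T a c"
  shows "2 * (T a b)\<^sup>2 + 2 * (T a c)\<^sup>2 \<le> (T a d)\<^sup>2 + (T b c)\<^sup>2"
proof -
  have caus: "caus X a b" "caus X b c" "caus X c d" using ch chron_imp_caus pts by auto
  then have caus2: "caus X a c" "caus X b d" "caus X a d" using caus_trans pts by blast+
  note t1 = T_triangle[OF caus2(1) caus(3) fin pts(1,3,4)]
      and t2 = T_triangle[OF caus(1) caus2(2) fin pts(1,2,4)]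
  note t3 = T_triangle[OF caus(2,3) t2(2) pts(2,3,4)]
      and t4 = T_triangle[OF caus(1,2) t1(1) pts(1,2,3)]
  have pos: "0 < T a b" "0 < T b c" "0 < T c d"
    using chron_iff t1 t2 t3 ch pts by blast+
  have half: "T a b < T a d / 2" using t1 t4 pos eq by linarith
  have chd: "chron X a d" "chron X a c" "chron X b d"
    using chron_iff[OF fin] chron_iff[OF t1(1)] chron_iff[OF t2(2)] t1 t2 t3 t4 pos pts by auto
  obtain m where m: "divides a d (1/2) m"
      using divides_exists[OF chd(1) fin pts(1,4), of "1/2"] by auto
  note dm = dividesD[OF m fin pts(1,4)]
  define E where "E = (T a b)\<^sup>2 / 2 + (T a c)\<^sup>2 / 2 - (T a d)\<^sup>2 / 4"
  have "E \<le> (T b m)\<^sup>2"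
  proof -
    have "divides a b 1 b" using divides_ends[OF ch(1) t2(1) pts(1,2)] by simp
    from comparison_at_past_vertex[OF pts(1,2,4) ch(1) chd(3) fin this m]
    show ?thesis using half eq by (simp add: E_def field_simps)
  qed
  moreover have "E \<le> (T m c)\<^sup>2"
  proof -
    have "divides c d (1 - 1) c" "divides a d (1 - 1/2) m"
      using divides_ends[OF ch(3) t1(2) pts(3,4)] m by auto
    from comparison_at_future_vertex[OF pts(1,3,4) chd(2) ch(3) fin this(2,1)]
    show ?thesis using half eq by (simp add: E_def field_simps)
  qed
  ultimately have *: "sqrt E \<le> T b m" "sqrt E \<le> T m c" by (auto intro: real_le_lsqrt)
  have "4 * E \<le> (T b c)\<^sup>2"
  proof (cases "0 < E")
    case True
    then have "0 < sqrt E" by simp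
    then have "0 < T b m" "0 < T m c" using * by linarith+
    then have c: "caus X b m" "caus X m c" using T_pos_imp_caus dm pts by blast+
    have "2 * sqrt E \<le> T b c" using T_triangle[OF c t4(2) pts(2) dm(1) pts(3)] * by linarith
    then have "(2 * sqrt E)\<^sup>2 \<le> (T b c)\<^sup>2" using True by (intro power_mono) auto
    moreover have "(2 * sqrt E)\<^sup>2 = 4 * E" using True by (simp add: power_mult_distrib)
    ultimately show ?thesis by linarith
  next
    case False then show ?thesis using zero_le_power2[of "T b c"] by linarith
  qed
  moreover have "4 * E = 2 * (T a b)\<^sup>2 + 2 * (T a c)\<^sup>2 - (T a d)\<^sup>2" by (simp add: E_def)
  ultimately show ?thesis by linarith
qed

end

section \<open>Midpoint convexity and hyperbolas\<close>

text \<open>Extrapolating an increase by reflection would make it grow linearly, beyond any bound.\<close>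

lemma bounded_midconvex_antimono:
  fixes P :: "real \<Rightarrow> real"
  assumes bound: "\<And>w. D w \<Longrightarrow> P w \<le> M"
    and up: "\<And>w w'. D w \<Longrightarrow> w \<le> w' \<Longrightarrow> D w'"
    and mid: "\<And>r t. D (r - t) \<Longrightarrow> 0 < t \<Longrightarrow> 2 * P r \<le> P (r + t) + P (r - t)"
    and uv: "D u" "u \<le> v"
  shows "P v \<le> P u"
proof (rule ccontr)
  assume less: "\<not> P v \<le> P u"
  define d where "d = v - u"
  have d: "0 < d" using less uv by (cases "u = v") (auto simp: d_def)
  have slope: "P v - P u \<le> P (u + real (Suc n) * d) - P (u + real n * d)" for n
  proof (induction n)
    case 0
    then show ?case by (simp add: d_def)
  next
    case (Suc n)
    have "D (u + real n * d)" using d by (intro up[OF uv(1)]) auto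
    then have "2 * P (u + real (Suc n) * d) \<le> P (u + real (Suc (Suc n)) * d) + P (u + real n * d)"
      using mid[of "u + real (Suc n) * d" d] d by (simp add: algebra_simps)
    then show ?case using Suc by linarith
  qed
  have grow: "P u + real n * (P v - P u) \<le> P (u + real n * d)" for n
  proof (induction n)
    case (Suc n)
    have "real (Suc n) * (P v - P u) = real n * (P v - P u) + (P v - P u)"
        by (simp add: algebra_simps)
    then show ?case using Suc slope[of n] by linarith
  qed simp
  obtain n :: nat where "M - P u < real n * (P v - P u)"
    using reals_Archimedean3[of "P v - P u"] less by (auto simp: mult.commute)
  moreover have "P (u + real n * d) \<le> M" using d by (intro bound up[OF uv(1)]) auto
  ultimately show False using grow[of n] by linarith
qed

lemma nonneg_midconcave_constant:
  fixes f :: "real \<Rightarrow> real"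
  assumes nn: "\<And>x. 0 \<le> f x" and mid: "\<And>x d. 0 < d \<Longrightarrow> f (x - d) + f (x + d) \<le> 2 * f x"
  shows "f x = f y"
proof -
  have up: "f u \<le> f v" if "u \<le> v" for u v
  proof -
    have "2 * - f r \<le> - f (r + t) + - f (r - t)" if "0 < t" for r t
      using mid[OF that, of r] by linarith
    then show ?thesis
      using bounded_midconvex_antimono[of "\<lambda>_. True" "\<lambda>x. - f x" 0 u v] nn that by simp
  qed
  have down: "f v \<le> f u" if "u \<le> v" for u v
  proof -
    have "2 * - f (- r) \<le> - f (- (r + t)) + - f (- (r - t))" if "0 < t" for r t
      using mid[OF that, of "- r"] by (simp add: algebra_simps)
    then show ?thesis
      using bounded_midconvex_antimono[of "\<lambda>_. True" "\<lambda>x. - f (- x)" 0 "- v" "- u"] nn that by simp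
  qed
  show ?thesis using up[of x y] down[of x y] up[of y x] down[of y x] by linarith
qed

text \<open>Off its zero set, \<open>g\<close> is one branch of a hyperbola; continuity excludes a jump to zero
  before the vertex of the branch is reached.\<close>

lemma hyperbola_threshold:
  fixes g :: "real \<Rightarrow> real"
  assumes cont: "continuous_on UNIV g" and nn: "\<And>w. 0 \<le> g w" and c: "0 \<le> c"
    and large: "\<And>r. R < r \<Longrightarrow> 0 < g r"
    and le: "\<And>w. 0 < g w \<Longrightarrow> g w \<le> w + \<omega>"
    and sq: "\<And>w. 0 < g w \<Longrightarrow> (g w)\<^sup>2 = (w + \<omega>)\<^sup>2 - c\<^sup>2"
  shows "g w = (if c \<le> w + \<omega> then sqrt ((w + \<omega>)\<^sup>2 - c\<^sup>2) else 0)"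
proof (cases "0 < g w")
  case True
  have "c\<^sup>2 \<le> (w + \<omega>)\<^sup>2" using sq[OF True] zero_le_power2[of "g w"] by linarith
  moreover have "0 \<le> w + \<omega>" using le[OF True] True by linarith
  ultimately have "c \<le> w + \<omega>" by (rule power2_le_imp_le)
  moreover have "g w = sqrt ((w + \<omega>)\<^sup>2 - c\<^sup>2)"
    unfolding sq[OF True, symmetric] using nn by simp
  ultimately show ?thesis by simp
next
  case False
  then have g0: "g w = 0" using nn[of w] by simp
  have "(w + \<omega>)\<^sup>2 - c\<^sup>2 \<le> 0" if cw: "c \<le> w + \<omega>"
  proof (rule ccontr)
    define E where "E = (w + \<omega>)\<^sup>2 - c\<^sup>2"
    assume "\<not> (w + \<omega>)\<^sup>2 - c\<^sup>2 \<le> 0"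
    then have E: "0 < E" by (simp add: E_def)
    define W where "W = max (w + 1) (R + 1)"
    have W: "w \<le> W" "0 < g W" using large[of W] by (auto simp: W_def)
    define e where "e = min (g W) (sqrt E / 2)"
    have e: "0 < e" "e \<le> g W" "e \<le> sqrt E / 2" using W E by (auto simp: e_def)
    obtain w' where w': "w \<le> w'" "w' \<le> W" "g w' = e"
      using IVT'[of g w e W] g0 e W continuous_on_subset[OF cont subset_UNIV] by auto
    have "e\<^sup>2 = (w' + \<omega>)\<^sup>2 - c\<^sup>2" using sq[of w'] w' e by simp
    moreover have "(w + \<omega>)\<^sup>2 \<le> (w' + \<omega>)\<^sup>2" using w' cw c by (intro power_mono) auto
    ultimately have "E \<le> e\<^sup>2" by (simp add: E_def)
    moreover have "e\<^sup>2 \<le> (sqrt E / 2)\<^sup>2" using e by (intro power_mono) auto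
    moreover have "(sqrt E / 2)\<^sup>2 = E / 4" using E by (simp add: power_divide)
    ultimately show False using E by linarith
  qed
  moreover have "0 \<le> (w + \<omega>)\<^sup>2 - c\<^sup>2" if "c \<le> w + \<omega>"
    using power_mono[OF that c, of 2] by simp
  ultimately have "(w + \<omega>)\<^sup>2 - c\<^sup>2 = 0" if "c \<le> w + \<omega>" using that by fastforce
  then show ?thesis using g0 by simp
qed

text \<open>Glue \<open>g(w)\<^sup>2 - w\<^sup>2\<close> and the reflection of \<open>h(v)\<^sup>2 - v\<^sup>2\<close> to one function on the line with a
  gap. The four-point inequalities say that it is midpoint convex, across the gap too. After
  subtraction of \<open>2 \<omega> w\<close> it is bounded above on both ends, hence constant.\<close>

lemma hyperbola_rigidity:
  fixes g h :: "real \<Rightarrow> real"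
  assumes cont: "continuous_on UNIV g" "continuous_on UNIV h"
    and nn: "\<And>w. 0 \<le> g w" "\<And>w. 0 \<le> h w"
    and large: "\<And>r. R < r \<Longrightarrow> 0 < g r" "\<And>r. R < r \<Longrightarrow> 0 < h r"
    and up: "\<And>r r'. 0 < g r \<Longrightarrow> r \<le> r' \<Longrightarrow> 0 < g r'" "\<And>r r'. 0 < h r \<Longrightarrow> r \<le> r' \<Longrightarrow> 0 < h r'"
    and loop: "\<And>u v. 0 < g u \<Longrightarrow> 0 < h v \<Longrightarrow> g u + h v \<le> u + v"
    and gg: "\<And>r t. 0 < g (r - t) \<Longrightarrow> 0 < t \<Longrightarrow> 2 * (g r)\<^sup>2 + 2 * t\<^sup>2 \<le> (g (r + t))\<^sup>2 + (g (r - t))\<^sup>2"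
    and hh: "\<And>r t. 0 < h (r - t) \<Longrightarrow> 0 < t \<Longrightarrow> 2 * (h r)\<^sup>2 + 2 * t\<^sup>2 \<le> (h (r + t))\<^sup>2 + (h (r - t))\<^sup>2"
    and gh: "\<And>r t. 0 < g r \<Longrightarrow> 0 < h (t - r) \<Longrightarrow> 2 * (g r)\<^sup>2 + 2 * t\<^sup>2 \<le> (g (r + t))\<^sup>2 + (h (t - r))\<^sup>2"
    and hg: "\<And>r t. 0 < h r \<Longrightarrow> 0 < g (t - r) \<Longrightarrow> 2 * (h r)\<^sup>2 + 2 * t\<^sup>2 \<le> (h (r + t))\<^sup>2 + (g (t - r))\<^sup>2"
  obtains \<omega> c where "0 \<le> c"
    "\<And>r. g r = (if c \<le> r + \<omega> then sqrt ((r + \<omega>)\<^sup>2 - c\<^sup>2) else 0)"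
    "\<And>r. h r = (if c \<le> r - \<omega> then sqrt ((r - \<omega>)\<^sup>2 - c\<^sup>2) else 0)"
proof -
  have gR: "0 < g (R + 1)" "0 < h (R + 1)" using large by auto
  define \<omega> where "\<omega> = Sup {g w - w | w. 0 < g w}"
  have ub: "x \<le> v - h v" if "0 < h v" "x \<in> {g w - w | w. 0 < g w}" for x v
    using that loop[of _ v] by fastforce
  have gle: "g w \<le> w + \<omega>" if "0 < g w" for w
  proof -
    have "g w - w \<le> \<omega>" unfolding \<omega>_def
      by (rule cSup_upper) (use that ub[OF gR(2)] in \<open>auto simp: bdd_above_def\<close>)
    then show ?thesis by simp
  qed
  have hle: "h v \<le> v + - \<omega>" if "0 < h v" for v
  proof -
    have "\<omega> \<le> v - h v" unfolding \<omega>_def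
      by (rule cSup_least) (use gR ub[OF that] in auto)
    then show ?thesis by simp
  qed
  define P where "P w = (g w)\<^sup>2 - w\<^sup>2 - 2 * \<omega> * w" for w
  define N where "N w = (h w)\<^sup>2 - w\<^sup>2 + 2 * \<omega> * w" for w
  have Pb: "P w \<le> \<omega>\<^sup>2" if "0 < g w" for w
  proof -
    have "(g w)\<^sup>2 \<le> (w + \<omega>)\<^sup>2" using gle[OF that] that by (intro power_mono) auto
    then show ?thesis by (simp add: P_def power2_sum mult.commute mult.left_commute)
  qed
  have Nb: "N w \<le> \<omega>\<^sup>2" if "0 < h w" for w
  proof -
    have "(h w)\<^sup>2 \<le> (w + - \<omega>)\<^sup>2" using hle[OF that] that by (intro power_mono) auto
    then show ?thesis by (simp add: N_def power2_diff mult.commute mult.left_commute)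
  qed
  have sq: "(r + t)\<^sup>2 + (r - t)\<^sup>2 = 2 * r\<^sup>2 + 2 * t\<^sup>2" for r t :: real
    by (simp add: power2_sum power2_diff)
  have Pmono: "P v \<le> P u" if "0 < g u" "u \<le> v" for u v
  proof (rule bounded_midconvex_antimono[of "\<lambda>w. 0 < g w" P "\<omega>\<^sup>2"])
    fix r t :: real assume "0 < g (r - t)" "0 < t"
    then show "2 * P r \<le> P (r + t) + P (r - t)" using gg[of r t] sq[of r t]
      unfolding P_def by (simp add: algebra_simps)
  qed (use Pb up that in auto)
  have Nmono: "N v \<le> N u" if "0 < h u" "u \<le> v" for u v
  proof (rule bounded_midconvex_antimono[of "\<lambda>w. 0 < h w" N "\<omega>\<^sup>2"])
    fix r t :: real assume "0 < h (r - t)" "0 < t"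
    then show "2 * N r \<le> N (r + t) + N (r - t)" using hh[of r t] sq[of r t]
      unfolding N_def by (simp add: algebra_simps)
  qed (use Nb up that in auto)
  \<comment> \<open>reflect at \<open>v\<close> on one side of the gap a far point of the other side\<close>
  have PN: "P v \<le> N w" if "0 < g v" "0 < h w" for v w
  proof -
    define t where "t = max (w + v) 0"
    have "0 < h (t - v)" by (rule up(2)[OF that(2)]) (auto simp: t_def)
    then have "2 * P v \<le> P (v + t) + N (t - v)"
      using gh[OF that(1), of t] sq[of t v]
      unfolding P_def N_def by (simp add: algebra_simps)
    moreover have "P (v + t) \<le> P v" by (rule Pmono[OF that(1)]) (simp add: t_def)
    moreover have "N (t - v) \<le> N w" by (rule Nmono[OF that(2)]) (simp add: t_def)
    ultimately show ?thesis by linarith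
  qed
  have NP: "N v \<le> P w" if "0 < h v" "0 < g w" for v w
  proof -
    define t where "t = max (w + v) 0"
    have "0 < g (t - v)" by (rule up(1)[OF that(2)]) (auto simp: t_def)
    then have "2 * N v \<le> N (v + t) + P (t - v)"
      using hg[OF that(1), of t] sq[of t v]
      unfolding P_def N_def by (simp add: algebra_simps)
    moreover have "N (v + t) \<le> N v" by (rule Nmono[OF that(1)]) (simp add: t_def)
    moreover have "P (t - v) \<le> P w" by (rule Pmono[OF that(2)]) (simp add: t_def)
    ultimately show ?thesis by linarith
  qed
  define K where "K = P (R + 1)"
  have PK: "P w = K" if "0 < g w" for w
    using PN[OF that gR(2)] NP[OF gR(2) that] PN[OF gR] NP[OF gR(2,1)] by (simp add: K_def)
  have NK: "N w = K" if "0 < h w" for w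
    using PN[OF gR(1) that] NP[OF that gR(1)] by (simp add: K_def)
  define c where "c = sqrt (\<omega>\<^sup>2 - K)"
  have c: "0 \<le> c" "c\<^sup>2 = \<omega>\<^sup>2 - K" using Pb[OF gR(1)] by (auto simp: c_def K_def)
  show thesis
  proof (rule that[of c \<omega>])
    show "0 \<le> c" by (rule c)
    show "g r = (if c \<le> r + \<omega> then sqrt ((r + \<omega>)\<^sup>2 - c\<^sup>2) else 0)" for r
    proof (rule hyperbola_threshold[OF cont(1) nn(1) c(1) large(1) gle])
      show "(g w)\<^sup>2 = (w + \<omega>)\<^sup>2 - c\<^sup>2" if "0 < g w" for w
        using PK[OF that] unfolding P_def c(2) by (simp add: power2_sum algebra_simps)
    qed auto
    have "h r = (if c \<le> r + - \<omega> then sqrt ((r + - \<omega>)\<^sup>2 - c\<^sup>2) else 0)" for r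
    proof (rule hyperbola_threshold[OF cont(2) nn(2) c(1) large(2) hle])
      show "(h w)\<^sup>2 = (w + - \<omega>)\<^sup>2 - c\<^sup>2" if "0 < h w" for w
        using NK[OF that] unfolding N_def c(2) by (simp add: power2_diff algebra_simps)
    qed auto
    then show "h r = (if c \<le> r - \<omega> then sqrt ((r - \<omega>)\<^sup>2 - c\<^sup>2) else 0)" for r by simp
  qed
qed

section \<open>Pairs of weakly parallel lines\<close>

lemma weakly_parallel_sym: "weakly_parallel X \<alpha> \<beta> \<Longrightarrow> weakly_parallel X \<beta> \<alpha>"
  unfolding weakly_parallel_def by blast

context upper_curvature_zero
begin

text \<open>A line cannot return to its past: a causal relation from \<open>\<alpha>(s)\<close> to an earlier \<open>\<alpha>(t)\<close> would
  give \<open>\<alpha>(s)\<close> a positive separation from itself. So the order of the parameters decides causality.\<close>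

lemma lineD:
  assumes "complete_timelike_line X \<alpha>"
  shows line_pts: "\<alpha> t \<in> pts X"
    and line_cont: "continuous_map euclidean (ltop X) \<alpha>"
    and line_caus: "caus X (\<alpha> s) (\<alpha> t) \<longleftrightarrow> s \<le> t"
    and line_fin: "fin (\<alpha> s) (\<alpha> t)"
    and line_T: "T (\<alpha> s) (\<alpha> t) = max (t - s) 0"
    and line_chron: "chron X (\<alpha> s) (\<alpha> t) \<longleftrightarrow> s < t"
    and line_divides: "s < t \<Longrightarrow> l \<in> {0..1} \<Longrightarrow> divides (\<alpha> s) (\<alpha> t) l (\<alpha> (s + l * (t - s)))"
proof -
  have g: "geodesic X UNIV \<alpha>" and cc: "causal_curve X UNIV \<alpha>"
    and t: "\<And>s t. s \<le> t \<Longrightarrow> tsep X (\<alpha> s) (\<alpha> t) = ennreal (t - s)"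
    using assms unfolding complete_timelike_line_def geodesic_def by auto
  then show cont: "continuous_map euclidean (ltop X) \<alpha>" unfolding causal_curve_def by auto
  then show p: "\<alpha> t \<in> pts X" for t unfolding continuous_map_def by auto
  have f: "fin (\<alpha> s) (\<alpha> t)" "T (\<alpha> s) (\<alpha> t) = t - s" if "s \<le> t" for s t
    using fin_T_eqI[OF t[OF that]] that by auto
  have c: "caus X (\<alpha> s) (\<alpha> t)" if "s \<le> t" for s t using cc that unfolding causal_curve_def by auto
  have nc: "\<not> caus X (\<alpha> s) (\<alpha> t)" if "t < s" for s t
  proof
    assume "caus X (\<alpha> s) (\<alpha> t)"
    then show False
      using T_triangle(3)[OF c[of t s] _ f(1)[of t t] p p p] f(2)[of t t] f(2)[of t s] that
        T_nonneg[of "\<alpha> s" "\<alpha> t"] by auto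
  qed
  show "caus X (\<alpha> s) (\<alpha> t) \<longleftrightarrow> s \<le> t" for s t using c nc by (meson not_le)
  show F: "fin (\<alpha> s) (\<alpha> t)" for s t using f nc not_caus_fin p by (meson not_le)
  show TT: "T (\<alpha> s) (\<alpha> t) = max (t - s) 0" for s t
    using f(2)[of s t] nc[of t s] not_caus_fin(2)[OF _ p p] by (cases "s \<le> t") auto
  show "chron X (\<alpha> s) (\<alpha> t) \<longleftrightarrow> s < t" for s t using chron_iff[OF F p p] TT by auto
  show "divides (\<alpha> s) (\<alpha> t) l (\<alpha> (s + l * (t - s)))" if st: "s < t" "l \<in> {0..1}" for s t l
  proof -
    have "geodesic X {s..t} \<alpha>"
      using g continuous_map_from_subtopology[OF cont] unfolding geodesic_def causal_curve_def
      by (auto simp: is_interval_cc)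
    then have "geodesic_segment X (\<alpha> s) (\<alpha> t) (\<alpha> ` {s..t})"
      unfolding geodesic_segment_def using st by (intro exI[of _ \<alpha>] exI[of _ s] exI[of _ t]) auto
    moreover have "0 \<le> l * (t - s)" "l * (t - s) \<le> 1 * (t - s)"
      using st by (auto intro!: mult_right_mono mult_nonneg_nonneg simp del: mult_1)
    ultimately show ?thesis using st TT unfolding divides_def
      by (auto simp: algebra_simps intro!: exI[of _ "\<alpha> ` {s..t}"])
  qed
qed

definition parallel :: "(real \<Rightarrow> 'a) \<Rightarrow> (real \<Rightarrow> 'a) \<Rightarrow> bool" where
  "parallel \<alpha> \<beta> \<longleftrightarrow> complete_timelike_line X \<alpha> \<and> complete_timelike_line X \<beta> \<and> weakly_parallel X \<alpha> \<beta>"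

lemma parallelD:
  assumes "parallel \<alpha> \<beta>"
  shows "complete_timelike_line X \<alpha>" "complete_timelike_line X \<beta>" "weakly_parallel X \<alpha> \<beta>"
  using assms parallel_def by auto

lemma parallel_sym: "parallel \<alpha> \<beta> \<Longrightarrow> parallel \<beta> \<alpha>"
  unfolding parallel_def using weakly_parallel_sym by blast

lemma parallel_trans:
  assumes "parallel \<alpha> \<beta>" "parallel \<beta> \<delta>" shows "parallel \<alpha> \<delta>"
proof -
  note l = parallelD[OF assms(1)] parallelD[OF assms(2)]
  obtain s s' where s: "s \<ge> 0" "s' \<ge> 0" "\<And>t. caus X (\<alpha> t) (\<beta> (t + s)) \<and> caus X (\<beta> t) (\<alpha> (t + s'))"
    using l(3) unfolding weakly_parallel_def by blast
  obtain r r' where r: "r \<ge> 0" "r' \<ge> 0" "\<And>t. caus X (\<beta> t) (\<delta> (t + r)) \<and> caus X (\<delta> t) (\<beta> (t + r'))"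
    using l(6) unfolding weakly_parallel_def by blast
  have "caus X (\<alpha> t) (\<delta> (t + (s + r)))" "caus X (\<delta> t) (\<alpha> (t + (r' + s')))" for t
    using caus_trans[OF s(3)[THEN conjunct1, of t] r(3)[THEN conjunct1, of "t + s"]]
      caus_trans[OF r(3)[THEN conjunct2, of t] s(3)[THEN conjunct2, of "t + r'"]] line_pts l
    by (auto simp: add.assoc)
  then have "weakly_parallel X \<alpha> \<delta>" unfolding weakly_parallel_def
    by (intro exI[of _ "s + r"] conjI exI[of _ "r' + s'"]) (use s r in auto)
  then show ?thesis using l parallel_def by blast
qed

text \<open>The point \<open>\<beta>(b)\<close> lies in the past of a point of \<open>\<alpha>\<close>, and separations along \<open>\<alpha>\<close> are finite.\<close>

lemma parallel_fin:
  assumes "parallel \<alpha> \<beta>" shows "fin (\<alpha> a) (\<beta> b)"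
proof -
  note l = parallelD[OF assms]
  obtain s' where "\<And>t. caus X (\<beta> t) (\<alpha> (t + s'))" using l(3) unfolding weakly_parallel_def by blast
  then show ?thesis using fin_between[of "\<alpha> a" "\<alpha> (b + s')" "\<alpha> a"
      "\<beta> b"] l line_fin line_pts caus_refl by blast
qed

lemma parallel_chron:
  assumes "parallel \<alpha> \<beta>" shows "chron X (\<alpha> a) (\<beta> b) \<longleftrightarrow> 0 < T (\<alpha> a) (\<beta> b)"
  using chron_iff parallel_fin[OF assms] parallelD[OF assms] line_pts by blast

lemma parallel_extend:
  assumes "parallel \<alpha> \<beta>" "caus X (\<alpha> a) (\<beta> b)" "a' \<le> a" "b \<le> b'"
  shows "caus X (\<alpha> a') (\<beta> b')" "T (\<alpha> a) (\<beta> b) + (a - a') + (b' - b) \<le> T (\<alpha> a') (\<beta> b')"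
proof -
  note l = parallelD[OF assms(1)]
  have c: "caus X (\<alpha> a') (\<alpha> a)" "caus X (\<beta> b) (\<beta> b')" using assms line_caus l by auto
  then have c2: "caus X (\<alpha> a') (\<beta> b)" using caus_trans assms l line_pts by blast
  then show "caus X (\<alpha> a') (\<beta> b')" using caus_trans c l line_pts by blast
  show "T (\<alpha> a) (\<beta> b) + (a - a') + (b' - b) \<le> T (\<alpha> a') (\<beta> b')"
    using T_triangle(3)[OF c(1) assms(2) parallel_fin[OF assms(1)]]
      T_triangle(3)[OF c2 c(2) parallel_fin[OF assms(1)]] line_pts[OF l(1)] line_pts[OF l(2)]
      line_T[OF l(1), of a' a] line_T[OF l(2), of b b'] assms by auto
qed

lemma parallel_extend_pos:
  assumes "parallel \<alpha> \<beta>" "0 < T (\<alpha> a) (\<beta> b)" "a' \<le> a" "b \<le> b'"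
  shows "0 < T (\<alpha> a') (\<beta> b')"
  using parallel_extend(2)[OF assms(1) _ assms(3,4)] T_pos_imp_caus[OF assms(2)]
      parallelD[OF assms(1)]
    line_pts assms by fastforce

lemma parallel_eventually_pos:
  assumes "parallel \<alpha> \<beta>"
  obtains R where "\<And>a b. R < b - a \<Longrightarrow> 0 < T (\<alpha> a) (\<beta> b)"
proof -
  obtain s where "\<And>t. caus X (\<alpha> t) (\<beta> (t + s))"
    using parallelD[OF assms] unfolding weakly_parallel_def by blast
  then have *: "T (\<alpha> a) (\<beta> (a + s)) + (a - a) + (b - (a + s)) \<le> T (\<alpha> a) (\<beta> b)" if "s < b - a"
      for a b
    using that by (intro parallel_extend(2)[OF assms]) auto
  have "0 < T (\<alpha> a) (\<beta> b)" if "s < b - a" for a b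
    using that *[OF that] T_nonneg[of "\<alpha> a" "\<beta> (a + s)"] by linarith
  then show thesis using that by blast
qed

lemma parallel_midconcave:
  assumes par: "parallel \<alpha> \<beta>" and pos: "0 < T (\<alpha> a) (\<beta> b)" "0 < T (\<alpha> a') (\<beta> b')"
      and lt: "a < a'" "b < b'"
  shows "T (\<alpha> a) (\<beta> b) + T (\<alpha> a') (\<beta> b') \<le> 2 * T (\<alpha> ((a + a') / 2)) (\<beta> ((b + b') / 2))"
proof -
  note l = parallelD[OF par]
  have "divides (\<alpha> a) (\<alpha> a') (1/2) (\<alpha> ((a + a') / 2))"
      "divides (\<beta> b) (\<beta> b') (1/2) (\<beta> ((b + b') / 2))"
    using line_divides[OF l(1) lt(1), of "1/2"] line_divides[OF l(2) lt(2), of "1/2"]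
    by (auto simp: field_simps)
  from separation_concave(3)[OF _ _ _ _ _ _ _ _ _ this] show ?thesis
    using l line_pts line_chron lt parallel_chron[OF par] parallel_fin[OF par] pos
        by (auto simp: field_simps)
qed

lemma continuous_on_parallel_T:
  fixes u v :: "real \<Rightarrow> real"
  assumes "parallel \<alpha> \<beta>" "continuous_on UNIV u" "continuous_on UNIV v"
  shows "continuous_on UNIV (\<lambda>t. T (\<alpha> (u t)) (\<beta> (v t)))"
proof -
  note l = parallelD[OF assms(1)]
  have "continuous_map (top_of_set UNIV) (ltop X) (\<alpha> \<circ> u)"
      "continuous_map (top_of_set UNIV) (ltop X) (\<beta> \<circ> v)"
    using line_cont[OF l(1)] line_cont[OF l(2)] assms by (auto intro!: continuous_map_compose)
  from continuous_on_T[OF this] show ?thesis using parallel_fin[OF assms(1)] by (simp add: o_def)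
qed

text \<open>The set of parameters \<open>(a, b)\<close> with \<open>\<alpha>(a)\<close> in the timelike past of \<open>\<beta>(b)\<close> contains a half
  plane \<open>b - a > R\<close>. Taking midpoints with far points of this half plane, one gets from \<open>(a, b)\<close>
  to \<open>(a + u, b + v)\<close> for all \<open>u < v\<close> of the same sign. To reach \<open>u = v\<close>, replace \<open>a\<close> by a
  slightly larger parameter first, which is possible since the set is open.\<close>

lemma parallel_pos_translate:
  assumes par: "parallel \<alpha> \<beta>" and pos: "0 < T (\<alpha> a) (\<beta> b)"
  shows "0 < T (\<alpha> (a + t)) (\<beta> (b + t))"
proof -
  obtain R where R: "\<And>a b. R < b - a \<Longrightarrow> 0 < T (\<alpha> a) (\<beta> b)"
      using parallel_eventually_pos[OF par] by blast
  have step: "0 < T (\<alpha> (a + u)) (\<beta> (b + v))"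
    if pos: "0 < T (\<alpha> a) (\<beta> b)" and uv: "0 < u \<and> 0 < v \<or> u < 0 \<and> v < 0" "u < v" for a b u v
  proof -
    have half: "0 < T (\<alpha> (a + x)) (\<beta> (b + y))"
      if "0 < T (\<alpha> (a + 2 * x)) (\<beta> (b + 2 * y))" "0 < x \<and> 0 < y \<or> x < 0 \<and> y < 0" for x y
    proof -
      have *: "(a + (a + 2 * x)) / 2 = a + x" "(b + (b + 2 * y)) / 2 = b + y"
        "(a + 2 * x + a) / 2 = a + x" "(b + 2 * y + b) / 2 = b + y" by (auto simp: field_simps)
      have "T (\<alpha> a) (\<beta> b) + T (\<alpha> (a + 2 * x)) (\<beta> (b + 2 * y)) \<le> 2 * T (\<alpha> (a + x)) (\<beta> (b + y))"
        using parallel_midconcave[OF par pos that(1), unfolded *]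
            parallel_midconcave[OF par that(1) pos, unfolded *] that(2)
        by (auto simp: add.commute)
      then show ?thesis using pos that(1) by linarith
    qed
    have "0 < T (\<alpha> (a + u)) (\<beta> (b + v))" if "0 < T (\<alpha> (a + 2 ^ n * u)) (\<beta> (b + 2 ^ n * v))" for n
      using that
    proof (induction n)
      case (Suc n)
      have "0 < T (\<alpha> (a + 2 ^ n * u)) (\<beta> (b + 2 ^ n * v))"
        by (rule half) (use Suc.prems uv in \<open>auto simp: mult.assoc mult_pos_neg\<close>)
      then show ?case by (rule Suc.IH)
    qed simp
    moreover obtain n where "(R - (b - a)) / (v - u) < 2 ^ n" using real_arch_pow[of 2] by fastforce
    then have "R < (b + 2 ^ n * v) - (a + 2 ^ n * u)" using uv by (simp add: field_simps)
    then have "0 < T (\<alpha> (a + 2 ^ n * u)) (\<beta> (b + 2 ^ n * v))" by (rule R)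
    ultimately show ?thesis by blast
  qed
  have "continuous_on UNIV (\<lambda>d. T (\<alpha> (a + d)) (\<beta> b))"
    by (rule continuous_on_parallel_T[OF par]) (auto intro!: continuous_intros)
  then have "((\<lambda>d. T (\<alpha> (a + d)) (\<beta> b)) \<longlongrightarrow> T (\<alpha> (a + 0)) (\<beta> b)) (at 0)"
    unfolding continuous_on_def by blast
  then have "\<forall>\<^sub>F d in at 0. 0 < T (\<alpha> (a + d)) (\<beta> b)" using pos by (intro order_tendstoD(1)) auto
  then obtain e where e: "0 < e" "\<And>d. d \<noteq> 0 \<Longrightarrow> \<bar>d\<bar> < e \<Longrightarrow> 0 < T (\<alpha> (a + d)) (\<beta> b)"
    unfolding eventually_at by (auto simp: dist_real_def)
  show ?thesis
  proof (cases "t = 0")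
    case False
    define d where "d = min (e / 2) (\<bar>t\<bar> / 2)"
    have d: "0 < d" "d < e" "d < \<bar>t\<bar>" using e False by (auto simp: d_def)
    then have "0 < T (\<alpha> (a + d)) (\<beta> b)" using e by auto
    moreover have "0 < t - d \<and> 0 < t \<or> t - d < 0 \<and> t < 0" using d by linarith
    ultimately have "0 < T (\<alpha> (a + d + (t - d))) (\<beta> (b + t))" using d by (intro step) auto
    then show ?thesis by simp
  qed (use pos in simp)
qed

text \<open>A nonnegative midpoint concave function on the whole line is constant.\<close>

lemma parallel_translate:
  assumes par: "parallel \<alpha> \<beta>"
  shows "T (\<alpha> a) (\<beta> b) = T (\<alpha> 0) (\<beta> (b - a))"
proof (cases "0 < T (\<alpha> a) (\<beta> b)")
  case True
  define f where "f t = T (\<alpha> (a + t)) (\<beta> (b + t))" for t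
  have pos: "0 < f t" for t unfolding f_def by (rule parallel_pos_translate[OF par True])
  have "f 0 = f (- a)"
  proof (rule nonneg_midconcave_constant[where f = f])
    fix x d :: real assume d: "0 < d"
    have *: "(a + (x - d) + (a + (x + d))) / 2 = a + x"
        "(b + (x - d) + (b + (x + d))) / 2 = b + x" by auto
    show "f (x - d) + f (x + d) \<le> 2 * f x"
      using parallel_midconcave[OF par pos[unfolded f_def, of "x - d"]
          pos[unfolded f_def, of "x + d"], unfolded *] d
      unfolding f_def by simp
  qed (simp add: f_def)
  then show ?thesis by (simp add: f_def)
next
  case False
  then have "\<not> 0 < T (\<alpha> 0) (\<beta> (b - a))" using parallel_pos_translate[OF par, of 0 "b - a" a] by auto
  then show ?thesis using False T_nonneg[of "\<alpha> a" "\<beta> b"] T_nonneg[of "\<alpha> 0" "\<beta> (b - a)"] by linarith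
qed

text \<open>The time separations and causal relations of two parallel vertical lines at distance \<open>c\<close> in
  the Minkowski plane. In contrast to \<^const>\<open>synchronised_parallel_at\<close>, parameters \<open>s \<ge> t\<close> are
  included.\<close>

definition flat_pair :: "real \<Rightarrow> (real \<Rightarrow> 'a) \<Rightarrow> (real \<Rightarrow> 'a) \<Rightarrow> bool" where
  "flat_pair c \<alpha> \<beta> \<longleftrightarrow> parallel \<alpha> \<beta> \<and> 0 \<le> c \<and> (\<forall>s t.
     (caus X (\<alpha> s) (\<beta> t) \<longleftrightarrow> c \<le> t - s) \<and> (caus X (\<beta> s) (\<alpha> t) \<longleftrightarrow> c \<le> t - s) \<and>
     T (\<alpha> s) (\<beta> t) = (if c \<le> t - s then sqrt ((t - s)\<^sup>2 - c\<^sup>2) else 0) \<and>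
     T (\<beta> s) (\<alpha> t) = (if c \<le> t - s then sqrt ((t - s)\<^sup>2 - c\<^sup>2) else 0))"

lemma caus_right_closed:
  assumes "x \<in> pts X" "complete_timelike_line X \<beta>" "\<And>d. 0 < d \<Longrightarrow> caus X x (\<beta> (b + d))"
  shows "caus X x (\<beta> b)"
proof -
  have "continuous_map euclidean (ltop2 X) (\<lambda>t::real. (x, \<beta> t))"
    using line_cont[OF assms(2)] assms(1) by (simp add: continuous_map_pairwise o_def)
  then have "closedin euclidean {t \<in> topspace euclidean. (x, \<beta> t) \<in> {(x, y). x \<in> pts X \<and>
      y \<in> pts X \<and> caus X x y}}"
    by (rule closedin_continuous_map_preimage) (use closed_causality causally_closed_def in blast)
  then have "closed {t. caus X x (\<beta> t)}" using assms line_pts by (simp add: )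
  moreover have "(\<lambda>n. b + 1 / real (Suc n)) \<longlonglongrightarrow> b"
    using tendsto_add[OF tendsto_const LIMSEQ_inverse_real_of_nat, of b]
        by (simp add: inverse_eq_divide)
  ultimately show ?thesis
    using closed_sequentially[of "{t. caus X x (\<beta> t)}" "\<lambda>n. b + 1 / real (Suc n)" b] assms(3)
        by auto
qed

text \<open>Moving the second point to the future turns a causal relation into a timelike one, which is
  seen by \<open>T\<close>. Closedness of the causal relation allows to move the point back.\<close>

lemma caus_of_flat_T:
  assumes par: "parallel \<alpha> \<beta>" and c: "0 \<le> c"
    and T: "\<And>s t. T (\<alpha> s) (\<beta> t) = (if c \<le> t - s then sqrt ((t - s)\<^sup>2 - c\<^sup>2) else 0)"
  shows "caus X (\<alpha> s) (\<beta> t) \<longleftrightarrow> c \<le> t - s"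
proof
  assume *: "caus X (\<alpha> s) (\<beta> t)"
  show "c \<le> t - s"
  proof (rule field_le_epsilon)
    fix e :: real assume "0 < e"
    then have "0 < T (\<alpha> s) (\<beta> (t + e))"
      using parallel_extend(2)[OF par *, of s "t + e"] T_nonneg[of "\<alpha> s" "\<beta> t"] by linarith
    then show "c \<le> t - s + e" unfolding T by (auto split: if_splits)
  qed
next
  note l = parallelD[OF par]
  assume *: "c \<le> t - s"
  show "caus X (\<alpha> s) (\<beta> t)"
  proof (rule caus_right_closed)
    fix d :: real assume d: "0 < d"
    have "c\<^sup>2 < (t + d - s)\<^sup>2" using c * d by (intro power_strict_mono) auto
    then have "0 < T (\<alpha> s) (\<beta> (t + d))" unfolding T using * d by auto
    then show "caus X (\<alpha> s) (\<beta> (t + d))" using T_pos_imp_caus l line_pts by blast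
  qed (use l line_pts in auto)
qed

lemma line_shift:
  assumes "complete_timelike_line X \<alpha>" shows "complete_timelike_line X (\<lambda>t. \<alpha> (t + d))"
proof -
  have cont: "continuous_map euclidean (ltop X) (\<alpha> \<circ> (\<lambda>t. t + d))"
    using line_cont[OF assms] by (intro continuous_map_compose) (auto intro!: continuous_intros)
  have cc: "causal_curve X UNIV (\<lambda>t. \<alpha> (t + d))"
    unfolding causal_curve_def using cont line_caus[OF assms] by (auto simp: o_def)
  have "geodesic X UNIV (\<lambda>t. \<alpha> (t + d))"
    by (rule geodesicI[OF cc]) (use line_fin[OF assms] line_T[OF assms] in auto)
  moreover have "tsep X (\<alpha> (s + d)) (\<alpha> (t + d)) = ennreal (t - s)" if "s \<le> t" for s t
    using line_fin[OF assms] line_T[OF assms] that by (simp add: tsep_eq_T)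
  ultimately show ?thesis unfolding complete_timelike_line_def by auto
qed

lemma parallel_shift:
  assumes "parallel \<alpha> \<beta>" shows "parallel \<alpha> (\<lambda>t. \<beta> (t + d))"
proof -
  note l = parallelD[OF assms]
  obtain s s' where s: "s \<ge> 0" "s' \<ge> 0" "\<And>t. caus X (\<alpha> t) (\<beta> (t + s)) \<and> caus X (\<beta> t) (\<alpha> (t + s'))"
    using l(3) unfolding weakly_parallel_def by blast
  have "caus X (\<alpha> t) (\<beta> (t + (s + \<bar>d\<bar>) + d))" "caus X (\<beta> (t + d)) (\<alpha> (t + (s' + \<bar>d\<bar>)))" for t
    using parallel_extend(1)[OF assms s(3)[THEN conjunct1, of t], of t "t + (s + \<bar>d\<bar>) + d"]
      parallel_extend(1)[OF parallel_sym[OF assms] s(3)[THEN conjunct2, of "t + d"], of "t + d"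
          "t + (s' + \<bar>d\<bar>)"] by auto
  then have "weakly_parallel X \<alpha> (\<lambda>t. \<beta> (t + d))" unfolding weakly_parallel_def
    by (intro exI[of _ "s + \<bar>d\<bar>"] conjI exI[of _ "s' + \<bar>d\<bar>"]) (use s in \<open>auto simp: add.assoc\<close>)
  then show ?thesis using l line_shift parallel_def by blast
qed

text \<open>The four points \<open>\<alpha>(0)\<close>, \<open>\<alpha>(t)\<close>, \<open>\<beta>(r)\<close>, \<open>\<beta>(r + t)\<close>, in either possible chronological order
  of the middle two, turn the four-point inequality into the midpoint convexity that
  \<open>hyperbola_rigidity\<close> asks for.\<close>

theorem parallel_flat_pair:
  assumes par: "parallel \<alpha> \<beta>"
  obtains d c where "flat_pair c \<alpha> (\<lambda>t. \<beta> (t + d))"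
proof -
  have par': "parallel \<beta> \<alpha>" by (rule parallel_sym[OF par])
  note l = parallelD[OF par]
  define gap where "gap \<alpha> \<beta> r = T (\<alpha> 0) (\<beta> r)" for \<alpha> \<beta> :: "real \<Rightarrow> 'a" and r :: real
  have gap: "T (\<alpha> a) (\<beta> b) = gap \<alpha> \<beta> (b - a)" if "parallel \<alpha> \<beta>" for \<alpha> \<beta> a b
    unfolding gap_def by (rule parallel_translate[OF that])
  have cont: "continuous_on UNIV (gap \<alpha> \<beta>)" if "parallel \<alpha> \<beta>" for \<alpha> \<beta>
    unfolding gap_def by (rule continuous_on_parallel_T[OF that]) (auto intro!: continuous_intros)
  have same: "2 * (gap \<alpha> \<beta> r)\<^sup>2 + 2 * t\<^sup>2 \<le> (gap \<alpha> \<beta> (r + t))\<^sup>2 + (gap \<alpha> \<beta> (r - t))\<^sup>2"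
    if p: "parallel \<alpha> \<beta>" and pos: "0 < gap \<alpha> \<beta> (r - t)" "0 < t" for \<alpha> \<beta> r t
  proof -
    note l = parallelD[OF p]
    have "2 * (T (\<alpha> 0) (\<alpha> t))\<^sup>2 + 2 * (T (\<alpha> 0) (\<beta> r))\<^sup>2
      \<le> (T (\<alpha> 0) (\<beta> (r + t)))\<^sup>2 + (T (\<alpha> t) (\<beta> r))\<^sup>2"
      by (rule four_point_inequality)
        (use l line_pts line_chron line_T parallel_chron[OF p] parallel_fin[OF p] gap[OF p]
            pos in auto)
    then show ?thesis using gap[OF p] line_T[OF l(1)] pos by simp
  qed
  have mixed: "2 * (gap \<alpha> \<beta> r)\<^sup>2 + 2 * t\<^sup>2 \<le> (gap \<alpha> \<beta> (r + t))\<^sup>2 + (gap \<beta> \<alpha> (t - r))\<^sup>2"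
    if p: "parallel \<alpha> \<beta>" and pos: "0 < gap \<alpha> \<beta> r" "0 < gap \<beta> \<alpha> (t - r)" for \<alpha> \<beta> r t
  proof -
    note l = parallelD[OF p] and p' = parallel_sym[OF p]
    have ch: "chron X (\<alpha> 0) (\<beta> r)" "chron X (\<beta> r) (\<alpha> t)" "chron X (\<alpha> t) (\<beta> (r + t))"
      using parallel_chron[OF p] parallel_chron[OF p'] gap[OF p] gap[OF p'] pos by auto
    then have "caus X (\<alpha> 0) (\<alpha> t)" using chron_imp_caus caus_trans line_pts l by blast
    then have "0 \<le> t" using line_caus[OF l(1)] by simp
    then have "2 * (T (\<alpha> 0) (\<beta> r))\<^sup>2 + 2 * (T (\<alpha> 0) (\<alpha> t))\<^sup>2
      \<le> (T (\<alpha> 0) (\<beta> (r + t)))\<^sup>2 + (T (\<beta> r) (\<alpha> t))\<^sup>2"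
      by (intro four_point_inequality)
        (use ch l line_pts line_T parallel_fin[OF p] gap[OF p] in auto)
    then show ?thesis using gap[OF p] gap[OF p'] line_T[OF l(1)] \<open>0 \<le> t\<close> by simp
  qed
  have up: "0 < gap \<alpha> \<beta> r'" if "parallel \<alpha> \<beta>" "0 < gap \<alpha> \<beta> r" "r \<le> r'" for \<alpha> \<beta> r r'
    using parallel_extend_pos[OF that(1), of 0 r 0 r'] that by (simp add: gap_def)
  have loop: "gap \<alpha> \<beta> u + gap \<beta> \<alpha> v \<le> u + v" if pos: "0 < gap \<alpha> \<beta> u" "0 < gap \<beta> \<alpha> v" for u v
  proof -
    have "T (\<beta> u) (\<alpha> (u + v)) = gap \<beta> \<alpha> v" using gap[OF par'] by simp
    then have c: "caus X (\<alpha> 0) (\<beta> u)" "caus X (\<beta> u) (\<alpha> (u + v))"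
      using pos l line_pts T_pos_imp_caus unfolding gap_def by auto
    then have "caus X (\<alpha> 0) (\<alpha> (u + v))" using caus_trans line_pts l by blast
    then have "0 \<le> u + v" using line_caus[OF l(1)] by simp
    then show ?thesis using T_triangle(3)[OF c] line_fin[OF l(1)] line_pts l gap[OF par]
        gap[OF par'] line_T[OF l(1)] by auto
  qed
  obtain R1 where R1: "\<And>a b. R1 < b - a \<Longrightarrow> 0 < T (\<alpha> a) (\<beta> b)"
    by (rule parallel_eventually_pos[OF par]) (rule that)
  obtain R2 where R2: "\<And>a b. R2 < b - a \<Longrightarrow> 0 < T (\<beta> a) (\<alpha> b)"
    by (rule parallel_eventually_pos[OF par']) (rule that)
  have R: "0 < gap \<alpha> \<beta> r" "0 < gap \<beta> \<alpha> r" if "max R1 R2 < r" for r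
    using R1[of r 0] R2[of r 0] that by (auto simp: gap_def)
  have nn: "0 \<le> gap \<alpha> \<beta> r" for \<alpha> \<beta> r by (simp add: gap_def)
  obtain \<omega> c where c: "0 \<le> c"
    and g: "\<And>r. gap \<alpha> \<beta> r = (if c \<le> r + \<omega> then sqrt ((r + \<omega>)\<^sup>2 - c\<^sup>2) else 0)"
    and h: "\<And>r. gap \<beta> \<alpha> r = (if c \<le> r - \<omega> then sqrt ((r - \<omega>)\<^sup>2 - c\<^sup>2) else 0)"
    by (rule hyperbola_rigidity[OF cont[OF par] cont[OF par'] nn nn R up[OF par] up[OF par']
      loop same[OF par] same[OF par'] mixed[OF par] mixed[OF par']]) (assumption | rule that)+
  define \<beta>' where "\<beta>' t = \<beta> (t + - \<omega>)" for t
  have p: "parallel \<alpha> \<beta>'" unfolding \<beta>'_def by (rule parallel_shift[OF par])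
  have 1: "T (\<alpha> s) (\<beta>' t) = (if c \<le> t - s then sqrt ((t - s)\<^sup>2 - c\<^sup>2) else 0)" for s t
    unfolding \<beta>'_def gap[OF par] g by simp
  have 2: "T (\<beta>' s) (\<alpha> t) = (if c \<le> t - s then sqrt ((t - s)\<^sup>2 - c\<^sup>2) else 0)" for s t
    unfolding \<beta>'_def gap[OF par'] h by simp
  have "flat_pair c \<alpha> \<beta>'" unfolding flat_pair_def
    using p c 1 2 caus_of_flat_T[OF p c 1] caus_of_flat_T[OF parallel_sym[OF p] c 2] by auto
  then show thesis using that unfolding \<beta>'_def by blast
qed

end

section \<open>Synchronisation\<close>

lemma sqrt_asymptotic:
  fixes c e u :: real
  assumes "0 < e" "(c\<^sup>2 + e\<^sup>2) / (2 * e) \<le> u"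
  shows "u - e \<le> sqrt (u\<^sup>2 - c\<^sup>2)"
proof (rule real_le_rsqrt)
  have "c\<^sup>2 + e\<^sup>2 \<le> 2 * e * u" using assms by (simp add: field_simps)
  then show "(u - e)\<^sup>2 \<le> u\<^sup>2 - c\<^sup>2" by (simp add: power2_diff algebra_simps)
qed

context upper_curvature_zero
begin

lemma flat_pairD:
  assumes "flat_pair c \<alpha> \<beta>"
  shows "parallel \<alpha> \<beta>" "0 \<le> c"
    "caus X (\<alpha> s) (\<beta> t) \<longleftrightarrow> c \<le> t - s" "caus X (\<beta> s) (\<alpha> t) \<longleftrightarrow> c \<le> t - s"
    "T (\<alpha> s) (\<beta> t) = (if c \<le> t - s then sqrt ((t - s)\<^sup>2 - c\<^sup>2) else 0)"
    "T (\<beta> s) (\<alpha> t) = (if c \<le> t - s then sqrt ((t - s)\<^sup>2 - c\<^sup>2) else 0)"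
  using assms unfolding flat_pair_def by blast+

lemma flat_pair_line:
  assumes "flat_pair c \<alpha> \<beta>"
  shows "complete_timelike_line X \<alpha>" "complete_timelike_line X \<beta>"
  using parallelD flat_pairD(1)[OF assms] by auto

lemma flat_pair_sym: "flat_pair c \<alpha> \<beta> \<Longrightarrow> flat_pair c \<beta> \<alpha>"
  unfolding flat_pair_def using parallel_sym by blast

lemma flat_pair_chron:
  assumes "flat_pair c \<alpha> \<beta>" "c < t - s"
  shows "chron X (\<alpha> s) (\<beta> t)"
proof -
  note f = flat_pairD[OF assms(1)]
  have "c\<^sup>2 < (t - s)\<^sup>2" using f assms by (intro power_strict_mono) auto
  then show ?thesis using parallel_chron[OF f(1)] f(5) assms by simp
qed

lemma flat_pair_refl:
  assumes "complete_timelike_line X \<alpha>" shows "flat_pair 0 \<alpha> \<alpha>"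
proof -
  have "weakly_parallel X \<alpha> \<alpha>" unfolding weakly_parallel_def
    by (intro exI[of _ 0] conjI) (use line_caus[OF assms] in auto)
  then show ?thesis unfolding flat_pair_def parallel_def
    using assms line_caus[OF assms] line_T[OF assms] by auto
qed

lemma flat_pair_T_le:
  assumes "flat_pair c \<alpha> \<beta>" "0 < T (\<alpha> s) (\<beta> t)"
  shows "T (\<alpha> s) (\<beta> t) \<le> t - s"
proof -
  note f = flat_pairD[OF assms(1)]
  have "c \<le> t - s" using f(5)[of s t] assms by (auto split: if_splits)
  then have "0 \<le> t - s" using f(2) by simp
  have "sqrt ((t - s)\<^sup>2 - c\<^sup>2) \<le> t - s" by (rule real_le_lsqrt) (use \<open>0 \<le> t - s\<close> in auto)
  then show ?thesis using f(5) \<open>c \<le> t - s\<close> by simp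
qed

text \<open>The shift that synchronises two lines is detected by the limits of \<open>\<tau>(\<alpha>(0), \<beta>(t)) - t\<close> and
  \<open>\<tau>(\<beta>(0), \<alpha>(t)) - t\<close>, which are opposite to each other. Hence two lower bounds suffice to see
  that no shift is necessary.\<close>

lemma flat_pair_of_asymptotics:
  assumes par: "parallel \<alpha> \<beta>"
    and 1: "\<And>e. 0 < e \<Longrightarrow> \<exists>t. 0 < T (\<alpha> 0) (\<beta> t) \<and> t - e \<le> T (\<alpha> 0) (\<beta> t)"
    and 2: "\<And>e. 0 < e \<Longrightarrow> \<exists>t. 0 < T (\<beta> 0) (\<alpha> t) \<and> t - e \<le> T (\<beta> 0) (\<alpha> t)"
  obtains c where "flat_pair c \<alpha> \<beta>"
proof -
  obtain d c where f: "flat_pair c \<alpha> (\<lambda>t. \<beta> (t + d))"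
      by (rule parallel_flat_pair[OF par]) (rule that)
  have "d \<le> 0"
  proof (rule field_le_epsilon)
    fix e :: real assume "0 < e"
    then obtain t where t: "0 < T (\<alpha> 0) (\<beta> t)" "t - e \<le> T (\<alpha> 0) (\<beta> t)" using 1 by blast
    then show "d \<le> 0 + e" using flat_pair_T_le[OF f, of 0 "t - d"] by simp
  qed
  moreover have "- d \<le> 0"
  proof (rule field_le_epsilon)
    fix e :: real assume "0 < e"
    then obtain t where t: "0 < T (\<beta> 0) (\<alpha> t)" "t - e \<le> T (\<beta> 0) (\<alpha> t)" using 2 by blast
    then show "- d \<le> 0 + e" using flat_pair_T_le[OF flat_pair_sym[OF f], of "- d" t] by simp
  qed
  ultimately have "d = 0" by simp
  then show thesis using that f by simp
qed

lemma flat_pair_imp_synchronised: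
  assumes "flat_pair c \<alpha> \<beta>" shows "synchronised_parallel_at X c \<alpha> \<beta>"
  using flat_pairD[OF assms] parallel_fin[OF flat_pairD(1)[OF assms]]
    parallel_fin[OF parallel_sym[OF flat_pairD(1)[OF assms]]]
  unfolding synchronised_parallel_at_def by (simp add: tsep_eq_T)

text \<open>The pair is flat after some shift and for some constant. The asymptotics exclude a shift,
  and a single value of the separation determines the constant.\<close>

lemma synchronised_imp_flat_pair:
  assumes lines: "complete_timelike_line X \<alpha>" "complete_timelike_line X \<beta>"
    and sync: "synchronised_parallel_at X c \<alpha> \<beta>"
  shows "flat_pair c \<alpha> \<beta>"
proof -
  have c: "0 \<le> c" and caus: "\<And>s t. s < t \<Longrightarrow> c \<le> t - s \<Longrightarrow> caus X (\<alpha> s) (\<beta> t) \<and> caus X (\<beta> s) (\<alpha> t)"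
    and tsep: "\<And>s t. s < t \<Longrightarrow> c \<le> t - s \<Longrightarrow> tsep X (\<alpha> s) (\<beta> t) = ennreal (sqrt ((t - s)\<^sup>2 - c\<^sup>2))
       \<and> tsep X (\<beta> s) (\<alpha> t) = ennreal (sqrt ((t - s)\<^sup>2 - c\<^sup>2))"
    using sync unfolding synchronised_parallel_at_def by auto
  have "weakly_parallel X \<alpha> \<beta>" unfolding weakly_parallel_def
    by (intro exI[of _ "c + 1"] conjI) (use c caus in auto)
  then have par: "parallel \<alpha> \<beta>" using lines parallel_def by blast
  have Tc: "T (\<alpha> 0) (\<beta> t) = sqrt (t\<^sup>2 - c\<^sup>2)" "T (\<beta> 0) (\<alpha> t) = sqrt (t\<^sup>2 - c\<^sup>2)" "c\<^sup>2 < t\<^sup>2"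
      if "c < t" for t
  proof -
    show *: "c\<^sup>2 < t\<^sup>2" using that c by (intro power_strict_mono) auto
    show "T (\<alpha> 0) (\<beta> t) = sqrt (t\<^sup>2 - c\<^sup>2)" "T (\<beta> 0) (\<alpha> t) = sqrt (t\<^sup>2 - c\<^sup>2)"
      using tsep[of 0 t] that c * by (auto simp: T_def)
  qed
  have asym: "\<exists>t. c < t \<and> t - e \<le> sqrt (t\<^sup>2 - c\<^sup>2)" if "0 < e" for e
    by (rule exI[of _ "max (c + 1) ((c\<^sup>2 + e\<^sup>2) / (2 * e))"])
      (use sqrt_asymptotic[OF that] in \<open>auto simp del: divide_le_eq_numeral1\<close>)
  obtain k where k: "flat_pair k \<alpha> \<beta>"
  proof (rule flat_pair_of_asymptotics[OF par])
    fix e :: real assume "0 < e"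
    then obtain t where "c < t" "t - e \<le> sqrt (t\<^sup>2 - c\<^sup>2)" using asym by blast
    then show "\<exists>t. 0 < T (\<alpha> 0) (\<beta> t) \<and> t - e \<le> T (\<alpha> 0) (\<beta> t)"
       "\<exists>t. 0 < T (\<beta> 0) (\<alpha> t) \<and> t - e \<le> T (\<beta> 0) (\<alpha> t)"
      using Tc[of t] by (auto intro!: exI[of _ t])
  qed (rule that)
  define t where "t = max c k + 1"
  have ct: "c < t" and kt: "k \<le> t" by (auto simp: t_def)
  have "sqrt (t\<^sup>2 - c\<^sup>2) = sqrt (t\<^sup>2 - k\<^sup>2)"
    using Tc(1)[OF ct] flat_pairD(5)[OF k, of 0 t] kt by simp
  then have "c\<^sup>2 = k\<^sup>2" by simp
  then have "c = k" using c flat_pairD(2)[OF k] by (simp add: power2_eq_iff_nonneg)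
  then show ?thesis using k by simp
qed

text \<open>The defects \<open>t - \<tau>(\<alpha>(0), \<beta>(t))\<close> and \<open>t - \<tau>(\<beta>(0), \<delta>(t))\<close>, which tend to \<open>0\<close>, add up to a
  bound for the defect of \<open>\<alpha>\<close> and \<open>\<delta>\<close>.\<close>

lemma flat_pair_trans:
  assumes "flat_pair a \<alpha> \<beta>" "flat_pair b \<beta> \<delta>"
  obtains c where "flat_pair c \<alpha> \<delta>" "c \<le> a + b"
proof -
  note f = flat_pairD[OF assms(1)] flat_pairD[OF assms(2)]
  have par: "parallel \<alpha> \<delta>" using parallel_trans f by blast
  note lines = flat_pair_line[OF assms(1)] flat_pair_line[OF assms(2)]
  have bound: "\<exists>t. 0 < T (\<alpha> 0) (\<delta> t) \<and> t - e \<le> T (\<alpha> 0) (\<delta> t)"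
    if e: "0 < e" and f1: "flat_pair a \<alpha> \<beta>" and f2: "flat_pair b \<beta> \<delta>" for e :: real and a b \<alpha> \<beta> \<delta>
  proof -
    note f = flat_pairD[OF f1] flat_pairD[OF f2]
    note lines = flat_pair_line[OF f1] flat_pair_line[OF f2]
    have par: "parallel \<alpha> \<delta>" using parallel_trans f by blast
    define r where "r = max (max (a + 1) (b + 1)) (max ((a\<^sup>2 + (e/2)\<^sup>2) / (2 * (e/2))) ((b\<^sup>2 +
        (e/2)\<^sup>2) / (2 * (e/2))))"
    have r: "a < r" "b < r" "(a\<^sup>2 + (e/2)\<^sup>2) / (2 * (e/2)) \<le> r" "(b\<^sup>2 + (e/2)\<^sup>2) / (2 * (e/2)) \<le> r"
      unfolding r_def by linarith+
    have half: "0 < e / 2" using e by simp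
    have "a\<^sup>2 < r\<^sup>2" using r f by (intro power_strict_mono) auto
    then have "0 < T (\<alpha> 0) (\<beta> r)" using r f(5)[of 0 r] by simp
    have c: "caus X (\<alpha> 0) (\<beta> r)" "caus X (\<beta> r) (\<delta> (2 * r))" using f r by auto
    have "T (\<alpha> 0) (\<beta> r) + T (\<beta> r) (\<delta> (2 * r)) \<le> T (\<alpha> 0) (\<delta> (2 * r))"
      using T_triangle(3)[OF c parallel_fin[OF par]] lines line_pts by blast
    moreover have "r - e / 2 \<le> T (\<alpha> 0) (\<beta> r)" "r - e / 2 \<le> T (\<beta> r) (\<delta> (2 * r))"
      using sqrt_asymptotic[OF half r(3)] sqrt_asymptotic[OF half r(4)] f(5)[of 0 r]
          f(11)[of r "2 * r"] r by auto
    ultimately have "2 * r - e \<le> T (\<alpha> 0) (\<delta> (2 * r))" "0 < T (\<alpha> 0) (\<delta> (2 * r))"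
      using \<open>0 < T (\<alpha> 0) (\<beta> r)\<close> T_nonneg[of "\<beta> r" "\<delta> (2 * r)"] by linarith+
    then show ?thesis by blast
  qed
  obtain c where c: "flat_pair c \<alpha> \<delta>"
    by (rule flat_pair_of_asymptotics[OF par])
      (rule bound assms flat_pair_sym[OF assms(1)] flat_pair_sym[OF assms(2)] that | assumption)+
  have "caus X (\<alpha> 0) (\<beta> a)" "caus X (\<beta> a) (\<delta> (a + b))" using f by auto
  then have "caus X (\<alpha> 0) (\<delta> (a + b))" using caus_trans lines line_pts by blast
  then have "c \<le> a + b" using flat_pairD(3)[OF c] by simp
  then show thesis using that c by blast
qed

lemma flat_pair_unique:
  assumes "flat_pair c \<alpha> \<beta>" "flat_pair k \<alpha> (\<lambda>t. \<beta> (t + d))"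
  shows "c = k" "d = 0"
proof -
  have "c \<le> k + d" using flat_pairD(3)[OF assms(1), of 0 "k + d"]
      flat_pairD(3)[OF assms(2), of 0 k] by simp
  moreover have "k \<le> c - d" using flat_pairD(3)[OF assms(1), of 0 c]
      flat_pairD(3)[OF assms(2), of 0 "c - d"] by simp
  moreover have "c \<le> k - d" using flat_pairD(4)[OF assms(1), of d k]
      flat_pairD(4)[OF assms(2), of 0 k] by simp
  moreover have "k \<le> c + d" using flat_pairD(4)[OF assms(1), of 0 c]
      flat_pairD(4)[OF assms(2), of "- d" c] by simp
  ultimately show "c = k" "d = 0" by auto
qed

section \<open>Concatenation of geodesics\<close>

text \<open>Equality in the reverse triangle inequality at \<open>p\<close> makes the concatenation of geodesics from
  \<open>x\<close> to \<open>p\<close> and from \<open>p\<close> to \<open>y\<close> a geodesic.\<close>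

lemma divides_of_T:
  assumes pts: "x \<in> pts X" "p \<in> pts X" "y \<in> pts X" and fin: "fin x y"
    and ch: "chron X x p" "chron X p y" and l: "0 < l" "l < 1"
    and T: "T x p = l * T x y" "T p y = (1 - l) * T x y"
  shows "divides x y l p"
proof -
  have caus: "caus X x p" "caus X p y" using ch chron_imp_caus pts by auto
  note tri = T_triangle[OF caus fin pts]
  have total: "T x p + T p y = T x y" unfolding T by (simp add: algebra_simps)
  have "\<exists>G. geodesic_segment X x p G" "\<exists>G. geodesic_segment X p y G"
    using divides_ends[OF ch(1) tri(1) pts(1,2)] divides_ends[OF ch(2) tri(2) pts(2,3)]
    unfolding divides_def by blast+
  then obtain G H where G: "geodesic_segment X x p G" and H: "geodesic_segment X p y H" by blast
  obtain \<sigma> a b where s: "a \<le> b" "geodesic X {a..b} \<sigma>" "\<sigma> a = x" "\<sigma> b = p" "G = \<sigma> ` {a..b}"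
    "\<And>s. s \<in> {a..b} \<Longrightarrow> \<sigma> s \<in> pts X"
    and sc: "\<And>s t. a \<le> s \<Longrightarrow> s \<le> t \<Longrightarrow> t \<le> b \<Longrightarrow> caus X (\<sigma> s) (\<sigma> t)"
    and "\<And>s t. a \<le> s \<Longrightarrow> s \<le> t \<Longrightarrow> t \<le> b \<Longrightarrow> fin (\<sigma> s) (\<sigma> t)"
    and sadd: "\<And>r s t. a \<le> r \<Longrightarrow> r \<le> s \<Longrightarrow> s \<le> t \<Longrightarrow> t \<le> b \<Longrightarrow>
        T (\<sigma> r) (\<sigma> s) + T (\<sigma> s) (\<sigma> t) = T (\<sigma> r) (\<sigma> t)"
    and "continuous_on {a..b} (\<lambda>s. T x (\<sigma> s))"
    and scont: "continuous_map (top_of_set {a..b}) (ltop X) \<sigma>"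
    by (rule geodesic_segmentE[OF G tri(1) pts(1,2)]) (rule that)
  obtain \<rho> a' b' where r: "a' \<le> b'" "geodesic X {a'..b'} \<rho>" "\<rho> a' = p" "\<rho> b' = y" "H = \<rho> ` {a'..b'}"
    "\<And>s. s \<in> {a'..b'} \<Longrightarrow> \<rho> s \<in> pts X"
    and rc: "\<And>s t. a' \<le> s \<Longrightarrow> s \<le> t \<Longrightarrow> t \<le> b' \<Longrightarrow> caus X (\<rho> s) (\<rho> t)"
    and "\<And>s t. a' \<le> s \<Longrightarrow> s \<le> t \<Longrightarrow> t \<le> b' \<Longrightarrow> fin (\<rho> s) (\<rho> t)"
    and radd: "\<And>r s t. a' \<le> r \<Longrightarrow> r \<le> s \<Longrightarrow> s \<le> t \<Longrightarrow> t \<le> b' \<Longrightarrow>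
        T (\<rho> r) (\<rho> s) + T (\<rho> s) (\<rho> t) = T (\<rho> r) (\<rho> t)"
    and "continuous_on {a'..b'} (\<lambda>s. T p (\<rho> s))"
    and rcont: "continuous_map (top_of_set {a'..b'}) (ltop X) \<rho>"
    by (rule geodesic_segmentE[OF H tri(2) pts(2,3)]) (rule that)
  define e where "e = b + (b' - a')"
  define \<kappa> where "\<kappa> t = (if t \<le> b then \<sigma> t else \<rho> (t - b + a'))" for t
  have le: "a \<le> b" "b \<le> e" using s r by (auto simp: e_def)
  have left: "\<kappa> t = \<sigma> t" if "t \<le> b" for t using that by (simp add: \<kappa>_def)
  have right: "\<kappa> t = \<rho> (t - b + a')" if "b \<le> t" for t using that s(4) r(3) by (auto simp: \<kappa>_def)
  have ends: "\<kappa> a = x" "\<kappa> b = p" "\<kappa> e = y" using s r le left right[of e] by (auto simp: e_def)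
  have kpts: "\<kappa> t \<in> pts X" if "a \<le> t" "t \<le> e" for t
    using s(6)[of t] r(6)[of "t - b + a'"] that by (auto simp: \<kappa>_def e_def)
  have cl: "caus X (\<kappa> u) (\<kappa> v)" if "a \<le> u" "u \<le> v" "v \<le> b" for u v using sc that left by auto
  have cr: "caus X (\<kappa> u) (\<kappa> v)" if "b \<le> u" "u \<le> v" "v \<le> e" for u v
    using rc[of "u - b + a'" "v - b + a'"] that right by (auto simp: e_def)
  have kc: "caus X (\<kappa> u) (\<kappa> v)" if "a \<le> u" "u \<le> v" "v \<le> e" for u v
  proof (cases "u \<le> b \<and> b \<le> v")
    case True
    then have "caus X (\<kappa> u) (\<kappa> b)" "caus X (\<kappa> b) (\<kappa> v)" using cl cr that by auto
    then show ?thesis using caus_trans kpts that le by (meson True order_trans)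
  qed (use cl cr that in force)
  have kf: "fin (\<kappa> u) (\<kappa> v)" if "a \<le> u" "u \<le> v" "v \<le> e" for u v
    using fin_between[OF fin, of "\<kappa> u" "\<kappa> v"] kc[of a u] kc[of v e] kpts that pts ends by auto
  have tri3: "T (\<kappa> u) (\<kappa> v) + T (\<kappa> v) (\<kappa> w) \<le> T (\<kappa> u) (\<kappa> w)"
    if "a \<le> u" "u \<le> v" "v \<le> w" "w \<le> e" for u v w
    by (rule T_triangle(3)) (use kc kf kpts that in auto)
  have addl: "T (\<kappa> u) (\<kappa> v) + T (\<kappa> v) (\<kappa> w) = T (\<kappa> u) (\<kappa> w)" if "a \<le> u" "u \<le> v" "v \<le> w" "w \<le> b"
      for u v w
    using sadd that left by auto
  have addr: "T (\<kappa> u) (\<kappa> v) + T (\<kappa> v) (\<kappa> w) = T (\<kappa> u) (\<kappa> w)" if "b \<le> u" "u \<le> v" "v \<le> w" "w \<le> e"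
      for u v w
    using radd[of "u - b + a'" "v - b + a'" "w - b + a'"] that right by (auto simp: e_def)
  have tot: "T (\<kappa> a) (\<kappa> b) + T (\<kappa> b) (\<kappa> e) = T (\<kappa> a) (\<kappa> e)" using total ends by simp
  \<comment> \<open>the chain through \<open>u\<close> and \<open>v\<close> is at most \<open>T x y\<close>, and at least the chain through \<open>u\<close>, \<open>v\<close> and
      \<open>p\<close>\<close>
  have full: "T (\<kappa> a) (\<kappa> u) + T (\<kappa> u) (\<kappa> v) + T (\<kappa> v) (\<kappa> e) = T (\<kappa> a) (\<kappa> e)"
    if "a \<le> u" "u \<le> v" "v \<le> e" for u v
  proof (rule antisym)
    show "T (\<kappa> a) (\<kappa> u) + T (\<kappa> u) (\<kappa> v) + T (\<kappa> v) (\<kappa> e) \<le> T (\<kappa> a) (\<kappa> e)"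
      using tri3[of a u v] tri3[of a v e] that by simp
    consider "v \<le> b" | "u \<le> b" "b \<le> v" | "b \<le> u" by linarith
    then show "T (\<kappa> a) (\<kappa> e) \<le> T (\<kappa> a) (\<kappa> u) + T (\<kappa> u) (\<kappa> v) + T (\<kappa> v) (\<kappa> e)"
    proof cases
      case 1
      then show ?thesis using addl[of a u v] addl[of a v b] tri3[of v b e] tot that le by simp
    next
      case 2
      then show ?thesis using addl[of a u b] addr[of b v e] tri3[of u b v] tot that le by simp
    next
      case 3
      then show ?thesis using tri3[of a b u] addr[of u v e] addr[of b u e] tot that le by simp
    qed
  qed
  have zero: "T (\<kappa> u) (\<kappa> u) = 0" if "a \<le> u" "u \<le> e" for u
    using fin_diag[OF kf[of u u]] kc[of u u] kpts that by auto
  have "continuous_map (top_of_set {a..e}) (ltop X) \<kappa>"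
    unfolding \<kappa>_def
  proof (rule continuous_map_cases_le)
    show "continuous_map (top_of_set {a..e}) euclideanreal (\<lambda>t. t)"
        "continuous_map (top_of_set {a..e}) euclideanreal (\<lambda>t. b)"
      by (auto intro!: continuous_intros)
    have "{x \<in> {a..e}. x \<le> b} = {a..b}" using le by auto
    then show "continuous_map (subtopology (top_of_set {a..e}) {x \<in> topspace (top_of_set {a..e}).
        x \<le> b}) (ltop X) \<sigma>"
      using scont le by (simp add: subtopology_subtopology Int_absorb1)
    have eq: "{a..e} \<inter> {x. a \<le> x \<and> x \<le> e \<and> b \<le> x} = {b..e}" using le by auto
    have "continuous_map (top_of_set {b..e}) (ltop X) (\<rho> \<circ> (\<lambda>t. t - b + a'))"
      by (rule continuous_map_compose[OF _ rcont]) (auto intro!: continuous_intros simp: e_def)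
    then show "continuous_map (subtopology (top_of_set {a..e}) {x \<in> topspace (top_of_set {a..e}).
        b \<le> x}) (ltop X) (\<lambda>t. \<rho> (t - b + a'))"
      using le by (simp add: subtopology_subtopology eq o_def Int_absorb1)
  qed (use s r in auto)
  then have "causal_curve X {a..e} \<kappa>" unfolding causal_curve_def
      using kc by (auto simp: is_interval_cc)
  then have "geodesic X {a..e} \<kappa>"
  proof (rule geodesicI)
    fix u v w assume "u \<in> {a..e}" "v \<in> {a..e}" "w \<in> {a..e}" "u \<le> v" "v \<le> w"
    then show "T (\<kappa> u) (\<kappa> v) + T (\<kappa> v) (\<kappa> w) = T (\<kappa> u) (\<kappa> w)"
      using full[of u v] full[of v w] full[of u w] full[of v v] zero[of v] by simp
  qed (use kf in auto)
  then have "geodesic_segment X x y (\<kappa> ` {a..e})" unfolding geodesic_segment_def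
    using ends le by (intro exI[of _ \<kappa>] exI[of _ a] exI[of _ e]) auto
  moreover have "p \<in> \<kappa> ` {a..e}" using ends le by force
  ultimately show ?thesis unfolding divides_def using l T by auto
qed

text \<open>The causal relation need not be antisymmetric, so \<open>\<alpha>(t) \<le> \<beta>(t) \<le> \<alpha>(t)\<close> does not suffice. But
  both points are midpoints of geodesics from \<open>\<alpha>(t - 1)\<close> to \<open>\<alpha>(t + 1)\<close>.\<close>

lemma flat_pair_0_eq:
  assumes "flat_pair 0 \<alpha> \<beta>" shows "\<beta> = \<alpha>"
proof
  fix t
  note f = flat_pairD[OF assms] and l = flat_pair_line[OF assms]
  have "divides (\<alpha> (t - 1)) (\<alpha> (t + 1)) (1/2) (\<alpha> t)"
    using line_divides[OF l(1), of "t - 1" "t + 1" "1/2"] by simp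
  moreover have "divides (\<alpha> (t - 1)) (\<alpha> (t + 1)) (1/2) (\<beta> t)"
    by (rule divides_of_T) (use l line_pts line_fin line_T f flat_pair_chron[OF assms]
      flat_pair_chron[OF flat_pair_sym[OF assms]] in auto)
  ultimately show "\<beta> t = \<alpha> t"
    using divides_unique line_chron[OF l(1)] line_fin[OF l(1)] line_pts[OF l(1)]
        by (metis add_less_cancel_left diff_add_cancel less_add_one less_trans)
qed

text \<open>Only continuity is at stake. Every point of \<open>\<mu>\<close> between \<open>\<mu>(-n)\<close> and \<open>\<mu>(n)\<close> lies on a
  concatenation of two geodesics, so by uniqueness on one fixed geodesic \<open>\<rho>\<close> from \<open>\<mu>(-n)\<close> to
  \<open>\<mu>(n)\<close>. Hence \<open>\<mu>\<close> composed with the arclength parameter of \<open>\<rho>\<close> is \<open>\<rho>\<close>, and that parameter is a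
  quotient map.\<close>

lemma complete_timelike_lineI:
  fixes \<mu> :: "real \<Rightarrow> 'a"
  assumes pts: "\<And>t. \<mu> t \<in> pts X" and f: "\<And>s t. s \<le> t \<Longrightarrow> fin (\<mu> s) (\<mu> t)"
    and T: "\<And>s t. s \<le> t \<Longrightarrow> T (\<mu> s) (\<mu> t) = t - s"
  shows "complete_timelike_line X \<mu>"
proof -
  have ch: "chron X (\<mu> s) (\<mu> t)" if "s < t" for s t
      using chron_iff[OF f pts pts, of s t] T that by simp
  have caus: "caus X (\<mu> s) (\<mu> t)" if "s \<le> t" for s t
    using chron_imp_caus[OF ch pts pts, of s t] caus_refl[OF pts] that by (cases "s = t") auto
  have cont: "continuous_map (top_of_set {-n..n}) (ltop X) \<mu>" if n: "0 < n" for n :: real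
  proof -
    let ?x = "\<mu> (- n)" and ?y = "\<mu> n"
    have xy: "chron X ?x ?y" "fin ?x ?y" "T ?x ?y = 2 * n" using ch f T n by auto
    obtain G where G: "geodesic_segment X ?x ?y G"
      using divides_ends[OF xy(1,2) pts pts] unfolding divides_def by blast
    obtain \<rho> a b where r: "a \<le> b" "geodesic X {a..b} \<rho>" "\<rho> a = ?x" "\<rho> b = ?y" "G = \<rho> ` {a..b}"
      "\<And>s. s \<in> {a..b} \<Longrightarrow> \<rho> s \<in> pts X"
      "\<And>s t. a \<le> s \<Longrightarrow> s \<le> t \<Longrightarrow> t \<le> b \<Longrightarrow> caus X (\<rho> s) (\<rho> t)"
      "\<And>s t. a \<le> s \<Longrightarrow> s \<le> t \<Longrightarrow> t \<le> b \<Longrightarrow> fin (\<rho> s) (\<rho> t)"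
      and add: "\<And>r s t. a \<le> r \<Longrightarrow> r \<le> s \<Longrightarrow> s \<le> t \<Longrightarrow> t \<le> b \<Longrightarrow>
          T (\<rho> r) (\<rho> s) + T (\<rho> s) (\<rho> t) = T (\<rho> r) (\<rho> t)"
      and phi: "continuous_on {a..b} (\<lambda>s. T ?x (\<rho> s))"
      and rcont: "continuous_map (top_of_set {a..b}) (ltop X) \<rho>"
      by (rule geodesic_segmentE[OF G xy(2) pts pts]) (rule that)
    define \<phi> where "\<phi> s = T ?x (\<rho> s) - n" for s
    have phic: "continuous_on {a..b} \<phi>" unfolding \<phi>_def using phi by (intro continuous_intros)
    have range: "\<phi> s \<in> {-n..n}" if "s \<in> {a..b}" for s
    proof -
      have "T ?x (\<rho> s) + T (\<rho> s) ?y = 2 * n" using add[of a s b] that r xy by simp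
      then show ?thesis unfolding \<phi>_def atLeastAtMost_iff
        using T_nonneg[of ?x "\<rho> s"] T_nonneg[of "\<rho> s" ?y] by linarith
    qed
    have "T ?x ?x = 0" using T[of "-n" "-n"] by simp
    then have ab: "\<phi> a = - n" "\<phi> b = n" using r xy by (auto simp: \<phi>_def)
    have surj: "\<phi> ` {a..b} = {-n..n}"
    proof
      show "{-n..n} \<subseteq> \<phi> ` {a..b}"
        using IVT'[of \<phi> a _ b] ab r(1) phic by fastforce
    qed (use range in auto)
    have eq: "\<mu> (\<phi> s) = \<rho> s" if s: "s \<in> {a..b}" for s
    proof -
      define l where "l = (\<phi> s + n) / (2 * n)"
      have l: "l * (2 * n) = \<phi> s + n" "0 \<le> l" "l \<le> 1"
        using n range[OF s] by (auto simp: l_def)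
      have 1: "divides ?x ?y l (\<rho> s)" unfolding divides_def
        using l G r(5) s add[of a s b] r xy by (auto simp: \<phi>_def algebra_simps)
      have 2: "divides ?x ?y l (\<mu> (\<phi> s))"
      proof (cases "-n < \<phi> s \<and> \<phi> s < n")
        case True
        then have "0 < l" "l < 1" using n by (auto simp: l_def)
        then show ?thesis
          by (intro divides_of_T) (use pts True ch[of "-n" "\<phi> s"] ch[of "\<phi> s" n] xy l T[of "-n"
            "\<phi> s"] T[of "\<phi> s" n] in \<open>auto simp: algebra_simps\<close>)
      next
        case False
        then consider "\<phi> s = - n" "l = 0" | "\<phi> s = n" "l = 1"
            using range[OF s] n by (auto simp: l_def)
        then show ?thesis using divides_ends[OF xy(1,2) pts pts] by cases auto
      qed
      show ?thesis using divides_unique[OF 2 1 xy(1,2) pts pts] .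
    qed
    have "quotient_map (top_of_set {a..b}) (top_of_set {-n..n}) \<phi>"
      by (rule continuous_imp_quotient_map)
        (use phic surj in \<open>auto simp: compact_space_subtopology Hausdorff_space_subtopology\<close>)
    moreover have "continuous_map (top_of_set {a..b}) (ltop X) (\<mu> \<circ> \<phi>)"
      by (rule continuous_map_eq[OF rcont]) (use eq in auto)
    ultimately show ?thesis by (rule continuous_compose_quotient_map)
  qed
  have "continuous_map euclidean (ltop X) \<mu>"
  proof (rule pasting_lemma[where I = "{0<..}" and T = "\<lambda>n. {-n<..<n}" and f = "\<lambda>_. \<mu>"])
    fix n :: real assume "n \<in> {0<..}"
    then show "continuous_map (top_of_set {-n<..<n}) (ltop X) \<mu>"
      by (intro continuous_map_from_subtopology_mono[OF cont[of n]]) auto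
  next
    fix x :: real
    show "\<exists>n. n \<in> {0<..} \<and> x \<in> {-n<..<n} \<and> \<mu> x = \<mu> x"
      by (rule exI[of _ "\<bar>x\<bar> + 1"]) auto
  qed auto
  then have "causal_curve X UNIV \<mu>" unfolding causal_curve_def using caus by auto
  then have "geodesic X UNIV \<mu>" by (rule geodesicI) (use f T in auto)
  then show ?thesis unfolding complete_timelike_line_def using f T by (auto simp: tsep_eq_T)
qed

end

section \<open>The CAT(0) condition from the CN inequality\<close>

lemma euclidean_CN:
  fixes u v w :: "'e::real_inner"
  shows "(dist w ((1 - l) *\<^sub>R u + l *\<^sub>R v))\<^sup>2 =
    (1 - l) * (dist w u)\<^sup>2 + l * (dist w v)\<^sup>2 - l * (1 - l) * (dist u v)\<^sup>2"
proof -
  define a b where "a = w - u" and "b = w - v"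
  have 1: "w - ((1 - l) *\<^sub>R u + l *\<^sub>R v) = (1 - l) *\<^sub>R a + l *\<^sub>R b" "u - v = b - a" "w - u = a"
      "w - v = b"
    by (auto simp: a_def b_def algebra_simps)
  show ?thesis unfolding dist_norm 1 power2_norm_eq_inner
    by (simp add: inner_diff inner_add inner_commute algebra_simps power2_eq_square)
qed

text \<open>Applying the CN inequality first with vertex \<open>p\<close> and then with the end points of the side of
  \<open>q\<close> as vertices bounds \<open>d p q\<close> by an expression in the distances of vertices, which in the
  Euclidean plane is the distance of the comparison points.\<close>

lemma CAT0_of_CN:
  assumes M: "Metric_space S d"
    and seg: "\<And>x y. x \<in> S \<Longrightarrow> y \<in> S \<Longrightarrow> \<exists>G. metric_segment S d x y G"
    and CN: "\<And>x y z p l. x \<in> S \<Longrightarrow> y \<in> S \<Longrightarrow> z \<in> S \<Longrightarrow> p \<in> S \<Longrightarrow> 0 \<le> l \<Longrightarrow> l \<le> 1 \<Longrightarrow>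
      d y p = l * d y z \<Longrightarrow> d p z = (1 - l) * d y z \<Longrightarrow>
      (d x p)\<^sup>2 \<le> (1 - l) * (d x y)\<^sup>2 + l * (d x z)\<^sup>2 - l * (1 - l) * (d y z)\<^sup>2"
  shows "CAT0_space S d"
proof -
  have sym: "d x y = d y x" for x y by (rule Metric_space.commute[OF M])
  have nn: "0 \<le> d x y" for x y by (rule Metric_space.nonneg[OF M])
  have key: "d p q \<le> dist p' q'"
    if V: "x \<in> S" "y \<in> S" "u \<in> S" "v \<in> S" and GH: "G \<subseteq> S" "H \<subseteq> S"
      and d: "dist x' y' = d x y" "dist u' v' = d u v" "dist x' u' = d x u" "dist x' v' = d x v"
        "dist y' u' = d y u" "dist y' v' = d y v"
      and p: "(p, p') \<in> euclidean_comparison_points d x y G x' y'"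
      and q: "(q, q') \<in> euclidean_comparison_points d u v H u' v'"
    for x y u v G H p q and x' y' u' v' p' q' :: "real ^ 2"
  proof -
    have pS: "p \<in> S" "q \<in> S" using p q GH unfolding euclidean_comparison_points_def by auto
    obtain l where l: "0 \<le> l" "l \<le> 1" "p' = (1 - l) *\<^sub>R x' + l *\<^sub>R y'"
      and dp: "dist x' p' = d x p" "dist p' y' = d p y"
      using p unfolding euclidean_comparison_points_def closed_segment_def by auto
    obtain m where m: "0 \<le> m" "m \<le> 1" "q' = (1 - m) *\<^sub>R u' + m *\<^sub>R v'"
      and dq: "dist u' q' = d u q" "dist q' v' = d q v"
      using q unfolding euclidean_comparison_points_def closed_segment_def by auto
    have ratio: "dist a ((1 - l) *\<^sub>R a + l *\<^sub>R b) = l * dist a b"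
        "dist ((1 - l) *\<^sub>R a + l *\<^sub>R b) b = (1 - l) * dist a b"
      if "0 \<le> l" "l \<le> 1" for a b :: "real ^ 2" and l
    proof -
      have "a - ((1 - l) *\<^sub>R a + l *\<^sub>R b) = l *\<^sub>R (a - b)"
          "((1 - l) *\<^sub>R a + l *\<^sub>R b) - b = (1 - l) *\<^sub>R (a - b)"
        by (auto simp: algebra_simps)
      then show "dist a ((1 - l) *\<^sub>R a + l *\<^sub>R b) = l * dist a b"
          "dist ((1 - l) *\<^sub>R a + l *\<^sub>R b) b = (1 - l) * dist a b"
        unfolding dist_norm using that by auto
    qed
    have rp: "d x p = l * d x y" "d p y = (1 - l) * d x y"
        using ratio[OF l(1,2), of x' y'] dp l(3) d by auto
    have rq: "d u q = m * d u v" "d q v = (1 - m) * d u v"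
        using ratio[OF m(1,2), of u' v'] dq m(3) d by auto
    have cn: "(d w p)\<^sup>2 \<le> (dist w' p')\<^sup>2" if "w \<in> S" "dist x' w' = d x w" "dist y' w' = d y w"
        for w w'
    proof -
      have "(dist w' p')\<^sup>2 = (1 - l) * (d w x)\<^sup>2 + l * (d w y)\<^sup>2 - l * (1 - l) * (d x y)\<^sup>2"
        unfolding l(3) euclidean_CN using that(2,3) d(1)
        by (simp add: dist_commute[of w'] sym[of w])
      then show ?thesis using CN[OF that(1) V(1,2) pS(1) l(1,2) rp] by simp
    qed
    have pu: "(d p u)\<^sup>2 \<le> (dist p' u')\<^sup>2" "(d p v)\<^sup>2 \<le> (dist p' v')\<^sup>2"
      using cn[OF V(3) d(3,5)] cn[OF V(4) d(4,6)] by (simp_all add: dist_commute[of p'] sym[of p])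
    have "(d p q)\<^sup>2 \<le> (1 - m) * (d p u)\<^sup>2 + m * (d p v)\<^sup>2 - m * (1 - m) * (d u v)\<^sup>2"
      by (rule CN[OF pS(1) V(3,4) pS(2) m(1,2) rq])
    also have "\<dots> \<le> (1 - m) * (dist p' u')\<^sup>2 + m * (dist p' v')\<^sup>2 - m * (1 - m) * (dist u' v')\<^sup>2"
      unfolding d(2) using pu m(1,2) by (intro diff_mono add_mono mult_left_mono) auto
    also have "\<dots> = (dist p' q')\<^sup>2" unfolding m(3) by (rule euclidean_CN[symmetric])
    finally show ?thesis by (rule power2_le_imp_le) simp
  qed
  have comparison: "let T = euclidean_comparison_points d x y A x' y' \<union>
      euclidean_comparison_points d y z B y' z' \<union>
        euclidean_comparison_points d x z C x' z' in \<forall>(p, p')\<in>T. \<forall>(q, q')\<in>T. d p q \<le> dist p' q'"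
    if S: "x \<in> S" "y \<in> S" "z \<in> S"
        and G: "metric_segment S d x y A" "metric_segment S d y z B" "metric_segment S d x z C"
      and d: "dist x' y' = d x y" "dist y' z' = d y z" "dist x' z' = d x z"
    for x y z A B C and x' y' z' :: "real ^ 2"
  proof -
    have "G \<subseteq> S" if "metric_segment S d x y G" for x y G
      using that unfolding metric_segment_def by blast
    note sub = G[THEN this]
    have d': "dist y' x' = d y x" "dist z' y' = d z y" "dist z' x' = d z x"
      using d by (simp_all only: dist_commute[of y' x'] dist_commute[of z' y']
          dist_commute[of z' x'] sym[of y x] sym[of z y] sym[of z x])
    have zero: "dist x' x' = d x x" "dist y' y' = d y y" "dist z' z' = d z z"
      using Metric_space.zero[OF M S(1,1)] Metric_space.zero[OF M S(2,2)]
          Metric_space.zero[OF M S(3,3)] by simp_all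
    let ?A = "euclidean_comparison_points d x y A x' y'" and ?B = "euclidean_comparison_points d y
        z B y' z'"
      and ?C = "euclidean_comparison_points d x z C x' z'"
    have "d p q \<le> dist p' q'" if p: "(p, p') \<in> ?A \<union> ?B \<union> ?C"
        and q: "(q, q') \<in> ?A \<union> ?B \<union> ?C" for p p' q q'
      using p
    proof (elim UnE)
      assume p: "(p, p') \<in> ?A"
      note k = key[OF S(1,2) _ _ sub(1) _ d(1) _ _ _ _ _ p]
      show ?thesis using q
      proof (elim UnE)
        assume q: "(q, q') \<in> ?A"
        show ?thesis by (rule k[OF S(1,2) sub(1) d(1) zero(1) d(1) d'(1) zero(2) q])
      next
        assume q: "(q, q') \<in> ?B"
        show ?thesis by (rule k[OF S(2,3) sub(2) d(2) d(1,3) zero(2) d(2) q])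
      next
        assume q: "(q, q') \<in> ?C"
        show ?thesis by (rule k[OF S(1,3) sub(3) d(3) zero(1) d(3) d'(1) d(2) q])
      qed
    next
      assume p: "(p, p') \<in> ?B"
      note k = key[OF S(2,3) _ _ sub(2) _ d(2) _ _ _ _ _ p]
      show ?thesis using q
      proof (elim UnE)
        assume q: "(q, q') \<in> ?A"
        show ?thesis by (rule k[OF S(1,2) sub(1) d(1) d'(1) zero(2) d'(3,2) q])
      next
        assume q: "(q, q') \<in> ?B"
        show ?thesis by (rule k[OF S(2,3) sub(2) d(2) zero(2) d(2) d'(2) zero(3) q])
      next
        assume q: "(q, q') \<in> ?C"
        show ?thesis by (rule k[OF S(1,3) sub(3) d(3) d'(1) d(2) d'(3) zero(3) q])
      qed
    next
      assume p: "(p, p') \<in> ?C"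
      note k = key[OF S(1,3) _ _ sub(3) _ d(3) _ _ _ _ _ p]
      show ?thesis using q
      proof (elim UnE)
        assume q: "(q, q') \<in> ?A"
        show ?thesis by (rule k[OF S(1,2) sub(1) d(1) zero(1) d(1) d'(3,2) q])
      next
        assume q: "(q, q') \<in> ?B"
        show ?thesis by (rule k[OF S(2,3) sub(2) d(2) d(1,3) d'(2) zero(3) q])
      next
        assume q: "(q, q') \<in> ?C"
        show ?thesis by (rule k[OF S(1,3) sub(3) d(3) zero(1) d(3) d'(3) zero(3) q])
      qed
    qed
    then show ?thesis unfolding Let_def Ball_def split_paired_All prod.case by blast
  qed
  have "\<forall>x\<in>S. \<forall>y\<in>S. \<forall>z\<in>S. \<forall>A B C x' y' z'.
        metric_segment S d x y A \<longrightarrow> metric_segment S d y z B \<longrightarrow> metric_segment S d x z C \<longrightarrow>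
        dist x' y' = d x y \<longrightarrow> dist y' z' = d y z \<longrightarrow> dist x' z' = d x z \<longrightarrow>
        (let T = euclidean_comparison_points d x y A x' y' \<union> euclidean_comparison_points d y z B
            y' z' \<union>
                 euclidean_comparison_points d x z C x' z'
         in \<forall>(p, p')\<in>T. \<forall>(q, q')\<in>T. d p q \<le> dist p' q')"
    by (intro ballI allI impI) (rule comparison)
  moreover have "\<forall>x\<in>S. \<forall>y\<in>S. \<exists>G. metric_segment S d x y G" using seg by blast
  ultimately show ?thesis unfolding CAT0_space_def using M by (intro conjI)
qed

context upper_curvature_zero
begin

section \<open>Lines through the geodesics between two lines\<close>

text \<open>The points \<open>\<alpha>(s)\<close>, \<open>\<alpha>(a)\<close>, \<open>\<beta>(a + r)\<close> have the separations of the points with the same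
  parameters on two vertical lines of the Minkowski plane, where the comparison point of \<open>p\<close> has
  time coordinate \<open>a + l r\<close> and distance \<open>l c\<close> from the first line.\<close>

lemma strip_lower_bounds:
  assumes f: "flat_pair c \<alpha> \<beta>" and r: "c < r" and d: "divides (\<alpha> a) (\<beta> (a + r)) l p" "0 \<le> l" "l \<le> 1"
  shows "s < a \<Longrightarrow> sqrt ((a + l * r - s)\<^sup>2 - (l * c)\<^sup>2) \<le> T (\<alpha> s) p"
    and "a + r + c < s \<Longrightarrow> sqrt ((s - (a + l * r))\<^sup>2 - (l * c)\<^sup>2) \<le> T p (\<alpha> s)"
proof -
  note F = flat_pairD[OF f] and lines = flat_pair_line[OF f]
  have pts: "\<alpha> s \<in> pts X" "\<alpha> a \<in> pts X" "\<beta> (a + r) \<in> pts X" using lines line_pts by auto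
  have c: "0 \<le> c" by (rule F)
  have sq: "(sqrt (u\<^sup>2 - c\<^sup>2))\<^sup>2 = u\<^sup>2 - c\<^sup>2" if "c \<le> u" for u
    using power_mono[OF that c, of 2] by simp
  have ch: "chron X (\<alpha> a) (\<beta> (a + r))" using flat_pair_chron[OF f, of "a + r" a] r by simp
  have Tr: "T (\<alpha> a) (\<beta> (a + r)) = sqrt (r\<^sup>2 - c\<^sup>2)" using F(5)[of a "a + r"] r by simp
  show "sqrt ((a + l * r - s)\<^sup>2 - (l * c)\<^sup>2) \<le> T (\<alpha> s) p" if "s < a"
  proof (rule real_le_lsqrt)
    have ch1: "chron X (\<alpha> s) (\<alpha> a)" and T1: "T (\<alpha> s) (\<alpha> a) = a - s"
      using line_chron[OF lines(1)] line_T[OF lines(1)] that by auto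
    have ch2: "chron X (\<alpha> s) (\<beta> (a + r))" using flat_pair_chron[OF f, of "a + r" s] r that by simp
    have T2: "T (\<alpha> s) (\<beta> (a + r)) = sqrt ((a + r - s)\<^sup>2 - c\<^sup>2)"
        using F(5)[of s "a + r"] r that by simp
    have "T (\<alpha> a) (\<beta> (a + r)) \<le> T (\<alpha> s) (\<beta> (a + r))"
      unfolding Tr T2 using c r that by (intro real_sqrt_le_mono diff_right_mono power_mono) auto
    then have "(1 - l) * T (\<alpha> a) (\<beta> (a + r)) \<le> 1 * T (\<alpha> s) (\<beta> (a + r))"
      using d by (intro mult_mono) auto
    moreover have "divides (\<alpha> s) (\<beta> (a + r)) (1 - 1) (\<alpha> s)"
        "divides (\<alpha> a) (\<beta> (a + r)) (1 - (1 - l)) p"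
      using divides_ends[OF ch2 parallel_fin[OF F(1)] pts(1,3)] d by auto
    ultimately have "1\<^sup>2 * (T (\<alpha> s) (\<beta> (a + r)))\<^sup>2 + (1 - l)\<^sup>2 * (T (\<alpha> a) (\<beta> (a + r)))\<^sup>2 -
       (1 - l) * 1 * ((T (\<alpha> a) (\<beta> (a + r)))\<^sup>2 + (T (\<alpha> s) (\<beta> (a + r)))\<^sup>2 - (T (\<alpha> s) (\<alpha> a))\<^sup>2) \<le> (T
           (\<alpha> s) p)\<^sup>2"
      by (intro comparison_at_future_vertex[OF pts ch1 ch parallel_fin[OF F(1)]])
    then have "((a + r - s)\<^sup>2 - c\<^sup>2) + (1 - l)\<^sup>2 * (r\<^sup>2 - c\<^sup>2) - (1 - l) * ((r\<^sup>2 - c\<^sup>2) + ((a + r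
        - s)\<^sup>2 - c\<^sup>2) - (a - s)\<^sup>2)
       \<le> (T (\<alpha> s) p)\<^sup>2" unfolding T1 T2 Tr using sq[of r] sq[of "a + r - s"] r that by simp
    moreover have "((a + r - s)\<^sup>2 - c\<^sup>2) + (1 - l)\<^sup>2 * (r\<^sup>2 - c\<^sup>2) - (1 - l) * ((r\<^sup>2 - c\<^sup>2) + ((a
        + r - s)\<^sup>2 - c\<^sup>2) - (a - s)\<^sup>2)
      = (a + l * r - s)\<^sup>2 - (l * c)\<^sup>2" by (simp add: power2_eq_square algebra_simps)
    ultimately show "(a + l * r - s)\<^sup>2 - (l * c)\<^sup>2 \<le> (T (\<alpha> s) p)\<^sup>2" by simp
  qed simp
  show "sqrt ((s - (a + l * r))\<^sup>2 - (l * c)\<^sup>2) \<le> T p (\<alpha> s)" if "a + r + c < s"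
  proof (rule real_le_lsqrt)
    have ch1: "chron X (\<alpha> a) (\<alpha> s)" and T1: "T (\<alpha> a) (\<alpha> s) = s - a"
      using line_chron[OF lines(1)] line_T[OF lines(1)] that r c by auto
    have ch2: "chron X (\<beta> (a + r)) (\<alpha> s)"
        using flat_pair_chron[OF flat_pair_sym[OF f], of s "a + r"] that by simp
    have T2: "T (\<beta> (a + r)) (\<alpha> s) = sqrt ((s - (a + r))\<^sup>2 - c\<^sup>2)"
        using F(6)[of "a + r" s] that by simp
    have "sqrt (r\<^sup>2 - c\<^sup>2) \<le> r" using r c by (intro real_le_lsqrt) auto
    then have "T (\<alpha> a) (\<beta> (a + r)) \<le> T (\<alpha> a) (\<alpha> s)" unfolding Tr T1 using that c by simp
    then have "l * T (\<alpha> a) (\<beta> (a + r)) \<le> 1 * T (\<alpha> a) (\<alpha> s)"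
      using d by (intro mult_mono) auto
    then have "1\<^sup>2 * (T (\<alpha> a) (\<alpha> s))\<^sup>2 + l\<^sup>2 * (T (\<alpha> a) (\<beta> (a + r)))\<^sup>2 -
       l * 1 * ((T (\<alpha> a) (\<beta> (a + r)))\<^sup>2 + (T (\<alpha> a) (\<alpha> s))\<^sup>2 - (T (\<beta> (a + r)) (\<alpha> s))\<^sup>2) \<le> (T p (\<alpha>
           s))\<^sup>2"
      by (intro comparison_at_past_vertex[OF pts(2,3,1) ch ch2 line_fin[OF lines(1)]] d
        divides_ends[OF ch1 line_fin[OF lines(1)] pts(2,1)])
    then have "(s - a)\<^sup>2 + l\<^sup>2 * (r\<^sup>2 - c\<^sup>2) - l * ((r\<^sup>2 - c\<^sup>2) + (s - a)\<^sup>2 - ((s - (a + r))\<^sup>2 -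
        c\<^sup>2))
       \<le> (T p (\<alpha> s))\<^sup>2" unfolding T1 T2 Tr using sq[of r] sq[of "s - (a + r)"] r that by simp
    moreover have "(s - a)\<^sup>2 + l\<^sup>2 * (r\<^sup>2 - c\<^sup>2) - l * ((r\<^sup>2 - c\<^sup>2) + (s - a)\<^sup>2 - ((s - (a + r))\<^sup>2
        - c\<^sup>2))
      = (s - (a + l * r))\<^sup>2 - (l * c)\<^sup>2" by (simp add: power2_eq_square algebra_simps)
    ultimately show "(s - (a + l * r))\<^sup>2 - (l * c)\<^sup>2 \<le> (T p (\<alpha> s))\<^sup>2" by simp
  qed simp
qed

text \<open>Concavity bounds the separations along \<open>\<mu>\<close> from below. The bound from above comes from
  squeezing \<open>\<mu>\<close> between remote points of \<open>\<alpha>\<close>: by the previous lemma the chain from \<open>\<alpha>(-N)\<close> to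
  \<open>\<alpha>(N)\<close> through \<open>\<mu>\<close> loses nothing in the limit.\<close>

lemma strip_line:
  assumes f: "flat_pair c \<alpha> \<beta>" and r: "c < r" and l: "0 < l" "l < 1"
    and d: "\<And>a. divides (\<alpha> a) (\<beta> (a + r)) l (\<mu> (a + l * r))"
  obtains k where "flat_pair k \<alpha> \<mu>"
proof -
  note F = flat_pairD[OF f] and lines = flat_pair_line[OF f]
  have l': "0 \<le> l" "l \<le> 1" using l by auto
  have c: "0 \<le> c" by (rule F)
  have d': "divides (\<alpha> (t - l * r)) (\<beta> (t - l * r + r)) l (\<mu> t)" for t
      using d[of "t - l * r"] by simp
  note D = dividesD[OF d' parallel_fin[OF F(1)] line_pts[OF lines(1)] line_pts[OF lines(2)]]
  have pts: "\<mu> t \<in> pts X" for t by (rule D)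
  have lr: "0 \<le> l * r" "l * r \<le> r" using l r c by (auto simp: mult_le_cancel_right1)
  have past: "caus X (\<alpha> s) (\<mu> t)" if "s \<le> t - l * r" for s t
    using caus_trans[OF _ D(2)] line_caus[OF lines(1)] lines line_pts pts that by blast
  have future: "caus X (\<mu> t) (\<alpha> s)" if "t - l * r + r + c \<le> s" for s t
  proof -
    have "caus X (\<beta> (t - l * r + r)) (\<alpha> s)" using F(4) that by simp
    then show ?thesis using caus_trans[OF D(3)] lines line_pts pts by blast
  qed
  have fin: "fin (\<mu> s) (\<mu> t)" for s t
    using fin_between[OF line_fin[OF lines(1)] past[OF order_refl] future[OF order_refl]]
        lines line_pts pts by blast
  have lower: "t - s \<le> T (\<mu> s) (\<mu> t)" if st: "s < t" for s t
  proof -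
    have "(1 - l) * T (\<alpha> (s - l * r)) (\<alpha> (t - l * r)) + l * T (\<beta> (s - l * r + r)) (\<beta> (t - l * r +
        r)) \<le> T (\<mu> s) (\<mu> t)"
      by (rule separation_concave(3)[OF _ _ _ _ _ _ _ _ _ d' d' l])
        (use st r lines line_pts line_chron parallel_fin[OF F(1)] flat_pair_chron[OF f] in auto)
    then show ?thesis using line_T[OF lines(1)] line_T[OF lines(2)] st by (simp add: algebra_simps)
  qed
  have caus: "caus X (\<mu> s) (\<mu> t)" if "s < t" for s t
    using lower[OF that] T_pos_imp_caus pts that by force
  have upper: "T (\<mu> s) (\<mu> t) \<le> t - s" if st: "s < t" for s t
  proof (rule field_le_epsilon)
    fix e :: real assume e: "0 < e"
    define u where "u = max (r + c + 1) (((l * c)\<^sup>2 + (e/2)\<^sup>2) / (2 * (e/2)))"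
    have u: "r + c < u" "((l * c)\<^sup>2 + (e/2)\<^sup>2) / (2 * (e/2)) \<le> u" by (auto simp: u_def)
    have "u - e / 2 \<le> sqrt (u\<^sup>2 - (l * c)\<^sup>2)" using e u by (intro sqrt_asymptotic) auto
    moreover have "sqrt (u\<^sup>2 - (l * c)\<^sup>2) \<le> T (\<alpha> (s - u)) (\<mu> s)"
      using strip_lower_bounds(1)[OF f r d' l', of "s - u" s] u lr c by simp
    moreover have "sqrt (u\<^sup>2 - (l * c)\<^sup>2) \<le> T (\<mu> t) (\<alpha> (t + u))"
      using strip_lower_bounds(2)[OF f r d' l', of t "t + u"] u lr c by simp
    moreover have "T (\<alpha> (s - u)) (\<mu> s) + T (\<mu> s) (\<mu> t) + T (\<mu> t) (\<alpha> (t + u)) \<le> T (\<alpha> (s - u)) (\<alpha> (t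
        + u))"
    proof -
      have c1: "caus X (\<alpha> (s - u)) (\<mu> s)" "caus X (\<mu> t) (\<alpha> (t + u))"
          using past future u lr c by auto
      have c2: "caus X (\<alpha> (s - u)) (\<mu> t)"
          using caus_trans[OF c1(1) caus[OF st]] lines line_pts pts by blast
      have p: "\<alpha> (s - u) \<in> pts X" "\<alpha> (t + u) \<in> pts X" using lines line_pts by auto
      note t1 = T_triangle[OF c2 c1(2) line_fin[OF lines(1)] p(1) pts p(2)]
      show ?thesis using t1(3) T_triangle(3)[OF c1(1) caus[OF st] t1(1) p(1) pts pts] by simp
    qed
    moreover have "T (\<alpha> (s - u)) (\<alpha> (t + u)) = t + u - (s - u)"
        using line_T[OF lines(1)] u st r c by simp
    ultimately show "T (\<mu> s) (\<mu> t) \<le> t - s + e" by simp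
  qed
  have mline: "complete_timelike_line X \<mu>"
  proof (rule complete_timelike_lineI[OF pts fin])
    fix s t :: real assume st: "s \<le> t"
    have "T (\<mu> s) (\<mu> s) = 0" using fin_diag[OF fin caus pts pts, of s "s + 1"] by simp
    then show "T (\<mu> s) (\<mu> t) = t - s" using lower[of s t] upper[of s t] st by (cases "s = t") auto
  qed
  have "weakly_parallel X \<alpha> \<mu>" unfolding weakly_parallel_def
    by (intro exI[of _ "l * r"] conjI exI[of _ "r - l * r + c"]) (use past future lr c in auto)
  then have par: "parallel \<alpha> \<mu>" using mline lines parallel_def by blast
  have asym: "\<exists>u. r + c < u \<and> l * c < u \<and> u - e \<le> sqrt (u\<^sup>2 - (l * c)\<^sup>2)" if "0 < e" for e
    using sqrt_asymptotic[OF that, of "l * c"]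
    by (intro exI[of _ "max (max (r + c + 1) (l * c + 1)) (((l * c)\<^sup>2 + e\<^sup>2) / (2 * e))"]) (simp
      add: less_max_iff_disj)
  obtain k where "flat_pair k \<alpha> \<mu>"
  proof (rule flat_pair_of_asymptotics[OF par])
    fix e :: real assume "0 < e"
    then obtain u where u: "r + c < u" "l * c < u" "u - e \<le> sqrt (u\<^sup>2 - (l * c)\<^sup>2)"
        using asym by blast
    have "(l * c)\<^sup>2 < u\<^sup>2" using u c l by (intro power_strict_mono) auto
    then have pos: "0 < sqrt (u\<^sup>2 - (l * c)\<^sup>2)" by simp
    have "sqrt (u\<^sup>2 - (l * c)\<^sup>2) \<le> T (\<alpha> 0) (\<mu> u)"
      using strip_lower_bounds(1)[OF f r d' l', of 0 u] u lr c by simp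
    then show "\<exists>t. 0 < T (\<alpha> 0) (\<mu> t) \<and> t - e \<le> T (\<alpha> 0) (\<mu> t)"
      using pos u(3) by (intro exI[of _ u] conjI) linarith+
    have "sqrt (u\<^sup>2 - (l * c)\<^sup>2) \<le> T (\<mu> 0) (\<alpha> u)"
      using strip_lower_bounds(2)[OF f r d' l', of 0 u] u lr c by simp
    then show "\<exists>t. 0 < T (\<mu> 0) (\<alpha> t) \<and> t - e \<le> T (\<mu> 0) (\<alpha> t)"
      using pos u(3) by (intro exI[of _ u] conjI) linarith+
  qed (rule that)
  then show thesis by (rule that)
qed

text \<open>The leaves pairwise form flat pairs by transitivity through \<open>\<alpha>\<close>. Their distance is read off
  from two points of one geodesic from \<open>\<alpha>\<close> to \<open>\<beta>\<close>, for which both the separation and the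
  difference of the parameters are known.\<close>

lemma strip_foliation:
  assumes f: "flat_pair c \<alpha> \<beta>"
  obtains \<mu> where "\<mu> 0 = \<alpha>" "\<mu> 1 = \<beta>"
    "\<And>k l. 0 \<le> k \<Longrightarrow> k \<le> l \<Longrightarrow> l \<le> 1 \<Longrightarrow> flat_pair ((l - k) * c) (\<mu> k) (\<mu> l)"
proof -
  note F = flat_pairD[OF f] and lines = flat_pair_line[OF f]
  have c: "0 \<le> c" by (rule F)
  define r where "r = c + 1"
  have r: "c < r" by (simp add: r_def)
  have ch: "chron X (\<alpha> a) (\<beta> (a + r))" for a using flat_pair_chron[OF f] r by simp
  have Tr: "T (\<alpha> a) (\<beta> (a + r)) = sqrt (r\<^sup>2 - c\<^sup>2)" for a using F(5)[of a "a + r"] r by simp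
  have "c\<^sup>2 < r\<^sup>2" using r c by (intro power_strict_mono) auto
  have "\<exists>P. (\<forall>l\<in>{0..1}. divides (\<alpha> a) (\<beta> (a + r)) l (P l)) \<and> P 0 = \<alpha> a \<and> P 1 = \<beta> (a + r) \<and>
    (\<forall>k l. 0 \<le> k \<longrightarrow> k \<le> l \<longrightarrow> l \<le> 1 \<longrightarrow> T (P k) (P l) = (l - k) * sqrt (r\<^sup>2 - c\<^sup>2))" for a
  proof -
    obtain P where "\<And>l. l \<in> {0..1} \<Longrightarrow> divides (\<alpha> a) (\<beta> (a + r)) l (P l)" "P 0 = \<alpha> a"
        "P 1 = \<beta> (a + r)"
      "\<And>k l. 0 \<le> k \<Longrightarrow> k \<le> l \<Longrightarrow> l \<le> 1 \<Longrightarrow> T (P k) (P l) = (l - k) * T (\<alpha> a) (\<beta> (a + r))"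
      by (rule affine_parametrisation[OF ch parallel_fin[OF F(1)] line_pts[OF lines(1)]
        line_pts[OF lines(2)]]) (rule that)
    then show ?thesis unfolding Tr by blast
  qed
  then obtain P where P: "\<And>a l. l \<in> {0..1} \<Longrightarrow> divides (\<alpha> a) (\<beta> (a + r)) l (P a l)"
    "\<And>a. P a 0 = \<alpha> a" "\<And>a. P a 1 = \<beta> (a + r)"
    "\<And>a k l. 0 \<le> k \<Longrightarrow> k \<le> l \<Longrightarrow> l \<le> 1 \<Longrightarrow> T (P a k) (P a l) = (l - k) * sqrt (r\<^sup>2 - c\<^sup>2)"
    by metis
  define \<mu> where "\<mu> l t = P (t - l * r) l" for l t
  have m0: "\<mu> 0 = \<alpha>" and m1: "\<mu> 1 = \<beta>" using P by (auto simp: \<mu>_def)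
  have flat: "\<exists>k. flat_pair k \<alpha> (\<mu> l)" if "0 \<le> l" "l \<le> 1" for l
  proof -
    consider "l = 0" | "l = 1" | "0 < l" "l < 1" using \<open>0 \<le> l\<close> \<open>l \<le> 1\<close> by linarith
    then show ?thesis
    proof cases
      case 1 then show ?thesis using m0 flat_pair_refl[OF lines(1)] by auto
    next
      case 2 then show ?thesis using m1 f by auto
    next
      case 3
      have "divides (\<alpha> a) (\<beta> (a + r)) l (\<mu> l (a + l * r))" for a
        using P(1)[of l a] 3 by (simp add: \<mu>_def)
      then show ?thesis using strip_line[OF f r 3] by blast
    qed
  qed
  have "flat_pair ((l - k) * c) (\<mu> k) (\<mu> l)" if kl: "0 \<le> k" "k \<le> l" "l \<le> 1" for k l
  proof -
    obtain i j where ij: "flat_pair i \<alpha> (\<mu> k)" "flat_pair j \<alpha> (\<mu> l)" using flat kl by fastforce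
    obtain e where e: "flat_pair e (\<mu> k) (\<mu> l)"
      by (rule flat_pair_trans[OF flat_pair_sym[OF ij(1)] ij(2)]) (rule that)
    show ?thesis
    proof (cases "k = l")
      case True
      then show ?thesis using flat_pair_refl[OF flat_pair_line(2)[OF ij(2)]] by simp
    next
      case False
      have "0 < (l - k) * sqrt (r\<^sup>2 - c\<^sup>2)" using kl False \<open>c\<^sup>2 < r\<^sup>2\<close> by simp
      moreover have "T (\<mu> k (k * r)) (\<mu> l (l * r)) = (l - k) * sqrt (r\<^sup>2 - c\<^sup>2)"
        using P(4)[OF kl, of 0] by (simp add: \<mu>_def)
      ultimately have "sqrt ((l * r - k * r)\<^sup>2 - e\<^sup>2) = (l - k) * sqrt (r\<^sup>2 - c\<^sup>2)"
        using flat_pairD(5)[OF e, of "k * r" "l * r"] by (auto split: if_splits)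
      also have "\<dots> = sqrt ((l - k)\<^sup>2 * (r\<^sup>2 - c\<^sup>2))" using kl by (simp add: real_sqrt_mult)
      finally have "(l * r - k * r)\<^sup>2 - e\<^sup>2 = (l - k)\<^sup>2 * (r\<^sup>2 - c\<^sup>2)" by simp
      then have "e\<^sup>2 = ((l - k) * c)\<^sup>2" by (simp add: power2_eq_square algebra_simps)
      then have "e = (l - k) * c" using flat_pairD(2)[OF e] c kl by (simp add: power2_eq_iff_nonneg)
      then show ?thesis using e by simp
    qed
  qed
  then show thesis using that m0 m1 by blast
qed

text \<open>Stewart's theorem in the Minkowski plane for the triangle \<open>\<eta>(0)\<close>, \<open>\<zeta>(r)\<close>, \<open>\<xi>(n)\<close>: the time
  coordinates cancel and the spatial inequality remains.\<close>

lemma flat_pair_CN: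
  assumes xy: "flat_pair a \<xi> \<eta>" and xz: "flat_pair b \<xi> \<zeta>" and yz: "flat_pair c \<eta> \<zeta>"
    and yp: "flat_pair (l * c) \<eta> \<pi>" and pz: "flat_pair ((1 - l) * c) \<pi> \<zeta>" and xp: "flat_pair e \<xi> \<pi>"
    and l: "0 \<le> l" "l \<le> 1"
  shows "e\<^sup>2 \<le> (1 - l) * a\<^sup>2 + l * b\<^sup>2 - l * (1 - l) * c\<^sup>2"
proof -
  consider "l = 0" | "l = 1" | "0 < l" "l < 1" using l by linarith
  then show ?thesis
  proof cases
    case 1
    then have "\<pi> = \<eta>" using yp flat_pair_0_eq by simp
    then show ?thesis using flat_pair_unique(1)[of e \<xi> \<eta> a 0] xy xp 1 by simp
  next
    case 2
    then have "\<zeta> = \<pi>" using pz flat_pair_0_eq by simp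
    then show ?thesis using flat_pair_unique(1)[of e \<xi> \<zeta> b 0] xz xp 2 by simp
  next
    case 3
    note nn = flat_pairD(2)[OF xy] flat_pairD(2)[OF xz] flat_pairD(2)[OF yz] flat_pairD(2)[OF xp]
    define r where "r = c + 1"
    define n where "n = r + a + b + e + 1"
    have lr: "0 \<le> l * r" "l * r \<le> r" using l nn by (auto simp: r_def mult_le_cancel_right1)
    have rn: "c < r" "r + b < n" "a < n" "e < n - l * r"
        using nn lr unfolding n_def r_def[symmetric] by (linarith | simp add: r_def)+
    have pts: "\<eta> 0 \<in> pts X" "\<pi> (l * r) \<in> pts X" "\<zeta> r \<in> pts X" "\<xi> n \<in> pts X"
      using flat_pair_line line_pts xz yp yz by blast+
    have sq: "(sqrt (u\<^sup>2 - k\<^sup>2))\<^sup>2 = u\<^sup>2 - k\<^sup>2" if "k \<le> u" "0 \<le> k" for u k :: real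
      using power_mono[OF that, of 2] by simp
    have fin: "fin (\<eta> 0) (\<zeta> r)" "fin (\<eta> 0) (\<xi> n)"
      using parallel_fin parallel_sym flat_pairD(1) xy yz by blast+
    have ch: "chron X (\<eta> 0) (\<zeta> r)" "chron X (\<zeta> r) (\<xi> n)" "chron X (\<eta> 0) (\<xi> n)"
      using flat_pair_chron[OF yz] flat_pair_chron[OF flat_pair_sym[OF xz]]
          flat_pair_chron[OF flat_pair_sym[OF xy]] rn by auto
    have Tyz: "T (\<eta> 0) (\<zeta> r) = sqrt (r\<^sup>2 - c\<^sup>2)" using flat_pairD(5)[OF yz] rn by simp
    have scale: "sqrt ((k * r)\<^sup>2 - (k * c)\<^sup>2) = k * sqrt (r\<^sup>2 - c\<^sup>2)" if "0 \<le> k" for k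
    proof -
      have "(k * r)\<^sup>2 - (k * c)\<^sup>2 = k\<^sup>2 * (r\<^sup>2 - c\<^sup>2)"
          by (simp add: power_mult_distrib algebra_simps)
      then show ?thesis using that by (simp add: real_sqrt_mult)
    qed
    have lc: "l * c < l * r" "(1 - l) * c < (1 - l) * r" using 3 rn by auto
    have rest: "r - l * r = (1 - l) * r" by (simp add: algebra_simps)
    have div: "divides (\<eta> 0) (\<zeta> r) l (\<pi> (l * r))"
    proof (rule divides_of_T[OF pts(1-3) fin(1) _ _ 3])
      show "chron X (\<eta> 0) (\<pi> (l * r))" using flat_pair_chron[OF yp] lc by simp
      show "chron X (\<pi> (l * r)) (\<zeta> r)" using flat_pair_chron[OF pz] lc rest by simp
      show "T (\<eta> 0) (\<pi> (l * r)) = l * T (\<eta> 0) (\<zeta> r)"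
        using flat_pairD(5)[OF yp, of 0 "l * r"] lc scale[OF l(1)] Tyz by simp
      show "T (\<pi> (l * r)) (\<zeta> r) = (1 - l) * T (\<eta> 0) (\<zeta> r)"
        using flat_pairD(5)[OF pz, of "l * r" r] lc scale[of "1 - l"] l Tyz unfolding rest by simp
    qed
    have Ty: "T (\<eta> 0) (\<xi> n) = sqrt (n\<^sup>2 - a\<^sup>2)" using flat_pairD(6)[OF xy] rn by simp
    have Tz: "T (\<zeta> r) (\<xi> n) = sqrt ((n - r)\<^sup>2 - b\<^sup>2)" using flat_pairD(6)[OF xz] rn by simp
    have Tp: "T (\<pi> (l * r)) (\<xi> n) = sqrt ((n - l * r)\<^sup>2 - e\<^sup>2)"
        using flat_pairD(6)[OF xp] rn by simp
    have "T (\<eta> 0) (\<zeta> r) \<le> T (\<eta> 0) (\<xi> n)"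
    proof -
      have "caus X (\<eta> 0) (\<zeta> r)" "caus X (\<zeta> r) (\<xi> n)" using chron_imp_caus ch pts by auto
      from T_triangle(3)[OF this fin(2) pts(1,3,4)] show ?thesis
        using T_nonneg[of "\<zeta> r" "\<xi> n"] by linarith
    qed
    then have "l * T (\<eta> 0) (\<zeta> r) \<le> 1 * T (\<eta> 0) (\<xi> n)" using l by (intro mult_mono) auto
    then have "1\<^sup>2 * (T (\<eta> 0) (\<xi> n))\<^sup>2 + l\<^sup>2 * (T (\<eta> 0) (\<zeta> r))\<^sup>2 -
        l * 1 * ((T (\<eta> 0) (\<zeta> r))\<^sup>2 + (T (\<eta> 0) (\<xi> n))\<^sup>2 - (T (\<zeta> r) (\<xi> n))\<^sup>2) \<le> (T (\<pi> (l * r)) (\<xi>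
            n))\<^sup>2"
      by (intro comparison_at_past_vertex[OF pts(1,3,4) ch(1,2) fin(2) div]
        divides_ends[OF ch(3) fin(2) pts(1,4)])
    then have "(n\<^sup>2 - a\<^sup>2) + l\<^sup>2 * (r\<^sup>2 - c\<^sup>2) - l * ((r\<^sup>2 - c\<^sup>2) + (n\<^sup>2 - a\<^sup>2) - ((n - r)\<^sup>2 -
        b\<^sup>2)) \<le> (n - l * r)\<^sup>2 - e\<^sup>2"
      unfolding Tyz Ty Tz Tp using sq[of a n] sq[of c r] sq[of b "n - r"] sq[of e "n - l * r"]
          nn rn by simp
    moreover have "(n\<^sup>2 - a\<^sup>2) + l\<^sup>2 * (r\<^sup>2 - c\<^sup>2) - l * ((r\<^sup>2 - c\<^sup>2) + (n\<^sup>2 - a\<^sup>2) - ((n - r)\<^sup>2 -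
        b\<^sup>2))
      = (n - l * r)\<^sup>2 - ((1 - l) * a\<^sup>2 + l * b\<^sup>2 - l * (1 - l) * c\<^sup>2)"
      by (simp add: power2_eq_square algebra_simps)
    ultimately show ?thesis by simp
  qed
qed

end

section \<open>The space of lines\<close>

locale line_splitting = upper_curvature_zero X for X :: "'a lspace" +
  fixes \<gamma> :: "real \<Rightarrow> 'a"
  assumes line_\<gamma>: "complete_timelike_line X \<gamma>"
begin

abbreviation S :: "(real \<Rightarrow> 'a) set set" where
  "S \<equiv> line_classes X \<gamma>"

abbreviation class_of :: "(real \<Rightarrow> 'a) \<Rightarrow> (real \<Rightarrow> 'a) set" where
  "class_of \<alpha> \<equiv> shift_rel X \<gamma> `` {\<alpha>}"

lemma lines_parallel_to_iff: "\<alpha> \<in> lines_parallel_to X \<gamma> \<longleftrightarrow> parallel \<alpha> \<gamma>"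
  unfolding lines_parallel_to_def parallel_def using line_\<gamma> by auto

lemma shift_rel_iff:
  "(\<alpha>, \<beta>) \<in> shift_rel X \<gamma> \<longleftrightarrow> parallel \<alpha> \<gamma> \<and> (\<exists>d. \<beta> = (\<lambda>t. \<alpha> (t + d)))"
proof -
  have "(\<forall>t. \<alpha> t = \<beta> (t + c)) \<longleftrightarrow> \<beta> = (\<lambda>t. \<alpha> (t + - c))" for c
    by (auto simp: fun_eq_iff)
  then have "(\<exists>c. \<forall>t. \<alpha> t = \<beta> (t + c)) \<longleftrightarrow> (\<exists>d. \<beta> = (\<lambda>t. \<alpha> (t + d)))"
    by (metis minus_minus)
  then show ?thesis
    unfolding shift_rel_def using lines_parallel_to_iff parallel_sym parallel_shift by auto
qed

lemma equiv_shift_rel: "equiv (lines_parallel_to X \<gamma>) (shift_rel X \<gamma>)"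
proof (rule equivI)
  show "shift_rel X \<gamma> \<subseteq> lines_parallel_to X \<gamma> \<times> lines_parallel_to X \<gamma>"
    unfolding shift_rel_def by auto
  show "refl_on (lines_parallel_to X \<gamma>) (shift_rel X \<gamma>)"
    by (auto simp: refl_on_def shift_rel_iff lines_parallel_to_iff intro: exI[of _ 0])
  show "sym (shift_rel X \<gamma>)"
  proof (rule symI)
    fix \<alpha> \<beta> assume *: "(\<alpha>, \<beta>) \<in> shift_rel X \<gamma>"
    then obtain c where "\<forall>t. \<alpha> t = \<beta> (t + c)" unfolding shift_rel_def by blast
    then have "\<forall>t. \<beta> t = \<alpha> (t + - c)" by simp
    then show "(\<beta>, \<alpha>) \<in> shift_rel X \<gamma>" using * unfolding shift_rel_def by blast
  qed
  show "trans (shift_rel X \<gamma>)"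
  proof (rule transI)
    fix \<alpha> \<beta> \<delta> assume *: "(\<alpha>, \<beta>) \<in> shift_rel X \<gamma>" "(\<beta>, \<delta>) \<in> shift_rel X \<gamma>"
    then obtain c d where "\<forall>t. \<alpha> t = \<beta> (t + c)" "\<forall>t. \<beta> t = \<delta> (t + d)"
        unfolding shift_rel_def by blast
    then have "\<exists>e. \<forall>t. \<alpha> t = \<delta> (t + e)" by (intro exI[of _ "c + d"]) (simp add: add.assoc)
    then show "(\<alpha>, \<delta>) \<in> shift_rel X \<gamma>" using * by (simp add: shift_rel_def)
  qed
qed

lemma class_memberD:
  assumes "A \<in> S" "\<alpha> \<in> A"
  shows "parallel \<alpha> \<gamma> \<and> A = class_of \<alpha>"
proof -
  obtain \<beta> where \<beta>: "A = class_of \<beta>"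
    using assms(1) unfolding line_classes_def by (auto elim: quotientE)
  then have r: "(\<beta>, \<alpha>) \<in> shift_rel X \<gamma>" using assms(2) by simp
  then have "\<alpha> \<in> lines_parallel_to X \<gamma>" unfolding shift_rel_def by simp
  then show ?thesis
    using \<beta> equiv_class_eq[OF equiv_shift_rel r] lines_parallel_to_iff by simp
qed

lemma class_of_in: "parallel \<alpha> \<gamma> \<Longrightarrow> class_of \<alpha> \<in> S \<and> \<alpha> \<in> class_of \<alpha>"
  unfolding line_classes_def using lines_parallel_to_iff equiv_class_self[OF equiv_shift_rel]
  by (simp add: quotientI)

lemma class_nonempty: "A \<in> S \<Longrightarrow> \<exists>\<alpha>. \<alpha> \<in> A"
  unfolding line_classes_def using equiv_shift_rel in_quotient_imp_non_empty by blast

lemma class_shift: "A \<in> S \<Longrightarrow> \<alpha> \<in> A \<Longrightarrow> \<beta> \<in> A \<longleftrightarrow> (\<exists>d. \<beta> = (\<lambda>t. \<alpha> (t + d)))"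
  using class_memberD[of A \<alpha>] shift_rel_iff by auto

lemma synchronised_iff_flat:
  assumes "parallel \<alpha> \<gamma>"
  shows "synchronised_parallel X \<alpha> \<gamma> \<longleftrightarrow> (\<exists>c. flat_pair c \<alpha> \<gamma>)"
  unfolding synchronised_parallel_def
  using flat_pair_imp_synchronised synchronised_imp_flat_pair parallelD[OF assms] by blast

lemma synchronised_representative:
  assumes "A \<in> S" shows "\<exists>!\<alpha>. \<alpha> \<in> A \<and> synchronised_parallel X \<alpha> \<gamma>"
proof -
  obtain \<alpha> where \<alpha>: "\<alpha> \<in> A" using class_nonempty[OF assms] by blast
  note A = class_memberD[OF assms]
  obtain d c where f: "flat_pair c \<gamma> (\<lambda>t. \<alpha> (t + d))"
    by (rule parallel_flat_pair[OF parallel_sym]) (use A \<alpha> that in auto)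
  have mem: "(\<lambda>t. \<alpha> (t + d)) \<in> A" using class_shift[OF assms \<alpha>] by blast
  show ?thesis
  proof (intro ex1I[of _ "\<lambda>t. \<alpha> (t + d)"] conjI mem)
    show "synchronised_parallel X (\<lambda>t. \<alpha> (t + d)) \<gamma>"
      using synchronised_iff_flat A mem flat_pair_sym[OF f] by blast
  next
    fix \<beta> assume \<beta>: "\<beta> \<in> A \<and> synchronised_parallel X \<beta> \<gamma>"
    then obtain k where k: "flat_pair k \<gamma> \<beta>" using synchronised_iff_flat A flat_pair_sym by blast
    obtain e where e: "\<beta> = (\<lambda>t. \<alpha> (t + e + d))" using class_shift[OF assms mem] \<beta> by auto
    then have "e = 0" using flat_pair_unique(2)[OF f, of k e] k by simp
    then show "\<beta> = (\<lambda>t. \<alpha> (t + d))" using e by simp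
  qed
qed

definition rep :: "(real \<Rightarrow> 'a) set \<Rightarrow> real \<Rightarrow> 'a" where
  "rep A = (THE \<alpha>. \<alpha> \<in> A \<and> synchronised_parallel X \<alpha> \<gamma>)"

lemma rep:
  assumes "A \<in> S"
  shows rep_in: "rep A \<in> A" and rep_synchronised: "synchronised_parallel X (rep A) \<gamma>"
    and rep_parallel: "parallel (rep A) \<gamma>"
    and rep_eqI: "\<alpha> \<in> A \<Longrightarrow> synchronised_parallel X \<alpha> \<gamma> \<Longrightarrow> rep A = \<alpha>"
proof -
  have *: "rep A \<in> A \<and> synchronised_parallel X (rep A) \<gamma>"
    unfolding rep_def by (rule theI'[OF synchronised_representative[OF assms]])
  then show "rep A \<in> A" "synchronised_parallel X (rep A) \<gamma>" by auto
  then show "parallel (rep A) \<gamma>" using class_memberD[OF assms] by blast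
  show "\<alpha> \<in> A \<Longrightarrow> synchronised_parallel X \<alpha> \<gamma> \<Longrightarrow> rep A = \<alpha>"
    using synchronised_representative[OF assms] * by blast
qed

lemma rep_inj:
  assumes "A \<in> S" "B \<in> S" "rep A = rep B" shows "A = B"
  using class_memberD[OF assms(1) rep_in[OF assms(1)]]
      class_memberD[OF assms(2) rep_in[OF assms(2)]] assms(3)
  by simp

lemma rep_line: "A \<in> S \<Longrightarrow> complete_timelike_line X (rep A)"
  using rep_parallel parallelD by blast

lemma rep_flat_pair: "A \<in> S \<Longrightarrow> \<exists>c. flat_pair c (rep A) \<gamma>"
  using synchronised_iff_flat[OF rep_parallel] rep_synchronised by simp

lemma rep_class_of:
  assumes "flat_pair c \<alpha> \<gamma>" shows "class_of \<alpha> \<in> S" "rep (class_of \<alpha>) = \<alpha>"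
proof -
  have "parallel \<alpha> \<gamma>" using flat_pairD(1)[OF assms] .
  then show "class_of \<alpha> \<in> S" "rep (class_of \<alpha>) = \<alpha>"
    using class_of_in[of \<alpha>] rep_eqI[of "class_of \<alpha>" \<alpha>] synchronised_iff_flat[of \<alpha>] assms by auto
qed

text \<open>The infimum is over the intervals \<open>[s, t]\<close> that contain \<open>[a - b - c, a - b + c]\<close>; the shifts
  only translate this smallest interval.\<close>

lemma line_dist_shift:
  assumes f: "flat_pair c \<alpha> \<beta>"
  shows "line_dist X (\<lambda>t. \<alpha> (t + a)) (\<lambda>t. \<beta> (t + b)) = c"
proof -
  let ?D = "{(t - s) / 2 | s t. caus X (\<beta> (s + b)) (\<alpha> (0 + a)) \<and> caus X (\<alpha> (0 + a)) (\<beta> (t + b))}"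
  have "?D = {(t - s) / 2 | s t. c \<le> a - s - b \<and> c \<le> t + b - a}"
    using flat_pairD(3,4)[OF f] by (simp add: algebra_simps)
  also have "Inf \<dots> = c"
  proof (rule cInf_eq_minimum)
    show "c \<in> {(t - s) / 2 | s t. c \<le> a - s - b \<and> c \<le> t + b - a}"
      by (intro CollectI exI[of _ "a - b - c"] exI[of _ "a - b + c"]) auto
  qed auto
  finally show ?thesis unfolding line_dist_def .
qed

lemma flat_pair_rep:
  assumes "A \<in> S" "B \<in> S"
  shows "flat_pair (class_dist X \<gamma> A B) (rep A) (rep B)"
    and "\<alpha> \<in> A \<Longrightarrow> \<beta> \<in> B \<Longrightarrow> class_dist X \<gamma> A B = line_dist X \<alpha> \<beta>"
proof -
  obtain a b where a: "flat_pair a (rep A) \<gamma>" and b: "flat_pair b (rep B) \<gamma>"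
    using rep_flat_pair[OF assms(1)] rep_flat_pair[OF assms(2)] by auto
  obtain c where c: "flat_pair c (rep A) (rep B)"
    by (rule flat_pair_trans[OF a flat_pair_sym[OF b]]) (rule that)
  have ld: "line_dist X \<alpha> \<beta> = c" if "\<alpha> \<in> A" "\<beta> \<in> B" for \<alpha> \<beta>
    using class_shift[OF assms(1) rep_in[OF assms(1)]] class_shift[OF assms(2) rep_in[OF assms(2)]]
      line_dist_shift[OF c] that by auto
  have "class_dist X \<gamma> A B = c" unfolding class_dist_def
    using assms ld[OF someI_ex[OF class_nonempty[OF assms(1)]]
        someI_ex[OF class_nonempty[OF assms(2)]]] by simp
  then show "flat_pair (class_dist X \<gamma> A B) (rep A) (rep B)"
    "\<alpha> \<in> A \<Longrightarrow> \<beta> \<in> B \<Longrightarrow> class_dist X \<gamma> A B = line_dist X \<alpha> \<beta>" using c ld by auto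
qed

lemma class_dist_eqI:
  assumes "A \<in> S" "B \<in> S" "flat_pair c (rep A) (rep B)"
  shows "class_dist X \<gamma> A B = c"
  using flat_pair_unique(1)[OF flat_pair_rep(1)[OF assms(1,2)], of c 0] assms(3) by simp

lemma class_dist_metric: "Metric_space S (class_dist X \<gamma>)"
proof
  fix A B
  show "0 \<le> class_dist X \<gamma> A B"
    using flat_pairD(2)[OF flat_pair_rep(1)] by (cases "A \<in> S \<and> B \<in> S") (auto simp: class_dist_def)
  show "class_dist X \<gamma> A B = class_dist X \<gamma> B A"
  proof (cases "A \<in> S \<and> B \<in> S")
    case True
    then show ?thesis using class_dist_eqI[OF _ _ flat_pair_sym[OF flat_pair_rep(1)], of B A]
        by simp
  qed (auto simp: class_dist_def)
next
  fix A B assume AB: "A \<in> S" "B \<in> S"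
  show "class_dist X \<gamma> A B = 0 \<longleftrightarrow> A = B"
  proof
    assume "class_dist X \<gamma> A B = 0"
    then have "rep B = rep A" using flat_pair_0_eq flat_pair_rep(1)[OF AB] by simp
    then show "A = B" by (intro rep_inj[OF AB]) simp
  next
    assume "A = B"
    then show "class_dist X \<gamma> A B = 0"
        using class_dist_eqI[OF AB] flat_pair_refl[OF rep_line[OF AB(1)]] by simp
  qed
next
  fix A B C assume *: "A \<in> S" "B \<in> S" "C \<in> S"
  obtain c where "flat_pair c (rep A) (rep C)" "c \<le> class_dist X \<gamma> A B + class_dist X \<gamma> B C"
    by (rule flat_pair_trans[OF flat_pair_rep(1)[OF *(1,2)]
      flat_pair_rep(1)[OF *(2,3)]]) (rule that)
  then show "class_dist X \<gamma> A C \<le> class_dist X \<gamma> A B + class_dist X \<gamma> B C"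
    using class_dist_eqI * by simp
qed

lemma line_classes_geodesic:
  assumes "A \<in> S" "B \<in> S"
  shows "\<exists>G. metric_segment S (class_dist X \<gamma>) A B G"
proof -
  define c where "c = class_dist X \<gamma> A B"
  note f = flat_pair_rep(1)[OF assms, folded c_def]
  have c: "0 \<le> c" by (rule flat_pairD(2)[OF f])
  obtain \<mu> where \<mu>: "\<mu> 0 = rep A" "\<mu> 1 = rep B"
    "\<And>k l. 0 \<le> k \<Longrightarrow> k \<le> l \<Longrightarrow> l \<le> 1 \<Longrightarrow> flat_pair ((l - k) * c) (\<mu> k) (\<mu> l)"
    by (rule strip_foliation[OF f]) (rule that)
  obtain a where a: "flat_pair a (rep A) \<gamma>" using rep_flat_pair[OF assms(1)] by auto
  have flat: "\<exists>k. flat_pair k (\<mu> l) \<gamma>" if l: "0 \<le> l" "l \<le> 1" for l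
  proof -
    have "flat_pair ((l - 0) * c) (rep A) (\<mu> l)"
        unfolding \<mu>(1)[symmetric] by (rule \<mu>(3)) (use l in auto)
    from flat_pair_trans[OF flat_pair_sym[OF this] a] show ?thesis by blast
  qed
  \<comment> \<open>for \<open>c = 0\<close> the quotient is \<open>0\<close>, and \<open>\<sigma>\<close> is the constant curve at \<open>A\<close>\<close>
  define \<sigma> where "\<sigma> s = class_of (\<mu> (s / c))" for s
  have frac: "0 \<le> s / c" "s / c \<le> 1" if "s \<in> {0..c}" for s using that c by (auto simp: divide_le_eq)
  have cls: "\<sigma> s \<in> S" "rep (\<sigma> s) = \<mu> (s / c)" if "s \<in> {0..c}" for s
    unfolding \<sigma>_def using flat[OF frac[OF that]] rep_class_of by blast+
  have ends: "\<sigma> 0 = A" "\<sigma> c = B"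
  proof -
    show "\<sigma> 0 = A" by (rule rep_inj) (use cls[of 0] c \<mu> assms in auto)
    show "\<sigma> c = B"
    proof (cases "c = 0")
      case True
      then have "A = B" using Metric_space.zero[OF class_dist_metric assms] c_def by simp
      then show ?thesis using \<open>\<sigma> 0 = A\<close> True by simp
    next
      case False
      show ?thesis by (rule rep_inj) (use cls[of c] c False \<mu> assms in auto)
    qed
  qed
  have dist_le: "class_dist X \<gamma> (\<sigma> s) (\<sigma> t) = t - s" if st: "s \<in> {0..c}" "t \<in> {0..c}" "s \<le> t"
      for s t
  proof (rule class_dist_eqI)
    show "\<sigma> s \<in> S" "\<sigma> t \<in> S" using cls st by auto
    have "s / c \<le> t / c" using st c by (simp add: divide_right_mono)
    from \<mu>(3)[OF frac(1)[OF st(1)] this frac(2)[OF st(2)]]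
    have "flat_pair ((t / c - s / c) * c) (\<mu> (s / c)) (\<mu> (t / c))" .
    moreover have "(t / c - s / c) * c = t - s"
        using st by (cases "c = 0") (auto simp: algebra_simps)
    ultimately show "flat_pair (t - s) (rep (\<sigma> s)) (rep (\<sigma> t))" using cls st by simp
  qed
  have "class_dist X \<gamma> (\<sigma> s) (\<sigma> t) = \<bar>s - t\<bar>" if "s \<in> {0..c}" "t \<in> {0..c}" for s t
    using dist_le[of s t] dist_le[of t s] Metric_space.commute[OF class_dist_metric, of "\<sigma> s"
        "\<sigma> t"] that
    by (cases "s \<le> t") auto
  then have "metric_segment S (class_dist X \<gamma>) A B (\<sigma> ` {0..c})"
    unfolding metric_segment_def c_def[symmetric] using ends cls by (intro exI[of _ \<sigma>]) auto
  then show ?thesis by blast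
qed

lemma line_classes_CAT0: "CAT0_space S (class_dist X \<gamma>)"
proof (rule CAT0_of_CN[OF class_dist_metric line_classes_geodesic])
  fix A B C P and l :: real
  assume *: "A \<in> S" "B \<in> S" "C \<in> S" "P \<in> S" "0 \<le> l" "l \<le> 1"
    and d: "class_dist X \<gamma> B P = l * class_dist X \<gamma> B C"
        "class_dist X \<gamma> P C = (1 - l) * class_dist X \<gamma> B C"
  show "(class_dist X \<gamma> A P)\<^sup>2 \<le> (1 - l) * (class_dist X \<gamma> A B)\<^sup>2 + l * (class_dist X \<gamma> A C)\<^sup>2
      - l * (1 - l) * (class_dist X \<gamma> B C)\<^sup>2"
    using flat_pair_rep(1)[OF *(2,4)] flat_pair_rep(1)[OF *(4,3)] unfolding d
    by (intro flat_pair_CN[OF flat_pair_rep(1)[OF *(1,2)] flat_pair_rep(1)[OF *(1,3)]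
      flat_pair_rep(1)[OF *(2,3)]
      _ _ flat_pair_rep(1)[OF *(1,4)] *(5,6)])
qed

lemma splitting_map_eq: "splitting_map X \<gamma> (t, A) = rep A t"
  by (simp add: splitting_map_def rep_def)

lemma range_splitting_map:
  "splitting_map X \<gamma> ` (UNIV \<times> S) = (\<Union>A\<in>S. \<Union>\<alpha>\<in>A. range \<alpha>)"
proof
  show "splitting_map X \<gamma> ` (UNIV \<times> S) \<subseteq> (\<Union>A\<in>S. \<Union>\<alpha>\<in>A. range \<alpha>)"
    using rep_in by (fastforce simp: splitting_map_eq)
  show "(\<Union>A\<in>S. \<Union>\<alpha>\<in>A. range \<alpha>) \<subseteq> splitting_map X \<gamma> ` (UNIV \<times> S)"
  proof clarify
    fix A \<alpha> t assume A: "A \<in> S" "\<alpha> \<in> A"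
    then obtain d where "\<alpha> = (\<lambda>t. rep A (t + d))"
        using class_shift[OF A(1) rep_in[OF A(1)]] by blast
    then have "\<alpha> t = splitting_map X \<gamma> (t + d, A)" by (simp add: splitting_map_eq)
    then show "\<alpha> t \<in> splitting_map X \<gamma> ` (UNIV \<times> S)" using A by blast
  qed
qed

lemma splitting_map_isometric:
  assumes "A \<in> S" "B \<in> S"
  shows "tsep X (splitting_map X \<gamma> (s, A)) (splitting_map X \<gamma> (t, B)) =
      tsep (lorentz_product S (class_dist X \<gamma>)) (s, A) (t, B)"
    and "caus X (splitting_map X \<gamma> (s, A)) (splitting_map X \<gamma> (t, B)) \<longleftrightarrow>
      caus (lorentz_product S (class_dist X \<gamma>)) (s, A) (t, B)"
proof -
  note f = flat_pairD[OF flat_pair_rep(1)[OF assms]]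
  show "tsep X (splitting_map X \<gamma> (s, A)) (splitting_map X \<gamma> (t, B)) =
      tsep (lorentz_product S (class_dist X \<gamma>)) (s, A) (t, B)"
    using f(5) parallel_fin[OF f(1)] by (simp add: splitting_map_eq lorentz_product_def tsep_eq_T)
  show "caus X (splitting_map X \<gamma> (s, A)) (splitting_map X \<gamma> (t, B)) \<longleftrightarrow>
      caus (lorentz_product S (class_dist X \<gamma>)) (s, A) (t, B)"
    using f(3) by (simp add: splitting_map_eq lorentz_product_def)
qed

lemma inj_splitting_map: "inj_on (splitting_map X \<gamma>) (UNIV \<times> S)"
proof (rule inj_onI, clarify)
  fix s t A B assume AB: "A \<in> S" "B \<in> S"
      and eq: "splitting_map X \<gamma> (s, A) = splitting_map X \<gamma> (t, B)"
  have p: "rep A s \<in> pts X" using rep_line AB line_pts by blast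
  have "rep A s = rep B t" using eq by (simp add: splitting_map_eq)
  then have "caus X (rep A s) (rep B t)" "caus X (rep B t) (rep A s)" using caus_refl[OF p] by auto
  then have *: "class_dist X \<gamma> A B \<le> t - s" "class_dist X \<gamma> A B \<le> s - t"
    using flat_pairD(3,4)[OF flat_pair_rep(1)[OF AB]] by auto
  then have "class_dist X \<gamma> A B = 0" "s = t" using flat_pairD(2)[OF flat_pair_rep(1)[OF AB]] by auto
  then show "s = t \<and> A = B" using Metric_space.zero[OF class_dist_metric AB] by simp
qed

lemma splitting_map_embedding:
  "isometric_embedding (lorentz_product S (class_dist X \<gamma>)) X (splitting_map X \<gamma>)"
proof -
  have pts: "pts (lorentz_product S (class_dist X \<gamma>)) = UNIV \<times> S" by (simp add: lorentz_product_def)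
  have "splitting_map X \<gamma> ` (UNIV \<times> S) \<subseteq> pts X"
    using rep_line line_pts by (auto simp: splitting_map_eq)
  then show ?thesis unfolding isometric_embedding_def isometry_def pts
    using inj_splitting_map splitting_map_isometric by (auto simp: bij_betw_def)
qed

lemma isometric_to_product:
  assumes "pts X = (\<Union>A\<in>S. \<Union>\<alpha>\<in>A. range \<alpha>)"
  shows "isometric_lspaces X (lorentz_product S (class_dist X \<gamma>))"
proof -
  let ?f = "splitting_map X \<gamma>" and ?g = "the_inv_into (UNIV \<times> S) (splitting_map X \<gamma>)"
  have bij: "bij_betw ?f (UNIV \<times> S) (pts X)"
    unfolding bij_betw_def using inj_splitting_map range_splitting_map assms by simp
  have g: "?g x \<in> UNIV \<times> S" "?f (?g x) = x" if "x \<in> pts X" for x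
    using bij_betwE[OF bij_betw_the_inv_into[OF bij]] f_the_inv_into_f_bij_betw[OF bij] that by auto
  have "isometry X (lorentz_product S (class_dist X \<gamma>)) ?g"
    unfolding isometry_def
  proof (intro conjI ballI)
    show "bij_betw ?g (pts X) (pts (lorentz_product S (class_dist X \<gamma>)))"
      using bij_betw_the_inv_into[OF bij] by (simp add: lorentz_product_def)
  next
    fix x y assume xy: "x \<in> pts X" "y \<in> pts X"
    obtain s A t B where eq: "?g x = (s, A)" "?g y = (t, B)" and AB: "A \<in> S" "B \<in> S"
      using g(1)[OF xy(1)] g(1)[OF xy(2)] by (metis SigmaE)
    show "tsep (lorentz_product S (class_dist X \<gamma>)) (?g x) (?g y) = tsep X x y"
      "caus (lorentz_product S (class_dist X \<gamma>)) (?g x) (?g y) = caus X x y"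
      using splitting_map_isometric[OF AB, of s t] g(2)[OF xy(1)] g(2)[OF xy(2)]
          unfolding eq by simp_all
  qed
  then show ?thesis unfolding isometric_lspaces_def by blast
qed

lemma synchronised_pair:
  assumes "A \<in> S" "B \<in> S" "\<alpha> \<in> A" "\<beta> \<in> B" "synchronised_parallel X \<alpha> \<gamma>"
      "synchronised_parallel X \<beta> \<gamma>"
  shows "synchronised_parallel_at X (class_dist X \<gamma> A B) \<alpha> \<beta>"
proof -
  have "rep A = \<alpha>" "rep B = \<beta>" using rep_eqI assms by blast+
  then show ?thesis using flat_pair_imp_synchronised[OF flat_pair_rep(1)[OF assms(1,2)]] by simp
qed

end

theorem theorem1p1:
  fixes X :: "'a lspace" and \<gamma> :: "real \<Rightarrow> 'a"
  assumes "lorentzian_pre_length_space X"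
    and "timelike_curvature_bounded_above_0 X"
    and "unique_timelike_geodesics X"
    and "causally_closed X"
    and "complete_timelike_line X \<gamma>"
  shows
    "((\<forall>A\<in>line_classes X \<gamma>. \<exists>\<alpha>\<in>A. synchronised_parallel X \<alpha> \<gamma>) \<and>
      (\<forall>A\<in>line_classes X \<gamma>. \<forall>B\<in>line_classes X \<gamma>. \<forall>\<alpha>\<in>A. \<forall>\<beta>\<in>B.
         synchronised_parallel X \<alpha> \<gamma> \<longrightarrow> synchronised_parallel X \<beta> \<gamma> \<longrightarrow>
         synchronised_parallel X \<alpha> \<beta>)) \<and>
     (\<forall>A\<in>line_classes X \<gamma>. \<forall>B\<in>line_classes X \<gamma>. \<forall>\<alpha>\<in>A. \<forall>\<beta>\<in>B.
         class_dist X \<gamma> A B = line_dist X \<alpha> \<beta> \<and>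
         (synchronised_parallel X \<alpha> \<gamma> \<longrightarrow> synchronised_parallel X \<beta> \<gamma> \<longrightarrow>
          synchronised_parallel_at X (class_dist X \<gamma> A B) \<alpha> \<beta>)) \<and>
     (Metric_space (line_classes X \<gamma>) (class_dist X \<gamma>) \<and>
      CAT0_space (line_classes X \<gamma>) (class_dist X \<gamma>) \<and>
      (\<forall>A\<in>line_classes X \<gamma>. \<exists>!\<alpha>. \<alpha> \<in> A \<and> synchronised_parallel X \<alpha> \<gamma>) \<and>
      isometric_embedding (lorentz_product (line_classes X \<gamma>) (class_dist X \<gamma>)) X
        (splitting_map X \<gamma>) \<and>
      splitting_map X \<gamma> ` (UNIV \<times> line_classes X \<gamma>) =
        (\<Union>A\<in>line_classes X \<gamma>. \<Union>\<alpha>\<in>A. range \<alpha>)) \<and>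
     (pts X = (\<Union>A\<in>line_classes X \<gamma>. \<Union>\<alpha>\<in>A. range \<alpha>) \<longrightarrow>
      isometric_lspaces X (lorentz_product (line_classes X \<gamma>) (class_dist X \<gamma>)) \<and>
      CAT0_space (line_classes X \<gamma>) (class_dist X \<gamma>))"
proof -
  interpret line_splitting X \<gamma> by unfold_locales (use assms in auto)
  show ?thesis
  proof (intro conjI ballI impI)
    fix A assume A: "A \<in> line_classes X \<gamma>"
    show "\<exists>\<alpha>\<in>A. synchronised_parallel X \<alpha> \<gamma>" using rep_in[OF A] rep_synchronised[OF A] by blast
    show "\<exists>!\<alpha>. \<alpha> \<in> A \<and> synchronised_parallel X \<alpha> \<gamma>" by (rule synchronised_representative[OF A])
  next
    fix A B \<alpha> \<beta>
    assume *: "A \<in> line_classes X \<gamma>" "B \<in> line_classes X \<gamma>" "\<alpha> \<in> A" "\<beta> \<in> B"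
    show "class_dist X \<gamma> A B = line_dist X \<alpha> \<beta>" by (rule flat_pair_rep(2)[OF *])
    assume "synchronised_parallel X \<alpha> \<gamma>" "synchronised_parallel X \<beta> \<gamma>"
    then show at: "synchronised_parallel_at X (class_dist X \<gamma> A B) \<alpha> \<beta>"
        by (rule synchronised_pair[OF *])
    then show "synchronised_parallel X \<alpha> \<beta>" unfolding synchronised_parallel_def by blast
  next
    show "Metric_space (line_classes X \<gamma>) (class_dist X \<gamma>)" by (rule class_dist_metric)
    show "CAT0_space (line_classes X \<gamma>) (class_dist X \<gamma>)" by (rule line_classes_CAT0)
    then show "CAT0_space (line_classes X \<gamma>) (class_dist X \<gamma>)" .
    show "isometric_embedding (lorentz_product (line_classes X \<gamma>) (class_dist X \<gamma>)) X
        (splitting_map X \<gamma>)"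
      by (rule splitting_map_embedding)
    show "splitting_map X \<gamma> ` (UNIV \<times> line_classes X \<gamma>) = (\<Union>A\<in>line_classes X \<gamma>. \<Union>\<alpha>\<in>A. range \<alpha>)"
      by (rule range_splitting_map)
  next
    assume "pts X = (\<Union>A\<in>line_classes X \<gamma>. \<Union>\<alpha>\<in>A. range \<alpha>)"
    then show "isometric_lspaces X (lorentz_product (line_classes X \<gamma>) (class_dist X \<gamma>))"
      by (rule isometric_to_product)
  qed
qed

end
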